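(* Let $\mathcal{M}$ be a model category and let $\mathcal{M}_{\mathrm{cf}}$ be the full subcategory of cofibrant–fibrant objects in $\mathcal{M}$. If $\mathcal{M}$ is Quillen-equivalent to the Joyal model category for quasicategories, then there exist a 2-category $\mathfrak{M}$ and a 2-functor $\tilde{F} : \mathfrak{M} \to \mathfrak{Qcat}$ with the following properties: - $\tilde{F} : \mathfrak{M} \to \mathfrak{Qcat}$ is a bicategorical equivalence. - The underlying functor of $\tilde{F}$ is a functor $F : \mathcal{M}_{\mathrm{cf}} \to \mathbf{Qcat}$ that preserves weak equivalences. - The induced functor $\mathrm{Ho}\,F : \mathrm{Ho}\,\mathcal{M}_{\mathrm{cf}} \to \mathrm{Ho}\,\mathbf{Qcat}$ is a categorical equivalence.
   Context: Model categories are complete, cocomplete and have functorial factorisations. Two model categories are Quillen-equivalent if they are connected by a finite zigzag of Quillen equivalences. $\mathbf{sSet}$ is the category of simplicial sets, with exponentials $[X,Y]$; $\mathrm{N} : \mathbf{Cat} \to \mathbf{sSet}$ is the nerve and $\tau_1 : \mathbf{sSet} \to \mathbf{Cat}$ its left adjoint, which preserves finite products; $\tau_0 X$ is the set of isomorphism classes of objects in $\tau_1 X$. A quasicategory is a simplicial set $X$ such that $X \to 1$ has the right lifting property against all inner horn inclusions $\Lambda^n_i \hookrightarrow \Delta^n$ ($n\ge 2$, $0<i<n$). A weak categorical equivalence is a morphism $F : X \to Y$ of simplicial sets such that $\tau_0[F,Z] : \tau_0[Y,Z]\to\tau_0[X,Z]$ is bijective for all quasicategories $Z$. The Joyal model structure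 on $\mathbf{sSet}$ has weak categorical equivalences as weak equivalences and monomorphisms as cofibrations; its fibrant objects are the quasicategories. $\mathbf{Qcat}$ is the full subcategory of quasicategories (its weak equivalences are the weak categorical equivalences), which is closed under products and exponentials in $\mathbf{sSet}$. $\mathfrak{Qcat}$ is the 2-category with quasicategories as objects and hom-categories $\tau_1[X,Y]$; its underlying ordinary category is $\mathbf{Qcat}$. $\mathrm{Ho}$ of a category with weak equivalences is its localisation at the weak equivalences. A categorical equivalence is a fully faithful, essentially surjective functor. A bicategorical equivalence is a pseudofunctor that is surjective on objects up to equivalence and induces equivalences on hom-categories. *)

theory Defs
  imports Main "HOL-Library.FuncSet"
begin

unbundle cardinal_syntax

section \<open>Size\<close>

text \<open>
  The type \<open>'u\<close> plays the role of the universe of sets: its cardinality is an uncountable strongly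
  inaccessible cardinal, and the small sets are those of strictly smaller cardinality.
  HOL does not prove that such a type exists (in the same way as ZFC does not prove that
  uncountable Grothendieck universes exist), so this is a type class without instances.
\<close>

class universe =
  assumes universe_uncountable: "|UNIV :: nat set| <o |UNIV :: 'a set|"
    and universe_strong_limit: "|A :: 'a set| <o |UNIV :: 'a set| \<Longrightarrow> |Pow A| <o |UNIV :: 'a set|"
    and universe_regular: "regularCard |UNIV :: 'a set|"

definition small :: "'u::universe set \<Rightarrow> bool" where
  "small A \<longleftrightarrow> |A| <o |UNIV :: 'u set|"


section \<open>Categories, functors, natural transformations\<close>

text \<open>
  Hom-sets are indexed by pairs of objects and need not be disjoint, so every operation on arrows
  takes the objects involved as arguments: \<open>Comp C X Y Z g f\<close> is the composite of
  \<open>f : X \<rightarrow> Y\<close> and \<open>g : Y \<rightarrow> Z\<close>. Values at non-objects and non-arrows are irrelevant.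
\<close>

record ('o, 'm) cat =
  Ob :: "'o set"
  Hom :: "'o \<Rightarrow> 'o \<Rightarrow> 'm set"
  Id :: "'o \<Rightarrow> 'm"
  Comp :: "'o \<Rightarrow> 'o \<Rightarrow> 'o \<Rightarrow> 'm \<Rightarrow> 'm \<Rightarrow> 'm"

definition category :: "('o, 'm, 'z) cat_scheme \<Rightarrow> bool" where
  "category C \<longleftrightarrow>
    (\<forall>X\<in>Ob C. Id C X \<in> Hom C X X) \<and>
    (\<forall>X\<in>Ob C. \<forall>Y\<in>Ob C. \<forall>Z\<in>Ob C. \<forall>f\<in>Hom C X Y. \<forall>g\<in>Hom C Y Z. Comp C X Y Z g f \<in> Hom C X Z) \<and>
    (\<forall>X\<in>Ob C. \<forall>Y\<in>Ob C. \<forall>f\<in>Hom C X Y.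
       Comp C X X Y f (Id C X) = f \<and> Comp C X Y Y (Id C Y) f = f) \<and>
    (\<forall>W\<in>Ob C. \<forall>X\<in>Ob C. \<forall>Y\<in>Ob C. \<forall>Z\<in>Ob C. \<forall>f\<in>Hom C W X. \<forall>g\<in>Hom C X Y. \<forall>h\<in>Hom C Y Z.
       Comp C W X Z (Comp C X Y Z h g) f = Comp C W Y Z h (Comp C W X Y g f))"

definition op_cat :: "('o, 'm, 'z) cat_scheme \<Rightarrow> ('o, 'm) cat" where
  "op_cat C = \<lparr>Ob = Ob C, Hom = (\<lambda>X Y. Hom C Y X), Id = Id C,
     Comp = (\<lambda>X Y Z g f. Comp C Z Y X f g)\<rparr>"

definition prod_cat ::
  "('o, 'm, 'z) cat_scheme \<Rightarrow> ('p, 'n, 'w) cat_scheme \<Rightarrow> ('o \<times> 'p, 'm \<times> 'n) cat" where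
  "prod_cat C D =
    \<lparr>Ob = Ob C \<times> Ob D,
     Hom = (\<lambda>(X, X') (Y, Y'). Hom C X Y \<times> Hom D X' Y'),
     Id = (\<lambda>(X, X'). (Id C X, Id D X')),
     Comp = (\<lambda>(X, X') (Y, Y') (Z, Z') (g, g') (f, f'). (Comp C X Y Z g f, Comp D X' Y' Z' g' f'))\<rparr>"

text \<open>The functor category of arrows: objects are arrows, morphisms are commutative squares.\<close>

definition arrow_cat :: "('o, 'm, 'z) cat_scheme \<Rightarrow> ('o \<times> 'o \<times> 'm, 'm \<times> 'm) cat" where
  "arrow_cat C =
    \<lparr>Ob = {(X, Y, f). X \<in> Ob C \<and> Y \<in> Ob C \<and> f \<in> Hom C X Y},
     Hom = (\<lambda>(X, Y, f) (X', Y', f').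
       {(u, v). u \<in> Hom C X X' \<and> v \<in> Hom C Y Y' \<and> Comp C X X' Y' f' u = Comp C X Y Y' v f}),
     Id = (\<lambda>(X, Y, f). (Id C X, Id C Y)),
     Comp = (\<lambda>(X, Y, f) (X', Y', f') (X'', Y'', f'') (u', v') (u, v).
       (Comp C X X' X'' u' u, Comp C Y Y' Y'' v' v))\<rparr>"

definition full_subcat ::
  "('o, 'm, 'z) cat_scheme \<Rightarrow> ('o \<Rightarrow> bool) \<Rightarrow> ('o, 'm, 'z) cat_scheme" where
  "full_subcat C P = C\<lparr>Ob := {X \<in> Ob C. P X}\<rparr>"

definition inverse_arrows :: "('o, 'm, 'z) cat_scheme \<Rightarrow> 'o \<Rightarrow> 'o \<Rightarrow> 'm \<Rightarrow> 'm \<Rightarrow> bool" where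
  "inverse_arrows C X Y f g \<longleftrightarrow> f \<in> Hom C X Y \<and> g \<in> Hom C Y X \<and>
     Comp C X Y X g f = Id C X \<and> Comp C Y X Y f g = Id C Y"

definition isomorphic :: "('o, 'm, 'z) cat_scheme \<Rightarrow> 'o \<Rightarrow> 'o \<Rightarrow> bool" where
  "isomorphic C X Y \<longleftrightarrow> X \<in> Ob C \<and> Y \<in> Ob C \<and> (\<exists>f g. inverse_arrows C X Y f g)"

definition iso_classes :: "('o, 'm, 'z) cat_scheme \<Rightarrow> 'o set set" where
  "iso_classes C = Ob C // {(X, Y). isomorphic C X Y}"

definition monomorphism :: "('o, 'm, 'z) cat_scheme \<Rightarrow> 'o \<Rightarrow> 'o \<Rightarrow> 'm \<Rightarrow> bool" where
  "monomorphism C X Y f \<longleftrightarrow> f \<in> Hom C X Y \<and>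
     (\<forall>T\<in>Ob C. \<forall>u\<in>Hom C T X. \<forall>v\<in>Hom C T X. Comp C T X Y f u = Comp C T X Y f v \<longrightarrow> u = v)"

definition initial :: "('o, 'm, 'z) cat_scheme \<Rightarrow> 'o \<Rightarrow> bool" where
  "initial C I \<longleftrightarrow> I \<in> Ob C \<and> (\<forall>X\<in>Ob C. \<exists>!f. f \<in> Hom C I X)"

definition terminal :: "('o, 'm, 'z) cat_scheme \<Rightarrow> 'o \<Rightarrow> bool" where
  "terminal C T \<longleftrightarrow> T \<in> Ob C \<and> (\<forall>X\<in>Ob C. \<exists>!f. f \<in> Hom C X T)"

record ('o, 'm, 'p, 'n) fctr =
  FOb :: "'o \<Rightarrow> 'p"
  FArr :: "'o \<Rightarrow> 'o \<Rightarrow> 'm \<Rightarrow> 'n"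

definition is_functor ::
  "('o, 'm, 'z) cat_scheme \<Rightarrow> ('p, 'n, 'w) cat_scheme \<Rightarrow> ('o, 'm, 'p, 'n) fctr \<Rightarrow> bool" where
  "is_functor C D F \<longleftrightarrow> category C \<and> category D \<and>
    (\<forall>X\<in>Ob C. FOb F X \<in> Ob D) \<and>
    (\<forall>X\<in>Ob C. \<forall>Y\<in>Ob C. \<forall>f\<in>Hom C X Y. FArr F X Y f \<in> Hom D (FOb F X) (FOb F Y)) \<and>
    (\<forall>X\<in>Ob C. FArr F X X (Id C X) = Id D (FOb F X)) \<and>
    (\<forall>X\<in>Ob C. \<forall>Y\<in>Ob C. \<forall>Z\<in>Ob C. \<forall>f\<in>Hom C X Y. \<forall>g\<in>Hom C Y Z.
       FArr F X Z (Comp C X Y Z g f) =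
         Comp D (FOb F X) (FOb F Y) (FOb F Z) (FArr F Y Z g) (FArr F X Y f))"

definition nat_trans ::
  "('o, 'm, 'z) cat_scheme \<Rightarrow> ('p, 'n, 'w) cat_scheme \<Rightarrow>
   ('o, 'm, 'p, 'n) fctr \<Rightarrow> ('o, 'm, 'p, 'n) fctr \<Rightarrow> ('o \<Rightarrow> 'n) \<Rightarrow> bool" where
  "nat_trans C D F G \<eta> \<longleftrightarrow> is_functor C D F \<and> is_functor C D G \<and>
    (\<forall>X\<in>Ob C. \<eta> X \<in> Hom D (FOb F X) (FOb G X)) \<and>
    (\<forall>X\<in>Ob C. \<forall>Y\<in>Ob C. \<forall>f\<in>Hom C X Y.
       Comp D (FOb F X) (FOb F Y) (FOb G Y) (\<eta> Y) (FArr F X Y f) =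
       Comp D (FOb F X) (FOb G X) (FOb G Y) (FArr G X Y f) (\<eta> X))"

text \<open>An adjunction \<open>F \<stileturn> G\<close>, given by bijections \<open>\<phi> X Y : Hom (F X) Y \<cong> Hom X (G Y)\<close>.\<close>

definition adjunction ::
  "('o, 'm, 'z) cat_scheme \<Rightarrow> ('p, 'n, 'w) cat_scheme \<Rightarrow>
   ('o, 'm, 'p, 'n) fctr \<Rightarrow> ('p, 'n, 'o, 'm) fctr \<Rightarrow> ('o \<Rightarrow> 'p \<Rightarrow> 'n \<Rightarrow> 'm) \<Rightarrow> bool" where
  "adjunction C D F G \<phi> \<longleftrightarrow> is_functor C D F \<and> is_functor D C G \<and>
    (\<forall>X\<in>Ob C. \<forall>Y\<in>Ob D. bij_betw (\<phi> X Y) (Hom D (FOb F X) Y) (Hom C X (FOb G Y))) \<and>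
    (\<forall>X\<in>Ob C. \<forall>X'\<in>Ob C. \<forall>Y\<in>Ob D. \<forall>Y'\<in>Ob D.
     \<forall>u\<in>Hom C X' X. \<forall>f\<in>Hom D (FOb F X) Y. \<forall>v\<in>Hom D Y Y'.
       \<phi> X' Y' (Comp D (FOb F X') Y Y' v (Comp D (FOb F X') (FOb F X) Y f (FArr F X' X u))) =
       Comp C X' (FOb G Y) (FOb G Y') (FArr G Y Y' v) (Comp C X' X (FOb G Y) (\<phi> X Y f) u))"

definition categorical_equivalence ::
  "('o, 'm, 'z) cat_scheme \<Rightarrow> ('p, 'n, 'w) cat_scheme \<Rightarrow> ('o, 'm, 'p, 'n) fctr \<Rightarrow> bool" where
  "categorical_equivalence C D F \<longleftrightarrow> is_functor C D F \<and>
    (\<forall>X\<in>Ob C. \<forall>Y\<in>Ob C. bij_betw (FArr F X Y) (Hom C X Y) (Hom D (FOb F X) (FOb F Y))) \<and>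
    (\<forall>Y\<in>Ob D. \<exists>X\<in>Ob C. isomorphic D (FOb F X) Y)"


section \<open>Limits and colimits\<close>

definition small_category :: "('u::universe, 'u) cat \<Rightarrow> bool" where
  "small_category J \<longleftrightarrow> category J \<and> small (Ob J) \<and> (\<forall>i\<in>Ob J. \<forall>j\<in>Ob J. small (Hom J i j))"

definition cone ::
  "('i, 'a, 'z) cat_scheme \<Rightarrow> ('o, 'm, 'w) cat_scheme \<Rightarrow> ('i, 'a, 'o, 'm) fctr \<Rightarrow>
   'o \<Rightarrow> ('i \<Rightarrow> 'm) \<Rightarrow> bool" where
  "cone J C D L p \<longleftrightarrow> L \<in> Ob C \<and> (\<forall>i\<in>Ob J. p i \<in> Hom C L (FOb D i)) \<and>
    (\<forall>i\<in>Ob J. \<forall>j\<in>Ob J. \<forall>a\<in>Hom J i j. Comp C L (FOb D i) (FOb D j) (FArr D i j a) (p i) = p j)"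

definition limit_cone ::
  "('i, 'a, 'z) cat_scheme \<Rightarrow> ('o, 'm, 'w) cat_scheme \<Rightarrow> ('i, 'a, 'o, 'm) fctr \<Rightarrow>
   'o \<Rightarrow> ('i \<Rightarrow> 'm) \<Rightarrow> bool" where
  "limit_cone J C D L p \<longleftrightarrow> cone J C D L p \<and>
    (\<forall>T q. cone J C D T q \<longrightarrow>
      (\<exists>!h. h \<in> Hom C T L \<and> (\<forall>i\<in>Ob J. Comp C T L (FOb D i) (p i) h = q i)))"

definition complete_cat :: "'u::universe itself \<Rightarrow> ('o, 'm, 'z) cat_scheme \<Rightarrow> bool" where
  "complete_cat U C \<longleftrightarrow>
    (\<forall>(J :: ('u, 'u) cat) D. small_category J \<longrightarrow> is_functor J C D \<longrightarrow> (\<exists>L p. limit_cone J C D L p))"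

definition cocomplete_cat :: "'u::universe itself \<Rightarrow> ('o, 'm, 'z) cat_scheme \<Rightarrow> bool" where
  "cocomplete_cat U C \<longleftrightarrow> complete_cat U (op_cat C)"


section \<open>Model categories\<close>

record ('o, 'm) relcat = "('o, 'm) cat" +
  Weq :: "'o \<Rightarrow> 'o \<Rightarrow> 'm set"

record ('o, 'm) model_cat = "('o, 'm) relcat" +
  Cof :: "'o \<Rightarrow> 'o \<Rightarrow> 'm set"
  Fib :: "'o \<Rightarrow> 'o \<Rightarrow> 'm set"

definition arrow_class :: "('o, 'm, 'z) cat_scheme \<Rightarrow> ('o \<Rightarrow> 'o \<Rightarrow> 'm set) \<Rightarrow> bool" where
  "arrow_class C K \<longleftrightarrow> (\<forall>X\<in>Ob C. \<forall>Y\<in>Ob C. K X Y \<subseteq> Hom C X Y)"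

definition retract_of ::
  "('o, 'm, 'z) cat_scheme \<Rightarrow> 'o \<times> 'o \<times> 'm \<Rightarrow> 'o \<times> 'o \<times> 'm \<Rightarrow> bool" where
  "retract_of C a b \<longleftrightarrow> (\<exists>i\<in>Hom (arrow_cat C) a b. \<exists>r\<in>Hom (arrow_cat C) b a.
     Comp (arrow_cat C) a b a r i = Id (arrow_cat C) a)"

definition retract_closed :: "('o, 'm, 'z) cat_scheme \<Rightarrow> ('o \<Rightarrow> 'o \<Rightarrow> 'm set) \<Rightarrow> bool" where
  "retract_closed C K \<longleftrightarrow>
    (\<forall>X\<in>Ob C. \<forall>Y\<in>Ob C. \<forall>X'\<in>Ob C. \<forall>Y'\<in>Ob C. \<forall>f\<in>Hom C X Y. \<forall>g\<in>K X' Y'.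
       retract_of C (X, Y, f) (X', Y', g) \<longrightarrow> f \<in> K X Y)"

definition two_out_of_three :: "('o, 'm, 'z) cat_scheme \<Rightarrow> ('o \<Rightarrow> 'o \<Rightarrow> 'm set) \<Rightarrow> bool" where
  "two_out_of_three C K \<longleftrightarrow>
    (\<forall>X\<in>Ob C. \<forall>Y\<in>Ob C. \<forall>Z\<in>Ob C. \<forall>f\<in>Hom C X Y. \<forall>g\<in>Hom C Y Z.
      (f \<in> K X Y \<and> g \<in> K Y Z \<longrightarrow> Comp C X Y Z g f \<in> K X Z) \<and>
      (f \<in> K X Y \<and> Comp C X Y Z g f \<in> K X Z \<longrightarrow> g \<in> K Y Z) \<and>
      (g \<in> K Y Z \<and> Comp C X Y Z g f \<in> K X Z \<longrightarrow> f \<in> K X Y))"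

definition lifts ::
  "('o, 'm, 'z) cat_scheme \<Rightarrow> 'o \<Rightarrow> 'o \<Rightarrow> 'm \<Rightarrow> 'o \<Rightarrow> 'o \<Rightarrow> 'm \<Rightarrow> bool" where
  "lifts C A B i X Y p \<longleftrightarrow>
    (\<forall>u\<in>Hom C A X. \<forall>v\<in>Hom C B Y. Comp C A X Y p u = Comp C A B Y v i \<longrightarrow>
       (\<exists>h\<in>Hom C B X. Comp C A B X h i = u \<and> Comp C B X Y p h = v))"

definition lifting_property ::
  "('o, 'm, 'z) cat_scheme \<Rightarrow> ('o \<Rightarrow> 'o \<Rightarrow> 'm set) \<Rightarrow> ('o \<Rightarrow> 'o \<Rightarrow> 'm set) \<Rightarrow> bool" where
  "lifting_property C L R \<longleftrightarrow>
    (\<forall>A\<in>Ob C. \<forall>B\<in>Ob C. \<forall>X\<in>Ob C. \<forall>Y\<in>Ob C. \<forall>i\<in>L A B. \<forall>p\<in>R X Y. lifts C A B i X Y p)"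

definition dom_functor :: "('o \<times> 'o \<times> 'm, 'm \<times> 'm, 'o, 'm) fctr" where
  "dom_functor = \<lparr>FOb = (\<lambda>(X, Y, f). X), FArr = (\<lambda>_ _ (u, v). u)\<rparr>"

definition cod_functor :: "('o \<times> 'o \<times> 'm, 'm \<times> 'm, 'o, 'm) fctr" where
  "cod_functor = \<lparr>FOb = (\<lambda>(X, Y, f). Y), FArr = (\<lambda>_ _ (u, v). v)\<rparr>"

definition functorial_factorisation ::
  "('o, 'm, 'z) cat_scheme \<Rightarrow> ('o \<Rightarrow> 'o \<Rightarrow> 'm set) \<Rightarrow> ('o \<Rightarrow> 'o \<Rightarrow> 'm set) \<Rightarrow> bool" where
  "functorial_factorisation C L R \<longleftrightarrow>
    (\<exists>E l r. nat_trans (arrow_cat C) C dom_functor E l \<and> nat_trans (arrow_cat C) C E cod_functor r \<and>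
      (\<forall>X\<in>Ob C. \<forall>Y\<in>Ob C. \<forall>f\<in>Hom C X Y.
         l (X, Y, f) \<in> L X (FOb E (X, Y, f)) \<and> r (X, Y, f) \<in> R (FOb E (X, Y, f)) Y \<and>
         Comp C X (FOb E (X, Y, f)) Y (r (X, Y, f)) (l (X, Y, f)) = f))"

definition model_category :: "'u::universe itself \<Rightarrow> ('o, 'm, 'z) model_cat_scheme \<Rightarrow> bool" where
  "model_category U M \<longleftrightarrow>
    category M \<and> complete_cat U M \<and> cocomplete_cat U M \<and>
    arrow_class M (Weq M) \<and> arrow_class M (Cof M) \<and> arrow_class M (Fib M) \<and>
    two_out_of_three M (Weq M) \<and>
    retract_closed M (Weq M) \<and> retract_closed M (Cof M) \<and> retract_closed M (Fib M) \<and>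
    lifting_property M (\<lambda>X Y. Cof M X Y \<inter> Weq M X Y) (Fib M) \<and>
    lifting_property M (Cof M) (\<lambda>X Y. Fib M X Y \<inter> Weq M X Y) \<and>
    functorial_factorisation M (\<lambda>X Y. Cof M X Y \<inter> Weq M X Y) (Fib M) \<and>
    functorial_factorisation M (Cof M) (\<lambda>X Y. Fib M X Y \<inter> Weq M X Y)"

definition cofibrant :: "('o, 'm, 'z) model_cat_scheme \<Rightarrow> 'o \<Rightarrow> bool" where
  "cofibrant M X \<longleftrightarrow> X \<in> Ob M \<and> (\<forall>I. initial M I \<longrightarrow> Hom M I X \<subseteq> Cof M I X)"

definition fibrant :: "('o, 'm, 'z) model_cat_scheme \<Rightarrow> 'o \<Rightarrow> bool" where
  "fibrant M X \<longleftrightarrow> X \<in> Ob M \<and> (\<forall>T. terminal M T \<longrightarrow> Hom M X T \<subseteq> Fib M X T)"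

definition cf_subcat :: "('o, 'm, 'z) model_cat_scheme \<Rightarrow> ('o, 'm) relcat" where
  "cf_subcat M = relcat.truncate (full_subcat M (\<lambda>X. cofibrant M X \<and> fibrant M X))"

definition quillen_adjunction ::
  "('o, 'm, 'z) model_cat_scheme \<Rightarrow> ('p, 'n, 'w) model_cat_scheme \<Rightarrow>
   ('o, 'm, 'p, 'n) fctr \<Rightarrow> ('p, 'n, 'o, 'm) fctr \<Rightarrow> ('o \<Rightarrow> 'p \<Rightarrow> 'n \<Rightarrow> 'm) \<Rightarrow> bool" where
  "quillen_adjunction M N F G \<phi> \<longleftrightarrow> adjunction M N F G \<phi> \<and>
    (\<forall>X\<in>Ob M. \<forall>Y\<in>Ob M. \<forall>f\<in>Cof M X Y.
       FArr F X Y f \<in> Cof N (FOb F X) (FOb F Y) \<and>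
       (f \<in> Weq M X Y \<longrightarrow> FArr F X Y f \<in> Weq N (FOb F X) (FOb F Y)))"

definition quillen_equivalence ::
  "'u::universe itself \<Rightarrow> ('o, 'm, 'z) model_cat_scheme \<Rightarrow> ('p, 'n, 'w) model_cat_scheme \<Rightarrow>
   ('o, 'm, 'p, 'n) fctr \<Rightarrow> ('p, 'n, 'o, 'm) fctr \<Rightarrow> ('o \<Rightarrow> 'p \<Rightarrow> 'n \<Rightarrow> 'm) \<Rightarrow> bool" where
  "quillen_equivalence U M N F G \<phi> \<longleftrightarrow>
    model_category U M \<and> model_category U N \<and> quillen_adjunction M N F G \<phi> \<and>
    (\<forall>X\<in>Ob M. \<forall>Y\<in>Ob N. cofibrant M X \<longrightarrow> fibrant N Y \<longrightarrow>
      (\<forall>f\<in>Hom N (FOb F X) Y. f \<in> Weq N (FOb F X) Y \<longleftrightarrow> \<phi> X Y f \<in> Weq M X (FOb G Y)))"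

text \<open>One step of a zigzag: a Quillen equivalence in either direction.\<close>

definition quillen_step ::
  "'u::universe itself \<Rightarrow> ('o, 'm, 'z) model_cat_scheme \<Rightarrow> ('p, 'n, 'w) model_cat_scheme \<Rightarrow> bool" where
  "quillen_step U M N \<longleftrightarrow>
    (\<exists>F G \<phi>. quillen_equivalence U M N F G \<phi>) \<or> (\<exists>F G \<phi>. quillen_equivalence U N M F G \<phi>)"

text \<open>
  \<open>quillen_zigzag U M Ps N\<close>: the model categories \<open>M\<close> and \<open>N\<close> are connected by a finite zigzag of
  Quillen equivalences with intermediate model categories \<open>Ps\<close>. HOL cannot quantify existentially
  over the types of the intermediate model categories, so these are an explicit argument.
  Demanding that they share a pair of types is no loss of generality, since finitely many model
  categories can be transported to a common pair of (sum) types.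
\<close>

definition quillen_zigzag ::
  "'u::universe itself \<Rightarrow> ('o, 'm) model_cat \<Rightarrow> ('p, 'n) model_cat list \<Rightarrow> ('q, 'k) model_cat \<Rightarrow> bool" where
  "quillen_zigzag U M Ps N \<longleftrightarrow>
    (if Ps = [] then quillen_step U M N
     else quillen_step U M (hd Ps) \<and> successively (quillen_step U) Ps \<and> quillen_step U (last Ps) N)"


section \<open>Categories presented by generators and relations\<close>

text \<open>
  A path is a list of triples (source, edge, target), traversed from left to right. Arrows of the
  presented category are classes of paths modulo the congruence generated by the relations.
\<close>

record ('v, 'e) presentation =
  Verts :: "'v set"
  Edges :: "'v \<Rightarrow> 'v \<Rightarrow> 'e set"
  Rels :: "('v \<times> 'e \<times> 'v) list \<Rightarrow> ('v \<times> 'e \<times> 'v) list \<Rightarrow> bool"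

fun is_path :: "('v, 'e) presentation \<Rightarrow> 'v \<Rightarrow> ('v \<times> 'e \<times> 'v) list \<Rightarrow> 'v \<Rightarrow> bool" where
  "is_path P x [] y \<longleftrightarrow> x \<in> Verts P \<and> x = y"
| "is_path P x ((a, e, b) # p) y \<longleftrightarrow> x = a \<and> a \<in> Verts P \<and> e \<in> Edges P a b \<and> is_path P b p y"

inductive path_eq ::
  "('v, 'e) presentation \<Rightarrow> 'v \<Rightarrow> 'v \<Rightarrow> ('v \<times> 'e \<times> 'v) list \<Rightarrow> ('v \<times> 'e \<times> 'v) list \<Rightarrow> bool"
  for P where
  rel: "is_path P x p y \<Longrightarrow> is_path P x q y \<Longrightarrow> Rels P p q \<Longrightarrow> path_eq P x y p q"
| refl: "is_path P x p y \<Longrightarrow> path_eq P x y p p"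
| sym: "path_eq P x y p q \<Longrightarrow> path_eq P x y q p"
| trans: "path_eq P x y p q \<Longrightarrow> path_eq P x y q r \<Longrightarrow> path_eq P x y p r"
| append: "path_eq P x y p p' \<Longrightarrow> path_eq P y z q q' \<Longrightarrow> path_eq P x z (p @ q) (p' @ q')"

definition path_class ::
  "('v, 'e) presentation \<Rightarrow> 'v \<Rightarrow> 'v \<Rightarrow> ('v \<times> 'e \<times> 'v) list \<Rightarrow> ('v \<times> 'e \<times> 'v) list set" where
  "path_class P x y p = {q. path_eq P x y p q}"

definition presented_cat :: "('v, 'e) presentation \<Rightarrow> ('v, ('v \<times> 'e \<times> 'v) list set) cat" where
  "presented_cat P =
    \<lparr>Ob = Verts P,
     Hom = (\<lambda>x y. path_class P x y ` {p. is_path P x p y}),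
     Id = (\<lambda>x. path_class P x x []),
     Comp = (\<lambda>x y z b a. \<Union>p\<in>a. \<Union>q\<in>b. path_class P x z (p @ q))\<rparr>"

text \<open>The functor induced by a relation-preserving map of generating graphs into \<open>Q\<close>.\<close>

definition presented_functor ::
  "('w, 'd) presentation \<Rightarrow> ('v \<Rightarrow> 'w) \<Rightarrow> ('v \<Rightarrow> 'v \<Rightarrow> 'e \<Rightarrow> 'd) \<Rightarrow>
   ('v, ('v \<times> 'e \<times> 'v) list set, 'w, ('w \<times> 'd \<times> 'w) list set) fctr" where
  "presented_functor Q f0 f1 =
    \<lparr>FOb = f0,
     FArr = (\<lambda>x y c. \<Union>p\<in>c. path_class Q (f0 x) (f0 y) (map (\<lambda>(a, e, b). (f0 a, f1 a b e, f0 b)) p))\<rparr>"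


section \<open>Localisation\<close>

text \<open>
  The localisation at the weak equivalences: generated by the arrows \<open>Inl f\<close> of the category and
  formal inverses \<open>Inr w\<close> of the weak equivalences. The universal property is proved below as
  \<open>Ho_localisation\<close>, and that \<open>Ho_functor\<close> is the induced functor as \<open>Ho_functor_induced\<close>.
\<close>

inductive ho_rel ::
  "('o, 'm, 'z) relcat_scheme \<Rightarrow> ('o \<times> ('m + 'm) \<times> 'o) list \<Rightarrow> ('o \<times> ('m + 'm) \<times> 'o) list \<Rightarrow> bool"
  for C where
  "X \<in> Ob C \<Longrightarrow> ho_rel C [(X, Inl (Id C X), X)] []"
| "X \<in> Ob C \<Longrightarrow> Y \<in> Ob C \<Longrightarrow> Z \<in> Ob C \<Longrightarrow> f \<in> Hom C X Y \<Longrightarrow> g \<in> Hom C Y Z \<Longrightarrow>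
     ho_rel C [(X, Inl f, Y), (Y, Inl g, Z)] [(X, Inl (Comp C X Y Z g f), Z)]"
| "X \<in> Ob C \<Longrightarrow> Y \<in> Ob C \<Longrightarrow> w \<in> Weq C X Y \<Longrightarrow> ho_rel C [(X, Inl w, Y), (Y, Inr w, X)] []"
| "X \<in> Ob C \<Longrightarrow> Y \<in> Ob C \<Longrightarrow> w \<in> Weq C X Y \<Longrightarrow> ho_rel C [(Y, Inr w, X), (X, Inl w, Y)] []"

definition ho_pres :: "('o, 'm, 'z) relcat_scheme \<Rightarrow> ('o, 'm + 'm) presentation" where
  "ho_pres C = \<lparr>Verts = Ob C,
     Edges = (\<lambda>X Y. if X \<in> Ob C \<and> Y \<in> Ob C then Inl ` Hom C X Y \<union> Inr ` Weq C Y X else {}),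
     Rels = ho_rel C\<rparr>"

definition Ho :: "('o, 'm, 'z) relcat_scheme \<Rightarrow> ('o, ('o \<times> ('m + 'm) \<times> 'o) list set) cat" where
  "Ho C = presented_cat (ho_pres C)"

definition ho_unit ::
  "('o, 'm, 'z) relcat_scheme \<Rightarrow> ('o, 'm, 'o, ('o \<times> ('m + 'm) \<times> 'o) list set) fctr" where
  "ho_unit C = \<lparr>FOb = (\<lambda>X. X), FArr = (\<lambda>X Y f. path_class (ho_pres C) X Y [(X, Inl f, Y)])\<rparr>"

definition preserves_weq ::
  "('o, 'm, 'z) relcat_scheme \<Rightarrow> ('p, 'n, 'w) relcat_scheme \<Rightarrow> ('o, 'm, 'p, 'n) fctr \<Rightarrow> bool" where
  "preserves_weq C D F \<longleftrightarrow>
    (\<forall>X\<in>Ob C. \<forall>Y\<in>Ob C. \<forall>w\<in>Weq C X Y. FArr F X Y w \<in> Weq D (FOb F X) (FOb F Y))"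

definition Ho_functor ::
  "('p, 'n, 'w) relcat_scheme \<Rightarrow> ('o, 'm, 'p, 'n) fctr \<Rightarrow>
   ('o, ('o \<times> ('m + 'm) \<times> 'o) list set, 'p, ('p \<times> ('n + 'n) \<times> 'p) list set) fctr" where
  "Ho_functor D F = presented_functor (ho_pres D) (FOb F)
     (\<lambda>X Y. map_sum (FArr F X Y) (FArr F Y X))"


section \<open>Simplicial sets\<close>

text \<open>
  \<open>Delta m n\<close> is the set of monotone maps \<open>[m] \<rightarrow> [n]\<close>. For \<open>\<theta> \<in> Delta m n\<close>, \<open>Act X m n \<theta>\<close> is the
  induced map \<open>X_n \<rightarrow> X_m\<close>. All functions are extensional so that equality of simplicial sets and
  of their morphisms is the expected one.
\<close>

definition Delta :: "nat \<Rightarrow> nat \<Rightarrow> (nat \<Rightarrow> nat) set" where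
  "Delta m n = {\<theta> \<in> {..m} \<rightarrow>\<^sub>E {..n}. mono_on {..m} \<theta>}"

record 'a sset =
  Simp :: "nat \<Rightarrow> 'a set"
  Act :: "nat \<Rightarrow> nat \<Rightarrow> (nat \<Rightarrow> nat) \<Rightarrow> 'a \<Rightarrow> 'a"

definition simplicial_set :: "'a sset \<Rightarrow> bool" where
  "simplicial_set X \<longleftrightarrow>
    (\<forall>m n \<theta>. \<theta> \<in> Delta m n \<longrightarrow> Act X m n \<theta> \<in> Simp X n \<rightarrow>\<^sub>E Simp X m) \<and>
    (\<forall>m n \<theta>. \<theta> \<notin> Delta m n \<longrightarrow> Act X m n \<theta> = (\<lambda>_. undefined)) \<and>
    (\<forall>n. \<forall>x\<in>Simp X n. Act X n n (\<lambda>i\<in>{..n}. i) x = x) \<and>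
    (\<forall>k m n \<phi> \<theta>. \<phi> \<in> Delta k m \<longrightarrow> \<theta> \<in> Delta m n \<longrightarrow>
       (\<forall>x\<in>Simp X n. Act X k n (compose {..k} \<theta> \<phi>) x = Act X k m \<phi> (Act X m n \<theta> x)))"

type_synonym ('a, 'b) smap = "nat \<Rightarrow> 'a \<Rightarrow> 'b"

definition sHom :: "'a sset \<Rightarrow> 'b sset \<Rightarrow> ('a, 'b) smap set" where
  "sHom X Y = {f. (\<forall>n. f n \<in> Simp X n \<rightarrow>\<^sub>E Simp Y n) \<and>
     (\<forall>m n. \<forall>\<theta>\<in>Delta m n. \<forall>x\<in>Simp X n. f m (Act X m n \<theta> x) = Act Y m n \<theta> (f n x))}"

definition sid :: "'a sset \<Rightarrow> ('a, 'a) smap" where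
  "sid X = (\<lambda>n. \<lambda>x\<in>Simp X n. x)"

definition scomp :: "'a sset \<Rightarrow> ('b, 'c) smap \<Rightarrow> ('a, 'b) smap \<Rightarrow> ('a, 'c) smap" where
  "scomp X g f = (\<lambda>n. compose (Simp X n) (g n) (f n))"

definition std_simplex :: "nat \<Rightarrow> (nat \<Rightarrow> nat) sset" where
  "std_simplex n =
    \<lparr>Simp = (\<lambda>m. Delta m n),
     Act = (\<lambda>k m \<theta>. if \<theta> \<in> Delta k m then \<lambda>\<sigma>\<in>Delta m n. compose {..k} \<sigma> \<theta> else (\<lambda>_. undefined))\<rparr>"

definition sub_sset :: "'a sset \<Rightarrow> (nat \<Rightarrow> 'a set) \<Rightarrow> 'a sset" where
  "sub_sset X S = \<lparr>Simp = S,
     Act = (\<lambda>m n \<theta>. if \<theta> \<in> Delta m n then restrict (Act X m n \<theta>) (S n) else (\<lambda>_. undefined))\<rparr>"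

text \<open>The horn \<open>\<Lambda>\<^sup>n\<^sub>i\<close>: the union of the faces of \<open>\<Delta>\<^sup>n\<close> opposite to the vertices \<open>j \<noteq> i\<close>.\<close>

definition horn :: "nat \<Rightarrow> nat \<Rightarrow> (nat \<Rightarrow> nat) sset" where
  "horn n i = sub_sset (std_simplex n) (\<lambda>m. {\<sigma> \<in> Delta m n. \<exists>j\<in>{..n}. j \<noteq> i \<and> j \<notin> \<sigma> ` {..m}})"

definition point :: "unit sset" where
  "point = \<lparr>Simp = (\<lambda>_. {()}), Act = (\<lambda>m n \<theta>. if \<theta> \<in> Delta m n then \<lambda>x\<in>{()}. x else (\<lambda>_. undefined))\<rparr>"

definition slifts ::
  "'a sset \<Rightarrow> 'b sset \<Rightarrow> ('a, 'b) smap \<Rightarrow> 'c sset \<Rightarrow> 'd sset \<Rightarrow> ('c, 'd) smap \<Rightarrow> bool" where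
  "slifts A B i X Y p \<longleftrightarrow>
    (\<forall>u\<in>sHom A X. \<forall>v\<in>sHom B Y. scomp A p u = scomp A v i \<longrightarrow>
       (\<exists>h\<in>sHom B X. scomp A h i = u \<and> scomp B p h = v))"

text \<open>
  The inclusion \<open>\<Lambda>\<^sup>n\<^sub>i \<hookrightarrow> \<Delta>\<^sup>n\<close> is, as a family of functions, \<open>sid (horn n i)\<close>;
  \<open>\<lambda>n. \<lambda>x\<in>Simp X n. ()\<close> is the morphism \<open>X \<rightarrow> 1\<close>.
\<close>

definition quasicategory :: "'a sset \<Rightarrow> bool" where
  "quasicategory X \<longleftrightarrow> simplicial_set X \<and>
    (\<forall>n\<ge>2. \<forall>i. 0 < i \<and> i < n \<longrightarrow>
       slifts (horn n i) (std_simplex n) (sid (horn n i)) X point (\<lambda>n. \<lambda>x\<in>Simp X n. ()))"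

definition sprod :: "'a sset \<Rightarrow> 'b sset \<Rightarrow> ('a \<times> 'b) sset" where
  "sprod X Y =
    \<lparr>Simp = (\<lambda>n. Simp X n \<times> Simp Y n),
     Act = (\<lambda>m n \<theta>. if \<theta> \<in> Delta m n
        then \<lambda>(x, y)\<in>Simp X n \<times> Simp Y n. (Act X m n \<theta> x, Act Y m n \<theta> y) else (\<lambda>_. undefined))\<rparr>"

definition sfst :: "'a sset \<Rightarrow> 'b sset \<Rightarrow> ('a \<times> 'b, 'a) smap" where
  "sfst X Y = (\<lambda>n. restrict fst (Simp X n \<times> Simp Y n))"

definition ssnd :: "'a sset \<Rightarrow> 'b sset \<Rightarrow> ('a \<times> 'b, 'b) smap" where
  "ssnd X Y = (\<lambda>n. restrict snd (Simp X n \<times> Simp Y n))"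


subsection \<open>Exponentials\<close>

text \<open>\<open>[X, Y]_n\<close> is the set of morphisms \<open>\<Delta>\<^sup>n \<times> X \<rightarrow> Y\<close>.\<close>

type_synonym ('a, 'b) esimp = "((nat \<Rightarrow> nat) \<times> 'a, 'b) smap"

definition sexp :: "'a sset \<Rightarrow> 'b sset \<Rightarrow> ('a, 'b) esimp sset" where
  "sexp X Y =
    \<lparr>Simp = (\<lambda>n. sHom (sprod (std_simplex n) X) Y),
     Act = (\<lambda>m n \<theta>. if \<theta> \<in> Delta m n
        then \<lambda>u\<in>sHom (sprod (std_simplex n) X) Y.
          \<lambda>k. \<lambda>(\<sigma>, x)\<in>Delta k m \<times> Simp X k. u k (compose {..k} \<theta> \<sigma>, x)
        else (\<lambda>_. undefined))\<rparr>"

text \<open>The morphism \<open>[f, Z] : [Y, Z] \<rightarrow> [X, Z]\<close> for \<open>f : X \<rightarrow> Y\<close>.\<close>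

definition sexp_pre ::
  "'a sset \<Rightarrow> 'b sset \<Rightarrow> ('a, 'b) smap \<Rightarrow> 'c sset \<Rightarrow> (('b, 'c) esimp, ('a, 'c) esimp) smap" where
  "sexp_pre X Y f Z =
    (\<lambda>n. \<lambda>u\<in>Simp (sexp Y Z) n. \<lambda>k. \<lambda>(\<sigma>, x)\<in>Delta k n \<times> Simp X k. u k (\<sigma>, f k x))"

text \<open>The composition morphism \<open>[Y, Z] \<times> [X, Y] \<rightarrow> [X, Z]\<close>.\<close>

definition sexp_comp ::
  "'a sset \<Rightarrow> 'b sset \<Rightarrow> 'c sset \<Rightarrow> (('b, 'c) esimp \<times> ('a, 'b) esimp, ('a, 'c) esimp) smap" where
  "sexp_comp X Y Z =
    (\<lambda>n. \<lambda>(v, u)\<in>Simp (sexp Y Z) n \<times> Simp (sexp X Y) n.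
       \<lambda>k. \<lambda>(\<sigma>, x)\<in>Delta k n \<times> Simp X k. v k (\<sigma>, u k (\<sigma>, x)))"

text \<open>The vertex of \<open>[X, Y]\<close> corresponding to \<open>f : X \<rightarrow> Y\<close> under \<open>\<Delta>\<^sup>0 \<times> X \<cong> X\<close>.\<close>

definition sname :: "'a sset \<Rightarrow> ('a, 'b) smap \<Rightarrow> ('a, 'b) esimp" where
  "sname X f = (\<lambda>k. \<lambda>(\<sigma>, x)\<in>Delta k 0 \<times> Simp X k. f k x)"


subsection \<open>The nerve and the fundamental category\<close>

text \<open>
  An \<open>n\<close>-simplex of the nerve is a functor \<open>[n] \<rightarrow> C\<close>, given by objects \<open>a i\<close> and arrows
  \<open>h i j : a i \<rightarrow> a j\<close> for \<open>i \<le> j \<le> n\<close>.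
\<close>

definition nerve_simp ::
  "('o, 'm, 'z) cat_scheme \<Rightarrow> nat \<Rightarrow> ((nat \<Rightarrow> 'o) \<times> (nat \<times> nat \<Rightarrow> 'm)) set" where
  "nerve_simp C n = {(a, h). a \<in> {..n} \<rightarrow>\<^sub>E Ob C \<and>
     h \<in> extensional {(i, j). i \<le> j \<and> j \<le> n} \<and>
     (\<forall>j\<le>n. \<forall>i\<le>j. h (i, j) \<in> Hom C (a i) (a j)) \<and>
     (\<forall>i\<le>n. h (i, i) = Id C (a i)) \<and>
     (\<forall>k\<le>n. \<forall>j\<le>k. \<forall>i\<le>j. h (i, k) = Comp C (a i) (a j) (a k) (h (j, k)) (h (i, j)))}"

definition nerve :: "('o, 'm, 'z) cat_scheme \<Rightarrow> ((nat \<Rightarrow> 'o) \<times> (nat \<times> nat \<Rightarrow> 'm)) sset" where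
  "nerve C =
    \<lparr>Simp = nerve_simp C,
     Act = (\<lambda>m n \<theta>. if \<theta> \<in> Delta m n
        then \<lambda>(a, h)\<in>nerve_simp C n.
          (compose {..m} a \<theta>, \<lambda>(i, j)\<in>{(i, j). i \<le> j \<and> j \<le> m}. h (\<theta> i, \<theta> j))
        else (\<lambda>_. undefined))\<rparr>"

definition nerve_map ::
  "('o, 'm, 'z) cat_scheme \<Rightarrow> ('o, 'm, 'p, 'n) fctr \<Rightarrow>
   ((nat \<Rightarrow> 'o) \<times> (nat \<times> nat \<Rightarrow> 'm), (nat \<Rightarrow> 'p) \<times> (nat \<times> nat \<Rightarrow> 'n)) smap" where
  "nerve_map C F = (\<lambda>n. \<lambda>(a, h)\<in>nerve_simp C n.
     (\<lambda>i\<in>{..n}. FOb F (a i), \<lambda>(i, j)\<in>{(i, j). i \<le> j \<and> j \<le> n}. FArr F (a i) (a j) (h (i, j))))"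

text \<open>The maps \<open>[0] \<rightarrow> [n]\<close> and \<open>[1] \<rightarrow> [n]\<close> picking out a vertex and an edge.\<close>

definition vtx :: "nat \<Rightarrow> nat \<Rightarrow> nat" where
  "vtx i = (\<lambda>_\<in>{..0}. i)"

definition edg :: "nat \<Rightarrow> nat \<Rightarrow> nat \<Rightarrow> nat" where
  "edg i j = (\<lambda>k\<in>{..1}. if k = 0 then i else j)"

definition svert :: "'a sset \<Rightarrow> nat \<Rightarrow> nat \<Rightarrow> 'a \<Rightarrow> 'a" where
  "svert X n i = Act X 0 n (vtx i)"

definition sedge :: "'a sset \<Rightarrow> nat \<Rightarrow> nat \<Rightarrow> nat \<Rightarrow> 'a \<Rightarrow> 'a \<times> 'a \<times> 'a" where
  "sedge X n i j x = (svert X n i x, Act X 1 n (edg i j) x, svert X n j x)"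

text \<open>
  The left adjoint of the nerve in its usual explicit form: \<open>\<tau>\<^sub>1 X\<close> is generated by the graph of
  vertices and edges of \<open>X\<close>, subject to one relation for each degenerate edge and one for each
  2-simplex. The universal property is proved below as \<open>tau1_left_adjoint\<close>.
\<close>

inductive tau1_rel :: "'a sset \<Rightarrow> ('a \<times> 'a \<times> 'a) list \<Rightarrow> ('a \<times> 'a \<times> 'a) list \<Rightarrow> bool" for X where
  degenerate: "x \<in> Simp X 0 \<Longrightarrow> tau1_rel X [sedge X 0 0 0 x] []"
| triangle: "s \<in> Simp X 2 \<Longrightarrow> tau1_rel X [sedge X 2 0 1 s, sedge X 2 1 2 s] [sedge X 2 0 2 s]"

definition tau1_pres :: "'a sset \<Rightarrow> ('a, 'a) presentation" where
  "tau1_pres X = \<lparr>Verts = Simp X 0,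
     Edges = (\<lambda>x y. {e \<in> Simp X 1. svert X 1 0 e = x \<and> svert X 1 1 e = y}),
     Rels = tau1_rel X\<rparr>"

definition tau1 :: "'a sset \<Rightarrow> ('a, ('a \<times> 'a \<times> 'a) list set) cat" where
  "tau1 X = presented_cat (tau1_pres X)"

definition tau1_functor ::
  "'b sset \<Rightarrow> ('a, 'b) smap \<Rightarrow>
   ('a, ('a \<times> 'a \<times> 'a) list set, 'b, ('b \<times> 'b \<times> 'b) list set) fctr" where
  "tau1_functor Y f = presented_functor (tau1_pres Y) (f 0) (\<lambda>_ _. f 1)"

definition tau1_unit ::
  "'a sset \<Rightarrow> ('a, (nat \<Rightarrow> 'a) \<times> (nat \<times> nat \<Rightarrow> ('a \<times> 'a \<times> 'a) list set)) smap" where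
  "tau1_unit X = (\<lambda>n. \<lambda>x\<in>Simp X n.
     (\<lambda>i\<in>{..n}. svert X n i x,
      \<lambda>(i, j)\<in>{(i, j). i \<le> j \<and> j \<le> n}.
        path_class (tau1_pres X) (svert X n i x) (svert X n j x) [sedge X n i j x]))"

definition tau0 :: "'a sset \<Rightarrow> 'a set set" where
  "tau0 X = iso_classes (tau1 X)"

definition tau0_map :: "'b sset \<Rightarrow> ('a, 'b) smap \<Rightarrow> 'a set \<Rightarrow> 'b set" where
  "tau0_map Y f c = (\<Union>x\<in>c. {y. isomorphic (tau1 Y) (f 0 x) y})"


section \<open>The Joyal model structure\<close>

definition small_sset :: "'u::universe sset \<Rightarrow> bool" where
  "small_sset X \<longleftrightarrow> simplicial_set X \<and> (\<forall>n. small (Simp X n))"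

definition weak_cat_equiv ::
  "'u::universe sset \<Rightarrow> 'u sset \<Rightarrow> ('u, 'u) smap \<Rightarrow> bool" where
  "weak_cat_equiv X Y f \<longleftrightarrow> f \<in> sHom X Y \<and>
    (\<forall>Z :: 'u sset. small_sset Z \<and> quasicategory Z \<longrightarrow>
       bij_betw (tau0_map (sexp X Z) (sexp_pre X Y f Z)) (tau0 (sexp Y Z)) (tau0 (sexp X Z)))"

text \<open>\<open>sSet\<close> as a category with weak equivalences, and its full subcategory \<open>Qcat\<close>.\<close>

definition sSet :: "('u::universe sset, ('u, 'u) smap) relcat" where
  "sSet = \<lparr>Ob = {X. small_sset X}, Hom = sHom, Id = sid, Comp = (\<lambda>X Y Z g f. scomp X g f),
     Weq = (\<lambda>X Y. {f. weak_cat_equiv X Y f})\<rparr>"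

definition Qcat :: "('u::universe sset, ('u, 'u) smap) relcat" where
  "Qcat = full_subcat sSet quasicategory"

definition joyal_model_structure ::
  "('u::universe sset, ('u, 'u) smap) model_cat \<Rightarrow> bool" where
  "joyal_model_structure J \<longleftrightarrow>
    relcat.truncate J = sSet \<and> model_category TYPE('u) J \<and>
    (\<forall>X\<in>Ob J. \<forall>Y\<in>Ob J. Cof J X Y = {f. monomorphism J X Y f}) \<and>
    (\<forall>X\<in>Ob J. fibrant J X \<longleftrightarrow> quasicategory X)"


section \<open>2-categories\<close>

record ('o, 'm, 't) two_cat =
  Ob0 :: "'o set"
  HomCat :: "'o \<Rightarrow> 'o \<Rightarrow> ('m, 't) cat"
  Unit :: "'o \<Rightarrow> 'm"
  CompF :: "'o \<Rightarrow> 'o \<Rightarrow> 'o \<Rightarrow> ('m \<times> 'm, 't \<times> 't, 'm, 't) fctr"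

text \<open>
  \<open>CompF K X Y Z\<close> is the composition functor \<open>K(Y, Z) \<times> K(X, Y) \<rightarrow> K(X, Z)\<close>; its action on
  2-cells is horizontal composition.
\<close>

definition two_category :: "('o, 'm, 't) two_cat \<Rightarrow> bool" where
  "two_category K \<longleftrightarrow>
    (\<forall>X\<in>Ob0 K. \<forall>Y\<in>Ob0 K. category (HomCat K X Y)) \<and>
    (\<forall>X\<in>Ob0 K. Unit K X \<in> Ob (HomCat K X X)) \<and>
    (\<forall>X\<in>Ob0 K. \<forall>Y\<in>Ob0 K. \<forall>Z\<in>Ob0 K.
       is_functor (prod_cat (HomCat K Y Z) (HomCat K X Y)) (HomCat K X Z) (CompF K X Y Z)) \<and>
    (\<forall>X\<in>Ob0 K. \<forall>Y\<in>Ob0 K. \<forall>f\<in>Ob (HomCat K X Y).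
       FOb (CompF K X X Y) (f, Unit K X) = f \<and> FOb (CompF K X Y Y) (Unit K Y, f) = f) \<and>
    (\<forall>X\<in>Ob0 K. \<forall>Y\<in>Ob0 K. \<forall>f\<in>Ob (HomCat K X Y). \<forall>f'\<in>Ob (HomCat K X Y).
     \<forall>\<alpha>\<in>Hom (HomCat K X Y) f f'.
       FArr (CompF K X X Y) (f, Unit K X) (f', Unit K X) (\<alpha>, Id (HomCat K X X) (Unit K X)) = \<alpha> \<and>
       FArr (CompF K X Y Y) (Unit K Y, f) (Unit K Y, f') (Id (HomCat K Y Y) (Unit K Y), \<alpha>) = \<alpha>) \<and>
    (\<forall>W\<in>Ob0 K. \<forall>X\<in>Ob0 K. \<forall>Y\<in>Ob0 K. \<forall>Z\<in>Ob0 K.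
     \<forall>f\<in>Ob (HomCat K W X). \<forall>g\<in>Ob (HomCat K X Y). \<forall>h\<in>Ob (HomCat K Y Z).
       FOb (CompF K W X Z) (FOb (CompF K X Y Z) (h, g), f) =
       FOb (CompF K W Y Z) (h, FOb (CompF K W X Y) (g, f))) \<and>
    (\<forall>W\<in>Ob0 K. \<forall>X\<in>Ob0 K. \<forall>Y\<in>Ob0 K. \<forall>Z\<in>Ob0 K.
     \<forall>f\<in>Ob (HomCat K W X). \<forall>g\<in>Ob (HomCat K X Y). \<forall>h\<in>Ob (HomCat K Y Z).
     \<forall>f'\<in>Ob (HomCat K W X). \<forall>g'\<in>Ob (HomCat K X Y). \<forall>h'\<in>Ob (HomCat K Y Z).
     \<forall>\<alpha>\<in>Hom (HomCat K W X) f f'. \<forall>\<beta>\<in>Hom (HomCat K X Y) g g'. \<forall>\<gamma>\<in>Hom (HomCat K Y Z) h h'.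
       FArr (CompF K W X Z) (FOb (CompF K X Y Z) (h, g), f) (FOb (CompF K X Y Z) (h', g'), f')
         (FArr (CompF K X Y Z) (h, g) (h', g') (\<gamma>, \<beta>), \<alpha>) =
       FArr (CompF K W Y Z) (h, FOb (CompF K W X Y) (g, f)) (h', FOb (CompF K W X Y) (g', f'))
         (\<gamma>, FArr (CompF K W X Y) (g, f) (g', f') (\<beta>, \<alpha>)))"

definition underlying_cat :: "('o, 'm, 't) two_cat \<Rightarrow> ('o, 'm) cat" where
  "underlying_cat K = \<lparr>Ob = Ob0 K, Hom = (\<lambda>X Y. Ob (HomCat K X Y)), Id = Unit K,
     Comp = (\<lambda>X Y Z g f. FOb (CompF K X Y Z) (g, f))\<rparr>"

record ('o, 'm, 't, 'p, 'n, 's) two_fctr =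
  F0 :: "'o \<Rightarrow> 'p"
  FHom :: "'o \<Rightarrow> 'o \<Rightarrow> ('m, 't, 'n, 's) fctr"

definition two_functor ::
  "('o, 'm, 't) two_cat \<Rightarrow> ('p, 'n, 's) two_cat \<Rightarrow> ('o, 'm, 't, 'p, 'n, 's) two_fctr \<Rightarrow> bool" where
  "two_functor K L F \<longleftrightarrow> two_category K \<and> two_category L \<and>
    (\<forall>X\<in>Ob0 K. F0 F X \<in> Ob0 L) \<and>
    (\<forall>X\<in>Ob0 K. \<forall>Y\<in>Ob0 K. is_functor (HomCat K X Y) (HomCat L (F0 F X) (F0 F Y)) (FHom F X Y)) \<and>
    (\<forall>X\<in>Ob0 K. FOb (FHom F X X) (Unit K X) = Unit L (F0 F X)) \<and>
    (\<forall>X\<in>Ob0 K. \<forall>Y\<in>Ob0 K. \<forall>Z\<in>Ob0 K. \<forall>f\<in>Ob (HomCat K X Y). \<forall>g\<in>Ob (HomCat K Y Z).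
       FOb (FHom F X Z) (FOb (CompF K X Y Z) (g, f)) =
       FOb (CompF L (F0 F X) (F0 F Y) (F0 F Z)) (FOb (FHom F Y Z) g, FOb (FHom F X Y) f)) \<and>
    (\<forall>X\<in>Ob0 K. \<forall>Y\<in>Ob0 K. \<forall>Z\<in>Ob0 K.
     \<forall>f\<in>Ob (HomCat K X Y). \<forall>g\<in>Ob (HomCat K Y Z). \<forall>f'\<in>Ob (HomCat K X Y). \<forall>g'\<in>Ob (HomCat K Y Z).
     \<forall>\<alpha>\<in>Hom (HomCat K X Y) f f'. \<forall>\<beta>\<in>Hom (HomCat K Y Z) g g'.
       FArr (FHom F X Z) (FOb (CompF K X Y Z) (g, f)) (FOb (CompF K X Y Z) (g', f'))
         (FArr (CompF K X Y Z) (g, f) (g', f') (\<beta>, \<alpha>)) =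
       FArr (CompF L (F0 F X) (F0 F Y) (F0 F Z))
         (FOb (FHom F Y Z) g, FOb (FHom F X Y) f) (FOb (FHom F Y Z) g', FOb (FHom F X Y) f')
         (FArr (FHom F Y Z) g g' \<beta>, FArr (FHom F X Y) f f' \<alpha>))"

definition underlying_functor ::
  "('o, 'm, 't, 'p, 'n, 's) two_fctr \<Rightarrow> ('o, 'm, 'p, 'n) fctr" where
  "underlying_functor F = \<lparr>FOb = F0 F, FArr = (\<lambda>X Y. FOb (FHom F X Y))\<rparr>"

definition equivalent_objects :: "('o, 'm, 't) two_cat \<Rightarrow> 'o \<Rightarrow> 'o \<Rightarrow> bool" where
  "equivalent_objects K X Y \<longleftrightarrow> X \<in> Ob0 K \<and> Y \<in> Ob0 K \<and>
    (\<exists>f\<in>Ob (HomCat K X Y). \<exists>g\<in>Ob (HomCat K Y X).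
       isomorphic (HomCat K X X) (FOb (CompF K X Y X) (g, f)) (Unit K X) \<and>
       isomorphic (HomCat K Y Y) (FOb (CompF K Y X Y) (f, g)) (Unit K Y))"

text \<open>Bicategorical equivalences are only needed between 2-categories and for 2-functors.\<close>

definition bicategorical_equivalence ::
  "('o, 'm, 't) two_cat \<Rightarrow> ('p, 'n, 's) two_cat \<Rightarrow> ('o, 'm, 't, 'p, 'n, 's) two_fctr \<Rightarrow> bool" where
  "bicategorical_equivalence K L F \<longleftrightarrow> two_functor K L F \<and>
    (\<forall>Z\<in>Ob0 L. \<exists>X\<in>Ob0 K. equivalent_objects L (F0 F X) Z) \<and>
    (\<forall>X\<in>Ob0 K. \<forall>Y\<in>Ob0 K.
       categorical_equivalence (HomCat K X Y) (HomCat L (F0 F X) (F0 F Y)) (FHom F X Y))"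


section \<open>The 2-category of quasicategories\<close>

type_synonym ('a, 'b) two_cell = "(('a, 'b) esimp \<times> ('a, 'b) esimp \<times> ('a, 'b) esimp) list set"

text \<open>
  The hom-category from \<open>X\<close> to \<open>Y\<close> is \<open>\<tau>\<^sub>1 [X, Y]\<close>, where the set of objects
  \<open>Hom (\<Delta>\<^sup>0 \<times> X) Y\<close> is replaced by \<open>Hom X Y\<close> along the canonical bijection \<open>sname\<close>
  (see \<open>bij_betw_sname\<close>), so that the underlying category is literally \<open>Qcat\<close>.
\<close>

definition qcat_hom :: "'a sset \<Rightarrow> 'b sset \<Rightarrow> (('a, 'b) smap, ('a, 'b) two_cell) cat" where
  "qcat_hom X Y =
    \<lparr>Ob = sHom X Y,
     Hom = (\<lambda>f g. Hom (tau1 (sexp X Y)) (sname X f) (sname X g)),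
     Id = (\<lambda>f. Id (tau1 (sexp X Y)) (sname X f)),
     Comp = (\<lambda>f g h. Comp (tau1 (sexp X Y)) (sname X f) (sname X g) (sname X h))\<rparr>"

text \<open>
  Since \<open>\<tau>\<^sub>1\<close> preserves products, a pair of arrows of \<open>\<tau>\<^sub>1 A\<close> and \<open>\<tau>\<^sub>1 B\<close> comes from a unique arrow of
  \<open>\<tau>\<^sub>1 (A \<times> B)\<close>.
\<close>

definition tau1_pair ::
  "'a sset \<Rightarrow> 'b sset \<Rightarrow> 'a \<times> 'b \<Rightarrow> 'a \<times> 'b \<Rightarrow>
   ('a \<times> 'a \<times> 'a) list set \<Rightarrow> ('b \<times> 'b \<times> 'b) list set \<Rightarrow>
   (('a \<times> 'b) \<times> ('a \<times> 'b) \<times> ('a \<times> 'b)) list set" where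
  "tau1_pair A B x y \<alpha> \<beta> = (THE \<gamma>. \<gamma> \<in> Hom (tau1 (sprod A B)) x y \<and>
     FArr (tau1_functor A (sfst A B)) x y \<gamma> = \<alpha> \<and> FArr (tau1_functor B (ssnd A B)) x y \<gamma> = \<beta>)"

text \<open>
  Composition is \<open>\<tau>\<^sub>1 [Y, Z] \<times> \<tau>\<^sub>1 [X, Y] \<cong> \<tau>\<^sub>1 ([Y, Z] \<times> [X, Y]) \<rightarrow> \<tau>\<^sub>1 [X, Z]\<close>.
\<close>

definition qcat_comp ::
  "'a sset \<Rightarrow> 'b sset \<Rightarrow> 'c sset \<Rightarrow>
   (('b, 'c) smap \<times> ('a, 'b) smap, ('b, 'c) two_cell \<times> ('a, 'b) two_cell,
    ('a, 'c) smap, ('a, 'c) two_cell) fctr" where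
  "qcat_comp X Y Z =
    \<lparr>FOb = (\<lambda>(g, f). scomp X g f),
     FArr = (\<lambda>(g, f) (g', f') (\<beta>, \<alpha>).
       FArr (tau1_functor (sexp X Z) (sexp_comp X Y Z)) (sname Y g, sname X f) (sname Y g', sname X f')
         (tau1_pair (sexp Y Z) (sexp X Y) (sname Y g, sname X f) (sname Y g', sname X f') \<beta> \<alpha>))\<rparr>"

definition QCAT :: "('u::universe sset, ('u, 'u) smap, ('u, 'u) two_cell) two_cat" where
  "QCAT = \<lparr>Ob0 = Ob Qcat, HomCat = qcat_hom, Unit = sid, CompF = qcat_comp\<rparr>"

lemma underlying_cat_QCAT: "underlying_cat QCAT = cat.truncate Qcat"
  by (simp add: underlying_cat_def QCAT_def Qcat_def sSet_def full_subcat_def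
      cat.truncate_def qcat_hom_def qcat_comp_def)



section \<open>Universal properties\<close>

subsection \<open>Presented categories\<close>

lemma categoryD:
  assumes "category C"
  shows "X \<in> Ob C \<Longrightarrow> Id C X \<in> Hom C X X"
    and "\<lbrakk>X \<in> Ob C; Y \<in> Ob C; Z \<in> Ob C; f \<in> Hom C X Y; g \<in> Hom C Y Z\<rbrakk> \<Longrightarrow> Comp C X Y Z g f \<in> Hom C X Z"
    and "\<lbrakk>X \<in> Ob C; Y \<in> Ob C; f \<in> Hom C X Y\<rbrakk> \<Longrightarrow> Comp C X X Y f (Id C X) = f"
    and "\<lbrakk>X \<in> Ob C; Y \<in> Ob C; f \<in> Hom C X Y\<rbrakk> \<Longrightarrow> Comp C X Y Y (Id C Y) f = f"
    and "\<lbrakk>W \<in> Ob C; X \<in> Ob C; Y \<in> Ob C; Z \<in> Ob C; f \<in> Hom C W X; g \<in> Hom C X Y; h \<in> Hom C Y Z\<rbrakk> \<Longrightarrow>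
      Comp C W X Z (Comp C X Y Z h g) f = Comp C W Y Z h (Comp C W X Y g f)"
  using assms unfolding category_def by simp_all

lemma is_functorD:
  assumes "is_functor C D F"
  shows "category C" "category D"
    and "X \<in> Ob C \<Longrightarrow> FOb F X \<in> Ob D"
    and "\<lbrakk>X \<in> Ob C; Y \<in> Ob C; f \<in> Hom C X Y\<rbrakk> \<Longrightarrow> FArr F X Y f \<in> Hom D (FOb F X) (FOb F Y)"
    and "X \<in> Ob C \<Longrightarrow> FArr F X X (Id C X) = Id D (FOb F X)"
    and "\<lbrakk>X \<in> Ob C; Y \<in> Ob C; Z \<in> Ob C; f \<in> Hom C X Y; g \<in> Hom C Y Z\<rbrakk> \<Longrightarrow>
       FArr F X Z (Comp C X Y Z g f) =
         Comp D (FOb F X) (FOb F Y) (FOb F Z) (FArr F Y Z g) (FArr F X Y f)"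
  using assms unfolding is_functor_def by simp_all

lemma is_path_Verts: "is_path P x p y \<Longrightarrow> x \<in> Verts P \<and> y \<in> Verts P"
  by (induction P x p y rule: is_path.induct) auto

lemma is_path_append: "is_path P x p y \<Longrightarrow> is_path P y q z \<Longrightarrow> is_path P x (p @ q) z"
  by (induction P x p y rule: is_path.induct) auto

lemma path_eq_is_path: "path_eq P x y p q \<Longrightarrow> is_path P x p y \<and> is_path P x q y"
  by (induction rule: path_eq.induct) (auto intro: is_path_append)

lemma path_class_eq: "path_eq P x y p q \<Longrightarrow> path_class P x y p = path_class P x y q"
  unfolding path_class_def by (blast intro: path_eq.sym path_eq.trans)

lemma path_class_self: "is_path P x p y \<Longrightarrow> p \<in> path_class P x y p"
  by (simp add: path_class_def path_eq.refl)

lemma presented_cat_simps: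
  "Ob (presented_cat P) = Verts P"
  "Hom (presented_cat P) x y = path_class P x y ` {p. is_path P x p y}"
  "Id (presented_cat P) x = path_class P x x []"
  by (simp_all add: presented_cat_def)

lemma presented_Comp:
  assumes "is_path P x p y" "is_path P y q z"
  shows "Comp (presented_cat P) x y z (path_class P y z q) (path_class P x y p) = path_class P x z (p @ q)"
proof -
  have "path_class P x z (p' @ q') = path_class P x z (p @ q)"
    if "p' \<in> path_class P x y p" "q' \<in> path_class P y z q" for p' q'
    using that path_class_eq[OF path_eq.append] unfolding path_class_def[of P x y] path_class_def[of P y z]
    by (metis mem_Collect_eq)
  then show ?thesis
    using path_class_self[OF assms(1)] path_class_self[OF assms(2)]
    unfolding presented_cat_def cat.simps by blast
qed

lemma category_presented_cat: "category (presented_cat P)"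
  unfolding category_def
  by (auto simp: presented_cat_simps presented_Comp is_path_append)

fun path_value ::
  "('p, 'n, 'w) cat_scheme \<Rightarrow> ('v \<Rightarrow> 'p) \<Rightarrow> ('v \<Rightarrow> 'v \<Rightarrow> 'e \<Rightarrow> 'n) \<Rightarrow> 'v \<Rightarrow> ('v \<times> 'e \<times> 'v) list \<Rightarrow> 'v \<Rightarrow> 'n" where
  "path_value D g0 g1 x [] y = Id D (g0 x)"
| "path_value D g0 g1 x ((a, e, b) # p) y = Comp D (g0 a) (g0 b) (g0 y) (path_value D g0 g1 b p y) (g1 a b e)"


locale presented_target =
  fixes P :: "('v, 'e) presentation" and D :: "('p, 'n, 'w) cat_scheme"
    and g0 :: "'v \<Rightarrow> 'p" and g1 :: "'v \<Rightarrow> 'v \<Rightarrow> 'e \<Rightarrow> 'n"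
  assumes D: "category D"
    and g0: "\<And>x. x \<in> Verts P \<Longrightarrow> g0 x \<in> Ob D"
    and g1: "\<And>x y e. x \<in> Verts P \<Longrightarrow> y \<in> Verts P \<Longrightarrow> e \<in> Edges P x y \<Longrightarrow> g1 x y e \<in> Hom D (g0 x) (g0 y)"
    and rels: "\<And>x y p q. is_path P x p y \<Longrightarrow> is_path P x q y \<Longrightarrow> Rels P p q \<Longrightarrow>
      path_value D g0 g1 x p y = path_value D g0 g1 x q y"
begin

abbreviation "val \<equiv> path_value D g0 g1"

lemma val_Hom: "is_path P x p y \<Longrightarrow> val x p y \<in> Hom D (g0 x) (g0 y)"
proof (induction p arbitrary: x)
  case Nil
  then show ?case using categoryD(1)[OF D] g0 by auto
next
  case (Cons t p)
  obtain a e b where t: "t = (a, e, b)" by (cases t)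
  show ?case
    using Cons is_path_Verts[of P b p y] g0 g1 categoryD(2)[OF D] by (auto simp: t)
qed

lemma val_append:
  "is_path P x p y \<Longrightarrow> is_path P y q z \<Longrightarrow>
   val x (p @ q) z = Comp D (g0 x) (g0 y) (g0 z) (val y q z) (val x p y)"
proof (induction p arbitrary: x)
  case Nil
  then show ?case using is_path_Verts[of P y q z] val_Hom[of y q z] categoryD(3)[OF D] g0 by auto
next
  case (Cons t p)
  obtain a e b where t: "t = (a, e, b)" by (cases t)
  have *: "x = a" "a \<in> Verts P" "e \<in> Edges P a b" "is_path P b p y" using Cons.prems by (auto simp: t)
  have v: "b \<in> Verts P" "y \<in> Verts P" "z \<in> Verts P"
    using is_path_Verts[OF *(4)] is_path_Verts[OF Cons.prems(2)] by auto
  have "val x ((t # p) @ q) z = Comp D (g0 a) (g0 b) (g0 z) (val b (p @ q) z) (g1 a b e)"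
    by (simp add: t)
  also have "\<dots> = Comp D (g0 a) (g0 b) (g0 z) (Comp D (g0 b) (g0 y) (g0 z) (val y q z) (val b p y)) (g1 a b e)"
    using Cons.IH[OF *(4) Cons.prems(2)] by simp
  also have "\<dots> = Comp D (g0 a) (g0 y) (g0 z) (val y q z) (Comp D (g0 a) (g0 b) (g0 y) (val b p y) (g1 a b e))"
    using categoryD(5)[OF D] g0 g1 v * val_Hom[OF *(4)] val_Hom[OF Cons.prems(2)] by simp
  finally show ?case by (simp add: t *)
qed

lemma val_eq: "path_eq P x y p q \<Longrightarrow> val x p y = val x q y"
proof (induction rule: path_eq.induct)
  case (rel x p y q)
  then show ?case by (rule rels)
next
  case (append x y p p' z q q')
  then show ?case
    using val_append path_eq_is_path by metis
qed simp_all

definition induced :: "('v, ('v \<times> 'e \<times> 'v) list set, 'p, 'n) fctr" where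
  "induced = \<lparr>FOb = g0, FArr = (\<lambda>x y c. val x (SOME p. p \<in> c) y)\<rparr>"

lemma induced_class:
  assumes "is_path P x p y"
  shows "FArr induced x y (path_class P x y p) = val x p y"
proof -
  have "(SOME q. q \<in> path_class P x y p) \<in> path_class P x y p"
    using path_class_self[OF assms] by (rule someI)
  then show ?thesis using val_eq unfolding induced_def path_class_def by fastforce
qed

lemma induced_edge:
  assumes "x \<in> Verts P" "y \<in> Verts P" "e \<in> Edges P x y"
  shows "FArr induced x y (path_class P x y [(x, e, y)]) = g1 x y e"
  using assms categoryD(4)[OF D] g0 g1 by (simp add: induced_class)

lemma is_functor_induced: "is_functor (presented_cat P) D induced"
proof -
  have "FOb induced = g0" by (simp add: induced_def)
  then show ?thesis
    unfolding is_functor_def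
    using D g0 category_presented_cat[of P]
    by (auto simp: presented_cat_simps induced_class val_Hom presented_Comp is_path_append val_append)
qed

end

lemma presented_functors_agree:
  assumes F: "is_functor (presented_cat P) D F" and G: "is_functor (presented_cat P) D G"
    and ob: "\<And>x. x \<in> Verts P \<Longrightarrow> FOb F x = FOb G x"
    and ed: "\<And>x y e. x \<in> Verts P \<Longrightarrow> y \<in> Verts P \<Longrightarrow> e \<in> Edges P x y \<Longrightarrow>
       FArr F x y (path_class P x y [(x, e, y)]) = FArr G x y (path_class P x y [(x, e, y)])"
    and c: "c \<in> Hom (presented_cat P) x y"
  shows "FArr F x y c = FArr G x y c"
proof -
  have "FArr F x y (path_class P x y p) = FArr G x y (path_class P x y p)" if "is_path P x p y" for p x
    using that
  proof (induction p arbitrary: x)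
    case Nil
    then show ?case
      using is_functorD(5)[OF F, of x] is_functorD(5)[OF G, of x] ob
      by (auto simp: presented_cat_simps)
  next
    case (Cons t p)
    obtain a e b where t: "t = (a, e, b)" by (cases t)
    have *: "x = a" "a \<in> Verts P" "e \<in> Edges P a b" "is_path P b p y" using Cons.prems by (auto simp: t)
    have v: "b \<in> Verts P" "y \<in> Verts P" using is_path_Verts[OF *(4)] by auto
    have 1: "is_path P x [t] b" using * v by (simp add: t)
    have comp: "path_class P x y (t # p) = Comp (presented_cat P) x b y (path_class P b y p) (path_class P x b [t])"
      using presented_Comp[OF 1 *(4)] by simp
    have "FArr H x y (path_class P x y (t # p)) =
        Comp D (FOb H x) (FOb H b) (FOb H y) (FArr H b y (path_class P b y p)) (FArr H x b (path_class P x b [t]))"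
      if "is_functor (presented_cat P) D H" for H
      unfolding comp using * v 1 by (intro is_functorD(6)[OF that]) (auto simp: presented_cat_simps)
    then show ?case
      using F G Cons.IH[OF *(4)] ob v * ed[of a b e] by (simp add: t)
  qed
  then show ?thesis using c by (auto simp: presented_cat_simps)
qed

lemma is_functor_presented_functor:
  assumes f0: "\<And>x. x \<in> Verts P \<Longrightarrow> f0 x \<in> Verts Q"
    and f1: "\<And>x y e. x \<in> Verts P \<Longrightarrow> y \<in> Verts P \<Longrightarrow> e \<in> Edges P x y \<Longrightarrow> f1 x y e \<in> Edges Q (f0 x) (f0 y)"
    and rels: "\<And>x y p q. is_path P x p y \<Longrightarrow> is_path P x q y \<Longrightarrow> Rels P p q \<Longrightarrow>
      path_eq Q (f0 x) (f0 y) (map (\<lambda>(a, e, b). (f0 a, f1 a b e, f0 b)) p)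
        (map (\<lambda>(a, e, b). (f0 a, f1 a b e, f0 b)) q)"
  shows "is_functor (presented_cat P) (presented_cat Q) (presented_functor Q f0 f1)"
    and "is_path P x p y \<Longrightarrow> FArr (presented_functor Q f0 f1) x y (path_class P x y p) =
      path_class Q (f0 x) (f0 y) (map (\<lambda>(a, e, b). (f0 a, f1 a b e, f0 b)) p)"
proof -
  define mp where "mp = map (\<lambda>(a, e, b). (f0 a, f1 a b e, f0 b))"
  have path: "is_path Q (f0 x) (mp p) (f0 y)" if "is_path P x p y" for x p y
    using that
  proof (induction p arbitrary: x)
    case Nil
    then show ?case by (auto simp: mp_def f0)
  next
    case (Cons t p)
    obtain a e b where t: "t = (a, e, b)" by (cases t)
    show ?case using Cons is_path_Verts[of P b p y] by (auto simp: mp_def f0 f1 t)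
  qed
  have eq: "path_eq Q (f0 x) (f0 y) (mp p) (mp q)" if "path_eq P x y p q" for x y p q
    using that
  proof (induction rule: path_eq.induct)
    case (rel x p y q)
    then show ?case using rels by (simp add: mp_def)
  next
    case (append x y p p' z q q')
    then show ?case using path_eq.append[OF append.IH] by (simp add: mp_def)
  qed (auto intro: path path_eq.refl path_eq.sym path_eq.trans)
  have cls: "FArr (presented_functor Q f0 f1) x y (path_class P x y p) = path_class Q (f0 x) (f0 y) (mp p)"
    if "is_path P x p y" for x p y
  proof -
    have "path_class Q (f0 x) (f0 y) (mp q) = path_class Q (f0 x) (f0 y) (mp p)" if "q \<in> path_class P x y p" for q
      using eq path_class_eq that unfolding path_class_def[of P] by (metis mem_Collect_eq)
    then show ?thesis
      using path_class_self[OF that] unfolding presented_functor_def fctr.simps mp_def by blast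
  qed
  then show "is_path P x p y \<Longrightarrow> FArr (presented_functor Q f0 f1) x y (path_class P x y p) =
      path_class Q (f0 x) (f0 y) (map (\<lambda>(a, e, b). (f0 a, f1 a b e, f0 b)) p)"
    by (simp add: mp_def)
  have "FOb (presented_functor Q f0 f1) = f0" by (simp add: presented_functor_def)
  moreover have "mp [] = []" "mp (p @ q) = mp p @ mp q" for p q by (simp_all add: mp_def)
  ultimately show "is_functor (presented_cat P) (presented_cat Q) (presented_functor Q f0 f1)"
    unfolding is_functor_def
    using f0 category_presented_cat[of P] category_presented_cat[of Q] path
    by (auto simp: presented_cat_simps cls presented_Comp is_path_append)
qed

subsection \<open>Localisation\<close>

text \<open>
  \<open>Ho C\<close> is the localisation: \<open>ho_unit C\<close> inverts the weak equivalences, and a functor on \<open>C\<close>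
  inverting them extends uniquely along \<open>ho_unit C\<close>.
\<close>

definition relative_category :: "('o, 'm, 'z) relcat_scheme \<Rightarrow> bool" where
  "relative_category C \<longleftrightarrow> category C \<and> arrow_class C (Weq C)"

lemma ho_pres_simps:
  "Verts (ho_pres C) = Ob C"
  "X \<in> Ob C \<Longrightarrow> Y \<in> Ob C \<Longrightarrow> Edges (ho_pres C) X Y = Inl ` Hom C X Y \<union> Inr ` Weq C Y X"
  "Rels (ho_pres C) = ho_rel C"
  by (simp_all add: ho_pres_def)

lemma Ho_localisation:
  fixes C :: "('o, 'm, 'z) relcat_scheme"
  assumes C: "relative_category C"
  shows "is_functor C (Ho C) (ho_unit C)"
    and "X \<in> Ob C \<Longrightarrow> Y \<in> Ob C \<Longrightarrow> w \<in> Weq C X Y \<Longrightarrow>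
      \<exists>v. inverse_arrows (Ho C) X Y (FArr (ho_unit C) X Y w) v"
    and "is_functor C D G \<Longrightarrow>
      (\<And>X Y w. X \<in> Ob C \<Longrightarrow> Y \<in> Ob C \<Longrightarrow> w \<in> Weq C X Y \<Longrightarrow>
        \<exists>v. inverse_arrows D (FOb G X) (FOb G Y) (FArr G X Y w) v) \<Longrightarrow>
      \<exists>F. is_functor (Ho C) D F \<and> (\<forall>X\<in>Ob C. FOb F X = FOb G X) \<and>
        (\<forall>X\<in>Ob C. \<forall>Y\<in>Ob C. \<forall>f\<in>Hom C X Y. FArr F X Y (FArr (ho_unit C) X Y f) = FArr G X Y f)"
    and "is_functor (Ho C) D F \<Longrightarrow> is_functor (Ho C) D F' \<Longrightarrow>
      (\<And>X. X \<in> Ob C \<Longrightarrow> FOb F X = FOb F' X) \<Longrightarrow>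
      (\<And>X Y f. X \<in> Ob C \<Longrightarrow> Y \<in> Ob C \<Longrightarrow> f \<in> Hom C X Y \<Longrightarrow>
        FArr F X Y (FArr (ho_unit C) X Y f) = FArr F' X Y (FArr (ho_unit C) X Y f)) \<Longrightarrow>
      c \<in> Hom (Ho C) X Y \<Longrightarrow> FArr F X Y c = FArr F' X Y c"
proof -
  note catC = C[unfolded relative_category_def, THEN conjunct1]
  have W: "X \<in> Ob C \<Longrightarrow> Y \<in> Ob C \<Longrightarrow> w \<in> Weq C X Y \<Longrightarrow> w \<in> Hom C X Y" for X Y w
    using C by (auto simp: relative_category_def arrow_class_def)
  let ?P = "ho_pres C"
  have p1: "is_path ?P X [(X, Inl f, Y)] Y" if "X \<in> Ob C" "Y \<in> Ob C" "f \<in> Hom C X Y" for X Y f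
    using that by (simp add: ho_pres_simps)
  have p2: "is_path ?P Y [(Y, Inr w, X)] X" if "X \<in> Ob C" "Y \<in> Ob C" "w \<in> Weq C X Y" for X Y w
    using that by (simp add: ho_pres_simps)
  have r1: "path_class ?P X X [(X, Inl (Id C X), X)] = path_class ?P X X []" if "X \<in> Ob C" for X
    using that p1[OF that that] categoryD(1)[OF catC that]
    by (intro path_class_eq path_eq.rel) (auto simp: ho_pres_simps intro: ho_rel.intros)
  have r2: "path_class ?P X Z [(X, Inl f, Y), (Y, Inl g, Z)] = path_class ?P X Z [(X, Inl (Comp C X Y Z g f), Z)]"
    if "X \<in> Ob C" "Y \<in> Ob C" "Z \<in> Ob C" "f \<in> Hom C X Y" "g \<in> Hom C Y Z" for X Y Z f g
    using that categoryD(2)[OF catC that]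
    by (intro path_class_eq path_eq.rel) (auto simp: ho_pres_simps intro: ho_rel.intros)
  have r3: "path_class ?P X X [(X, Inl w, Y), (Y, Inr w, X)] = path_class ?P X X []"
    if "X \<in> Ob C" "Y \<in> Ob C" "w \<in> Weq C X Y" for X Y w
    using that W[OF that]
    by (intro path_class_eq path_eq.rel) (auto simp: ho_pres_simps intro: ho_rel.intros)
  have r4: "path_class ?P Y Y [(Y, Inr w, X), (X, Inl w, Y)] = path_class ?P Y Y []"
    if "X \<in> Ob C" "Y \<in> Ob C" "w \<in> Weq C X Y" for X Y w
    using that W[OF that]
    by (intro path_class_eq path_eq.rel) (auto simp: ho_pres_simps intro: ho_rel.intros)
  show "is_functor C (Ho C) (ho_unit C)"
    unfolding is_functor_def Ho_def
    using catC category_presented_cat p1 r1 r2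
    by (auto simp: ho_unit_def presented_cat_simps ho_pres_simps presented_Comp)
  show "\<exists>v. inverse_arrows (Ho C) X Y (FArr (ho_unit C) X Y w) v"
    if "X \<in> Ob C" "Y \<in> Ob C" "w \<in> Weq C X Y"
    using p1[OF that(1,2) W[OF that]] p2[OF that] r3[OF that] r4[OF that]
    unfolding inverse_arrows_def Ho_def
    by (intro exI[of _ "path_class ?P Y X [(Y, Inr w, X)]"])
      (auto simp: ho_unit_def presented_cat_simps presented_Comp)
  show "FArr F X Y c = FArr F' X Y c"
    if F: "is_functor (Ho C) D F" and F': "is_functor (Ho C) D F'"
      and ob: "\<And>X. X \<in> Ob C \<Longrightarrow> FOb F X = FOb F' X"
      and ar: "\<And>X Y f. X \<in> Ob C \<Longrightarrow> Y \<in> Ob C \<Longrightarrow> f \<in> Hom C X Y \<Longrightarrow>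
        FArr F X Y (FArr (ho_unit C) X Y f) = FArr F' X Y (FArr (ho_unit C) X Y f)"
      and c: "c \<in> Hom (Ho C) X Y"
  proof (rule presented_functors_agree[OF F[unfolded Ho_def] F'[unfolded Ho_def] _ _ c[unfolded Ho_def]])
    fix X Y e assume X: "X \<in> Verts ?P" and Y: "Y \<in> Verts ?P" and e: "e \<in> Edges ?P X Y"
    then have X: "X \<in> Ob C" and Y: "Y \<in> Ob C" and e: "e \<in> Inl ` Hom C X Y \<union> Inr ` Weq C Y X"
      by (auto simp: ho_pres_simps)
    from e show "FArr F X Y (path_class ?P X Y [(X, e, Y)]) = FArr F' X Y (path_class ?P X Y [(X, e, Y)])"
    proof
      assume "e \<in> Inl ` Hom C X Y"
      then show ?thesis using ar[OF X Y] by (auto simp: ho_unit_def)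
    next
      assume "e \<in> Inr ` Weq C Y X"
      then obtain w where w: "w \<in> Weq C Y X" and e: "e = Inr w" by auto
      let ?w = "path_class ?P Y X [(Y, Inl w, X)]" and ?v = "path_class ?P X Y [(X, Inr w, Y)]"
      have hw: "?w \<in> Hom (Ho C) Y X" and hv: "?v \<in> Hom (Ho C) X Y"
        using p1[OF Y X W[OF Y X w]] p2[OF Y X w] by (auto simp: Ho_def presented_cat_simps)
      have id1: "Comp (Ho C) Y X Y ?v ?w = Id (Ho C) Y" and id2: "Comp (Ho C) X Y X ?w ?v = Id (Ho C) X"
        using p1[OF Y X W[OF Y X w]] p2[OF Y X w] r3[OF Y X w] r4[OF Y X w]
        by (auto simp: Ho_def presented_cat_simps presented_Comp)
      have obs: "X \<in> Ob (Ho C)" "Y \<in> Ob (Ho C)" using X Y by (auto simp: Ho_def presented_cat_simps ho_pres_simps)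
      note D = is_functorD(2)[OF F]
      let ?x = "FOb F X" and ?y = "FOb F Y"
      let ?Fw = "FArr F Y X ?w" and ?Fv = "FArr F X Y ?v" and ?Gv = "FArr F' X Y ?v"
      have eqw: "?Fw = FArr F' Y X ?w" using ar[OF Y X W[OF Y X w]] by (simp add: ho_unit_def)
      have xy: "FOb F' X = ?x" "FOb F' Y = ?y" using ob X Y by auto
      have ho: "?x \<in> Ob D" "?y \<in> Ob D" using is_functorD(3)[OF F] obs by auto
      have hh: "?Fw \<in> Hom D ?y ?x" "?Fv \<in> Hom D ?x ?y" "?Gv \<in> Hom D ?x ?y"
        using is_functorD(4)[OF F] is_functorD(4)[OF F', of X Y ?v] obs hw hv by (auto simp: xy)
      have 1: "Comp D ?y ?x ?y ?Fv ?Fw = Id D ?y"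
        using is_functorD(6)[OF F, of Y X Y ?w ?v] is_functorD(5)[OF F] obs hw hv id1 by simp
      have 2: "Comp D ?x ?y ?x ?Fw ?Gv = Id D ?x"
        using is_functorD(6)[OF F', of X Y X ?v ?w] is_functorD(5)[OF F'] obs hw hv id2 by (simp add: xy eqw)
      have "?Fv = Comp D ?x ?x ?y ?Fv (Comp D ?x ?y ?x ?Fw ?Gv)"
        using categoryD(3)[OF D] ho hh by (simp add: 2)
      also have "\<dots> = Comp D ?x ?y ?y (Comp D ?y ?x ?y ?Fv ?Fw) ?Gv"
        using categoryD(5)[OF D] ho hh by simp
      also have "\<dots> = ?Gv" using categoryD(4)[OF D] ho hh by (simp add: 1)
      finally show ?thesis by (simp add: e)
    qed
  qed (use ob in \<open>auto simp: ho_pres_simps\<close>)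
  show "\<exists>F. is_functor (Ho C) D F \<and> (\<forall>X\<in>Ob C. FOb F X = FOb G X) \<and>
        (\<forall>X\<in>Ob C. \<forall>Y\<in>Ob C. \<forall>f\<in>Hom C X Y. FArr F X Y (FArr (ho_unit C) X Y f) = FArr G X Y f)"
    if G: "is_functor C D G"
      and inv: "\<And>X Y w. X \<in> Ob C \<Longrightarrow> Y \<in> Ob C \<Longrightarrow> w \<in> Weq C X Y \<Longrightarrow>
        \<exists>v. inverse_arrows D (FOb G X) (FOb G Y) (FArr G X Y w) v"
  proof -
    define iv where "iv X Y w = (SOME v. inverse_arrows D (FOb G X) (FOb G Y) (FArr G X Y w) v)" for X Y w
    have iv: "inverse_arrows D (FOb G X) (FOb G Y) (FArr G X Y w) (iv X Y w)"
      if "X \<in> Ob C" "Y \<in> Ob C" "w \<in> Weq C X Y" for X Y w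
      unfolding iv_def using inv[OF that] by (rule someI_ex)
    define g1 where "g1 X Y = case_sum (FArr G X Y) (iv Y X)" for X Y
    have D: "category D" using is_functorD[OF G] by blast
    interpret presented_target ?P D "FOb G" g1
    proof
      show "category D" by (fact D)
      show "FOb G x \<in> Ob D" if "x \<in> Verts ?P" for x
        using that is_functorD(3)[OF G] by (simp add: ho_pres_simps)
      show "g1 X Y e \<in> Hom D (FOb G X) (FOb G Y)"
        if "X \<in> Verts ?P" "Y \<in> Verts ?P" "e \<in> Edges ?P X Y" for X Y e
        using that is_functorD(4)[OF G] iv by (auto simp: ho_pres_simps g1_def inverse_arrows_def)
      fix x y p q
      assume "Rels ?P p q" "is_path ?P x p y" "is_path ?P x q y"
      then have "ho_rel C p q" "is_path ?P x p y" "is_path ?P x q y" by (auto simp: ho_pres_simps)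
      then show "path_value D (FOb G) g1 x p y = path_value D (FOb G) g1 x q y"
      proof cases
        case (1 X)
        then show ?thesis using \<open>is_path ?P x p y\<close> is_functorD(3,5)[OF G] categoryD[OF D]
          by (auto simp: g1_def)
      next
        case (2 X Y Z f g)
        moreover have "Comp C X Y Z g f \<in> Hom C X Z" using 2 categoryD(2)[OF catC] by blast
        ultimately show ?thesis using \<open>is_path ?P x p y\<close> is_functorD(3,4,6)[OF G] categoryD[OF D]
          by (auto simp: g1_def)
      next
        case (3 X Y w)
        then show ?thesis using \<open>is_path ?P x p y\<close> is_functorD(3)[OF G] categoryD[OF D] iv[of X Y w]
          by (auto simp: g1_def inverse_arrows_def)
      next
        case (4 X Y w)
        then show ?thesis using \<open>is_path ?P x p y\<close> is_functorD(3)[OF G] categoryD[OF D] iv[of X Y w]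
            is_functorD(4)[OF G, of X Y w] W
          by (auto simp: g1_def inverse_arrows_def)
      qed
    qed
    have "FArr induced X Y (FArr (ho_unit C) X Y f) = FArr G X Y f"
      if "X \<in> Ob C" "Y \<in> Ob C" "f \<in> Hom C X Y" for X Y f
      using induced_edge[of X Y "Inl f"] that by (simp add: ho_unit_def ho_pres_simps g1_def)
    then show ?thesis
      using is_functor_induced by (intro exI[of _ induced]) (auto simp: Ho_def induced_def)
  qed
qed

lemma Ho_functor_induced:
  fixes C :: "('o, 'm, 'z) relcat_scheme" and D :: "('p, 'n, 'w) relcat_scheme"
  assumes C: "relative_category C" and D: "relative_category D"
    and F: "is_functor C D F" and pres: "preserves_weq C D F"
  shows "is_functor (Ho C) (Ho D) (Ho_functor D F)"
    and "X \<in> Ob C \<Longrightarrow> FOb (Ho_functor D F) X = FOb F X"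
    and "X \<in> Ob C \<Longrightarrow> Y \<in> Ob C \<Longrightarrow> f \<in> Hom C X Y \<Longrightarrow>
      FArr (Ho_functor D F) X Y (FArr (ho_unit C) X Y f) =
      FArr (ho_unit D) (FOb F X) (FOb F Y) (FArr F X Y f)"
proof -
  let ?f1 = "\<lambda>X Y. map_sum (FArr F X Y) (FArr F Y X)"
  note Fd = is_functorD[OF F]
  have W: "X \<in> Ob C \<Longrightarrow> Y \<in> Ob C \<Longrightarrow> w \<in> Weq C X Y \<Longrightarrow>
      w \<in> Hom C X Y \<and> FArr F X Y w \<in> Weq D (FOb F X) (FOb F Y)" for X Y w
    using C pres unfolding relative_category_def arrow_class_def preserves_weq_def by blast
  have 1: "FOb F x \<in> Verts (ho_pres D)" if "x \<in> Verts (ho_pres C)" for x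
    using that Fd by (simp add: ho_pres_simps)
  have 2: "?f1 X Y e \<in> Edges (ho_pres D) (FOb F X) (FOb F Y)"
    if "X \<in> Verts (ho_pres C)" "Y \<in> Verts (ho_pres C)" "e \<in> Edges (ho_pres C) X Y" for X Y e
    using that Fd W by (auto simp: ho_pres_simps)
  have 3: "path_eq (ho_pres D) (FOb F x) (FOb F y)
      (map (\<lambda>(a, e, b). (FOb F a, ?f1 a b e, FOb F b)) p)
      (map (\<lambda>(a, e, b). (FOb F a, ?f1 a b e, FOb F b)) q)"
    if p: "is_path (ho_pres C) x p y" and q: "is_path (ho_pres C) x q y" and r: "Rels (ho_pres C) p q" for x y p q
  proof (rule path_eq.rel)
    have pth: "is_path (ho_pres D) (FOb F x) (map (\<lambda>(a, e, b). (FOb F a, ?f1 a b e, FOb F b)) p) (FOb F y)"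
      if "is_path (ho_pres C) x p y" for x p
      using that
    proof (induction p arbitrary: x)
      case Nil
      then show ?case by (auto simp: 1)
    next
      case (Cons t p)
      obtain a e b where t: "t = (a, e, b)" by (cases t)
      show ?case using Cons is_path_Verts[of "ho_pres C" b p y] by (auto simp: 1 2 t)
    qed
    show "is_path (ho_pres D) (FOb F x) (map (\<lambda>(a, e, b). (FOb F a, ?f1 a b e, FOb F b)) p) (FOb F y)"
      "is_path (ho_pres D) (FOb F x) (map (\<lambda>(a, e, b). (FOb F a, ?f1 a b e, FOb F b)) q) (FOb F y)"
      using pth p q by blast+
    have "ho_rel C p q" using r by (simp add: ho_pres_simps)
    then have "ho_rel D (map (\<lambda>(a, e, b). (FOb F a, ?f1 a b e, FOb F b)) p)
        (map (\<lambda>(a, e, b). (FOb F a, ?f1 a b e, FOb F b)) q)"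
    proof cases
      case (1 X)
      then show ?thesis using Fd ho_rel.intros(1)[of "FOb F X" D] by simp
    next
      case (2 X Y Z f g)
      then show ?thesis using Fd
          ho_rel.intros(2)[of "FOb F X" D "FOb F Y" "FOb F Z" "FArr F X Y f" "FArr F Y Z g"] by simp
    next
      case (3 X Y w)
      then show ?thesis using Fd W ho_rel.intros(3)[of "FOb F X" D "FOb F Y" "FArr F X Y w"] by simp
    next
      case (4 X Y w)
      then show ?thesis using Fd W ho_rel.intros(4)[of "FOb F X" D "FOb F Y" "FArr F X Y w"] by simp
    qed
    then show "Rels (ho_pres D) (map (\<lambda>(a, e, b). (FOb F a, ?f1 a b e, FOb F b)) p)
        (map (\<lambda>(a, e, b). (FOb F a, ?f1 a b e, FOb F b)) q)"
      by (simp add: ho_pres_simps)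
  qed
  note pf = is_functor_presented_functor[of "ho_pres C" "FOb F" "ho_pres D" ?f1, OF 1 2 3]
  show "is_functor (Ho C) (Ho D) (Ho_functor D F)"
    unfolding Ho_def Ho_functor_def by (rule pf(1))
  show "FOb (Ho_functor D F) X = FOb F X"
    by (simp add: Ho_functor_def presented_functor_def)
  show "FArr (Ho_functor D F) X Y (FArr (ho_unit C) X Y f) =
      FArr (ho_unit D) (FOb F X) (FOb F Y) (FArr F X Y f)"
    if "X \<in> Ob C" "Y \<in> Ob C" "f \<in> Hom C X Y"
    using pf(2)[of X "[(X, Inl f, Y)]" Y] that
    by (simp add: Ho_functor_def ho_unit_def ho_pres_simps)
qed

subsection \<open>The fundamental category as left adjoint of the nerve\<close>

lemma Act_in:
  "simplicial_set X \<Longrightarrow> \<theta> \<in> Delta m n \<Longrightarrow> x \<in> Simp X n \<Longrightarrow> Act X m n \<theta> x \<in> Simp X m"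
  unfolding simplicial_set_def by blast

lemma Act_Act:
  "simplicial_set X \<Longrightarrow> \<phi> \<in> Delta k m \<Longrightarrow> \<theta> \<in> Delta m n \<Longrightarrow> x \<in> Simp X n \<Longrightarrow>
   Act X k m \<phi> (Act X m n \<theta> x) = Act X k n (compose {..k} \<theta> \<phi>) x"
  unfolding simplicial_set_def by simp

lemma Act_id: "simplicial_set X \<Longrightarrow> x \<in> Simp X n \<Longrightarrow> Act X n n (\<lambda>i\<in>{..n}. i) x = x"
  unfolding simplicial_set_def by simp

lemma vtx_Delta: "i \<le> n \<Longrightarrow> vtx i \<in> Delta 0 n"
  by (auto simp: vtx_def Delta_def mono_on_def)

lemma edg_Delta: "i \<le> j \<Longrightarrow> j \<le> n \<Longrightarrow> edg i j \<in> Delta 1 n"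
  by (auto simp: edg_def Delta_def mono_on_def)

definition tri :: "nat \<Rightarrow> nat \<Rightarrow> nat \<Rightarrow> nat \<Rightarrow> nat" where
  "tri i j k = (\<lambda>l\<in>{..2}. if l = 0 then i else if l = 1 then j else k)"

lemma tri_Delta: "i \<le> j \<Longrightarrow> j \<le> k \<Longrightarrow> k \<le> n \<Longrightarrow> tri i j k \<in> Delta 2 n"
  by (auto simp: tri_def Delta_def mono_on_def)

lemma Delta_le: "\<theta> \<in> Delta m n \<Longrightarrow> i \<le> m \<Longrightarrow> \<theta> i \<le> n"
  unfolding Delta_def by auto

lemma Delta_mono: "\<theta> \<in> Delta m n \<Longrightarrow> i \<le> j \<Longrightarrow> j \<le> m \<Longrightarrow> \<theta> i \<le> \<theta> j"
  unfolding Delta_def by (auto simp: mono_on_def)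

lemma compose_vtx: "compose {..0} \<theta> (vtx i) = vtx (\<theta> i)"
  by (auto simp: compose_def vtx_def)

lemma compose_edg: "compose {..1} \<theta> (edg i j) = edg (\<theta> i) (\<theta> j)"
  by (auto simp: compose_def edg_def)

lemma svert_in: "simplicial_set X \<Longrightarrow> i \<le> n \<Longrightarrow> x \<in> Simp X n \<Longrightarrow> svert X n i x \<in> Simp X 0"
  unfolding svert_def by (intro Act_in vtx_Delta)

lemma svert_Act:
  "simplicial_set X \<Longrightarrow> \<theta> \<in> Delta m n \<Longrightarrow> x \<in> Simp X n \<Longrightarrow> i \<le> m \<Longrightarrow>
   svert X m i (Act X m n \<theta> x) = svert X n (\<theta> i) x"
  unfolding svert_def by (metis Act_Act vtx_Delta compose_vtx)

lemma edge_Act: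
  "simplicial_set X \<Longrightarrow> \<theta> \<in> Delta m n \<Longrightarrow> x \<in> Simp X n \<Longrightarrow> i \<le> j \<Longrightarrow> j \<le> m \<Longrightarrow>
   Act X 1 m (edg i j) (Act X m n \<theta> x) = Act X 1 n (edg (\<theta> i) (\<theta> j)) x"
  by (metis Act_Act edg_Delta compose_edg)

lemma sedge_Act:
  "simplicial_set X \<Longrightarrow> \<theta> \<in> Delta m n \<Longrightarrow> x \<in> Simp X n \<Longrightarrow> i \<le> j \<Longrightarrow> j \<le> m \<Longrightarrow>
   sedge X m i j (Act X m n \<theta> x) = sedge X n (\<theta> i) (\<theta> j) x"
  unfolding sedge_def using edge_Act[of X \<theta> m n x i j] by (simp add: svert_Act)

lemma svert_0: "simplicial_set X \<Longrightarrow> x \<in> Simp X 0 \<Longrightarrow> svert X 0 0 x = x"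
  using Act_id[of X x 0] by (simp add: svert_def vtx_def atMost_0 restrict_def cong: if_cong)

lemma sedge_01:
  assumes "simplicial_set X" "e \<in> Simp X 1"
  shows "sedge X 1 0 1 e = (svert X 1 0 e, e, svert X 1 1 e)"
proof -
  have "edg 0 1 = (\<lambda>i\<in>{..1}. i)" by (auto simp: edg_def restrict_def fun_eq_iff)
  then show ?thesis using Act_id[OF assms] by (simp add: sedge_def)
qed

lemma sedge_path:
  assumes "simplicial_set X" "x \<in> Simp X n" "i \<le> j" "j \<le> n"
  shows "is_path (tau1_pres X) (svert X n i x) [sedge X n i j x] (svert X n j x)"
proof -
  have 1: "svert X 1 0 (Act X 1 n (edg i j) x) = svert X n i x" "svert X 1 1 (Act X 1 n (edg i j) x) = svert X n j x"
    using assms edg_Delta[of i j n] by (subst svert_Act; simp add: edg_def)+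
  show ?thesis
    using assms 1 Act_in[OF assms(1) edg_Delta assms(2), of i j]
    by (auto simp: tau1_pres_def sedge_def svert_in)
qed

abbreviation eclass where
  "eclass X n i j x \<equiv> path_class (tau1_pres X) (svert X n i x) (svert X n j x) [sedge X n i j x]"

lemma eclass_refl:
  assumes X: "simplicial_set X" and x: "x \<in> Simp X n" and i: "i \<le> n"
  shows "eclass X n i i x = path_class (tau1_pres X) (svert X n i x) (svert X n i x) []"
proof -
  let ?v = "svert X n i x"
  have v: "?v \<in> Simp X 0" using svert_in[OF X i x] .
  have "sedge X 0 0 0 ?v = sedge X n i i x"
    using sedge_Act[OF X vtx_Delta[OF i] x, of 0 0] by (simp add: svert_def vtx_def)
  then have "tau1_rel X [sedge X n i i x] []" using tau1_rel.degenerate[OF v] by simp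
  then show ?thesis using sedge_path[OF X x _ i, of i] v
    by (intro path_class_eq path_eq.rel) (auto simp: tau1_pres_def)
qed

lemma eclass_trans:
  assumes X: "simplicial_set X" and x: "x \<in> Simp X n" and ijk: "i \<le> j" "j \<le> k" "k \<le> n"
  shows "eclass X n i k x = path_class (tau1_pres X) (svert X n i x) (svert X n k x) [sedge X n i j x, sedge X n j k x]"
proof -
  let ?s = "Act X 2 n (tri i j k) x"
  note t = tri_Delta[OF ijk]
  have s: "?s \<in> Simp X 2" using Act_in[OF X t x] .
  have "sedge X 2 0 1 ?s = sedge X n i j x" "sedge X 2 1 2 ?s = sedge X n j k x" "sedge X 2 0 2 ?s = sedge X n i k x"
    using sedge_Act[OF X t x, of 0 1] sedge_Act[OF X t x, of 1 2] sedge_Act[OF X t x, of 0 2]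
    by (simp_all add: tri_def)
  then have r: "tau1_rel X [sedge X n i j x, sedge X n j k x] [sedge X n i k x]"
    using tau1_rel.triangle[OF s] by simp
  have 1: "is_path (tau1_pres X) (svert X n i x) [sedge X n i j x, sedge X n j k x] (svert X n k x)"
    using is_path_append[OF sedge_path[OF X x ijk(1)] sedge_path[OF X x ijk(2,3)]] ijk by simp
  have 2: "is_path (tau1_pres X) (svert X n i x) [sedge X n i k x] (svert X n k x)"
    using sedge_path[OF X x, of i k] ijk by simp
  show ?thesis
    using path_class_eq[OF path_eq.rel[OF 1 2]] r by (simp add: tau1_pres_def)
qed

lemma nerve_simpI:
  assumes "a \<in> extensional {..n}" "h \<in> extensional {(i, j). i \<le> j \<and> j \<le> n}"
    and "\<And>i. i \<le> n \<Longrightarrow> a i \<in> Ob C"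
    and "\<And>i j. i \<le> j \<Longrightarrow> j \<le> n \<Longrightarrow> h (i, j) \<in> Hom C (a i) (a j)"
    and "\<And>i. i \<le> n \<Longrightarrow> h (i, i) = Id C (a i)"
    and "\<And>i j k. i \<le> j \<Longrightarrow> j \<le> k \<Longrightarrow> k \<le> n \<Longrightarrow>
      h (i, k) = Comp C (a i) (a j) (a k) (h (j, k)) (h (i, j))"
  shows "(a, h) \<in> nerve_simp C n"
  unfolding nerve_simp_def mem_Collect_eq prod.case
proof (intro conjI allI impI)
  show "a \<in> {..n} \<rightarrow>\<^sub>E Ob C" using assms(1,3) by (auto simp: PiE_def)
qed (rule assms; assumption)+

lemma nerve_simpD:
  assumes "(a, h) \<in> nerve_simp C n"
  shows "a \<in> extensional {..n}" "h \<in> extensional {(i, j). i \<le> j \<and> j \<le> n}"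
    and "i \<le> n \<Longrightarrow> a i \<in> Ob C"
    and "i \<le> j \<Longrightarrow> j \<le> n \<Longrightarrow> h (i, j) \<in> Hom C (a i) (a j)"
    and "i \<le> n \<Longrightarrow> h (i, i) = Id C (a i)"
    and "i \<le> j \<Longrightarrow> j \<le> k \<Longrightarrow> k \<le> n \<Longrightarrow>
      h (i, k) = Comp C (a i) (a j) (a k) (h (j, k)) (h (i, j))"
proof -
  have *: "a \<in> {..n} \<rightarrow>\<^sub>E Ob C \<and>
     h \<in> extensional {(i, j). i \<le> j \<and> j \<le> n} \<and>
     (\<forall>j\<le>n. \<forall>i\<le>j. h (i, j) \<in> Hom C (a i) (a j)) \<and>
     (\<forall>i\<le>n. h (i, i) = Id C (a i)) \<and>
     (\<forall>k\<le>n. \<forall>j\<le>k. \<forall>i\<le>j. h (i, k) = Comp C (a i) (a j) (a k) (h (j, k)) (h (i, j)))"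
    using assms unfolding nerve_simp_def mem_Collect_eq prod.case .
  have a: "a \<in> {..n} \<rightarrow>\<^sub>E Ob C" using * by (rule conjunct1)
  show "a \<in> extensional {..n}" "i \<le> n \<Longrightarrow> a i \<in> Ob C"
    using a by (auto simp: PiE_def)
  show "h \<in> extensional {(i, j). i \<le> j \<and> j \<le> n}" using * by (elim conjE)
  show "i \<le> j \<Longrightarrow> j \<le> n \<Longrightarrow> h (i, j) \<in> Hom C (a i) (a j)"
    "i \<le> n \<Longrightarrow> h (i, i) = Id C (a i)"
    "i \<le> j \<Longrightarrow> j \<le> k \<Longrightarrow> k \<le> n \<Longrightarrow>
      h (i, k) = Comp C (a i) (a j) (a k) (h (j, k)) (h (i, j))"
    using *[THEN conjunct2, THEN conjunct2] by blast+
qed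

lemma simplicial_set_nerve:
  assumes C: "category C"
  shows "simplicial_set (nerve C)"
proof -
  have act: "Act (nerve C) m n \<theta> (a, h) = (compose {..m} a \<theta>, \<lambda>(i, j)\<in>{(i, j). i \<le> j \<and> j \<le> m}. h (\<theta> i, \<theta> j))"
    if "\<theta> \<in> Delta m n" "(a, h) \<in> nerve_simp C n" for m n \<theta> a h
    using that by (simp add: nerve_def)
  have mem: "(compose {..m} a \<theta>, \<lambda>(i, j)\<in>{(i, j). i \<le> j \<and> j \<le> m}. h (\<theta> i, \<theta> j)) \<in> nerve_simp C m"
    if t: "\<theta> \<in> Delta m n" and a: "(a, h) \<in> nerve_simp C n" for m n \<theta> a h
  proof (rule nerve_simpI, goal_cases)
    case (6 i j k)
    then show ?case
      using nerve_simpD(6)[OF a, of "\<theta> i" "\<theta> j" "\<theta> k"] Delta_le[OF t, of k] Delta_mono[OF t]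
      by (simp add: compose_def)
  qed (use nerve_simpD(3-5)[OF a] Delta_le[OF t] Delta_mono[OF t] in \<open>auto simp: compose_def\<close>)
  show ?thesis
    unfolding simplicial_set_def
  proof (intro conjI allI impI ballI)
    fix m n \<theta> assume t: "\<theta> \<in> Delta m n"
    show "Act (nerve C) m n \<theta> \<in> Simp (nerve C) n \<rightarrow>\<^sub>E Simp (nerve C) m"
      using t mem[OF t] by (auto simp: nerve_def)
  next
    fix m n \<theta> assume "\<theta> \<notin> Delta m n"
    then show "Act (nerve C) m n \<theta> = (\<lambda>_. undefined)" by (simp add: nerve_def)
  next
    fix n x assume x: "x \<in> Simp (nerve C) n"
    obtain a h where ah: "x = (a, h)" by (cases x)
    have i: "(\<lambda>i\<in>{..n}. i) \<in> Delta n n" by (auto simp: Delta_def mono_on_def)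
    have m: "(a, h) \<in> nerve_simp C n" using x ah by (simp add: nerve_def)
    have "compose {..n} a (\<lambda>i\<in>{..n}. i) = a"
      using m by (auto simp: nerve_simp_def compose_def PiE_def extensional_def fun_eq_iff)
    moreover have "(\<lambda>(i, j)\<in>{(i, j). i \<le> j \<and> j \<le> n}. h ((\<lambda>i\<in>{..n}. i) i, (\<lambda>i\<in>{..n}. i) j)) = h"
      using m by (auto simp: nerve_simp_def extensional_def fun_eq_iff)
    ultimately show "Act (nerve C) n n (\<lambda>i\<in>{..n}. i) x = x"
      unfolding ah using act[OF i m] by simp
  next
    fix k m n \<phi> \<theta> x assume p: "\<phi> \<in> Delta k m" and t: "\<theta> \<in> Delta m n" and x: "x \<in> Simp (nerve C) n"
    obtain a h where ah: "x = (a, h)" by (cases x)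
    have m: "(a, h) \<in> nerve_simp C n" using x ah by (simp add: nerve_def)
    have c: "compose {..k} \<theta> \<phi> \<in> Delta k n"
      using Delta_le[OF p] Delta_le[OF t] Delta_mono[OF p] Delta_mono[OF t]
      by (auto simp: Delta_def compose_def mono_on_def)
    show "Act (nerve C) k n (compose {..k} \<theta> \<phi>) x = Act (nerve C) k m \<phi> (Act (nerve C) m n \<theta> x)"
      unfolding ah act[OF t m] act[OF p mem[OF t m]] act[OF c m]
      using Delta_le[OF p] Delta_mono[OF p] by (auto simp: compose_def fun_eq_iff)
  qed
qed

lemma nerve_map_sHom:
  assumes F: "is_functor C D F"
  shows "nerve_map C F \<in> sHom (nerve C) (nerve D)"
proof -
  have mem: "(\<lambda>i\<in>{..n}. FOb F (a i), \<lambda>(i, j)\<in>{(i, j). i \<le> j \<and> j \<le> n}. FArr F (a i) (a j) (h (i, j))) \<in> nerve_simp D n"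
    if a: "(a, h) \<in> nerve_simp C n" for a h n
  proof -
    note o = nerve_simpD(3)[OF a] and hm = nerve_simpD(4)[OF a] and hi = nerve_simpD(5)[OF a]
      and hc = nerve_simpD(6)[OF a]
    have c: "FArr F (a i) (a k) (h (i, k)) = Comp D (FOb F (a i)) (FOb F (a j)) (FOb F (a k))
        (FArr F (a j) (a k) (h (j, k))) (FArr F (a i) (a j) (h (i, j)))" if "i \<le> j" "j \<le> k" "k \<le> n" for i j k
      unfolding hc[OF that] using that by (intro is_functorD(6)[OF F] o hm) auto
    show ?thesis
    proof (rule nerve_simpI, goal_cases)
      case (6 i j k)
      then show ?case using c[OF 6] by simp
    qed (use is_functorD(3-5)[OF F] o hm hi in auto)
  qed
  show ?thesis
    unfolding sHom_def mem_Collect_eq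
  proof (intro conjI allI ballI)
    fix n show "nerve_map C F n \<in> Simp (nerve C) n \<rightarrow>\<^sub>E Simp (nerve D) n"
      using mem by (auto simp: nerve_map_def nerve_def)
  next
    fix m n \<theta> x assume t: "\<theta> \<in> Delta m n" and x: "x \<in> Simp (nerve C) n"
    obtain a h where ah: "x = (a, h)" by (cases x)
    have m: "(a, h) \<in> nerve_simp C n" using x ah by (simp add: nerve_def)
    have A: "Act (nerve C) m n \<theta> (a, h) = (compose {..m} a \<theta>, \<lambda>(i, j)\<in>{(i, j). i \<le> j \<and> j \<le> m}. h (\<theta> i, \<theta> j))"
      using t m by (simp add: nerve_def)
    have "Act (nerve C) m n \<theta> (a, h) \<in> Simp (nerve C) m"
      using Act_in[OF simplicial_set_nerve[OF is_functorD(1)[OF F]] t x] ah by simp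
    then have m': "(compose {..m} a \<theta>, \<lambda>(i, j)\<in>{(i, j). i \<le> j \<and> j \<le> m}. h (\<theta> i, \<theta> j)) \<in> nerve_simp C m"
      unfolding A by (simp add: nerve_def)
    show "nerve_map C F m (Act (nerve C) m n \<theta> x) = Act (nerve D) m n \<theta> (nerve_map C F n x)"
      unfolding ah A using t m m' mem[OF m] Delta_le[OF t] Delta_mono[OF t]
      by (auto simp: nerve_map_def nerve_def compose_def fun_eq_iff)
  qed
qed

lemma tau1_unit_sHom:
  assumes X: "simplicial_set X"
  shows "tau1_unit X \<in> sHom X (nerve (tau1 X))"
proof -
  have mem: "tau1_unit X n x \<in> nerve_simp (tau1 X) n" if x: "x \<in> Simp X n" for n x
  proof -
    have c: "eclass X n i k x = Comp (tau1 X) (svert X n i x) (svert X n j x) (svert X n k x)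
        (eclass X n j k x) (eclass X n i j x)" if "i \<le> j" "j \<le> k" "k \<le> n" for i j k
    proof -
      have "i \<le> j" "j \<le> n" "j \<le> k" "k \<le> n" using that by auto
      from presented_Comp[OF sedge_path[OF X x this(1,2)] sedge_path[OF X x this(3,4)]]
      show ?thesis unfolding tau1_def eclass_trans[OF X x that] by simp
    qed
    have h: "eclass X n i j x \<in> Hom (tau1 X) (svert X n i x) (svert X n j x)" if "i \<le> j" "j \<le> n" for i j
      using sedge_path[OF X x that] by (simp add: tau1_def presented_cat_simps)
    have o: "svert X n i x \<in> Ob (tau1 X)" if "i \<le> n" for i
      using svert_in[OF X that x] by (simp add: tau1_def presented_cat_simps tau1_pres_def)
    have r: "eclass X n i i x = Id (tau1 X) (svert X n i x)" if "i \<le> n" for i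
      using eclass_refl[OF X x that] by (simp add: tau1_def presented_cat_simps)
    have u: "tau1_unit X n x = (\<lambda>i\<in>{..n}. svert X n i x,
        \<lambda>(i, j)\<in>{(i, j). i \<le> j \<and> j \<le> n}. eclass X n i j x)"
      using x by (simp add: tau1_unit_def)
    show ?thesis unfolding u
    proof (rule nerve_simpI, goal_cases)
      case (6 i j k)
      then show ?case using c[OF 6] by simp
    qed (use h o r in auto)
  qed
  show ?thesis
    unfolding sHom_def mem_Collect_eq
  proof (intro conjI allI ballI)
    fix n show "tau1_unit X n \<in> Simp X n \<rightarrow>\<^sub>E Simp (nerve (tau1 X)) n"
      using mem by (auto simp: nerve_def tau1_unit_def)
  next
    fix m n \<theta> x assume t: "\<theta> \<in> Delta m n" and x: "x \<in> Simp X n"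
    show "tau1_unit X m (Act X m n \<theta> x) = Act (nerve (tau1 X)) m n \<theta> (tau1_unit X n x)"
      using t x Act_in[OF X t x] mem[OF x] svert_Act[OF X t x] sedge_Act[OF X t x] Delta_le[OF t] Delta_mono[OF t]
      by (auto simp: tau1_unit_def nerve_def compose_def fun_eq_iff)
  qed
qed

lemma tau1_left_adjoint:
  assumes X: "simplicial_set X" and D: "category D" and f: "f \<in> sHom X (nerve D)"
  shows "\<exists>F. is_functor (tau1 X) D F \<and> scomp X (nerve_map (tau1 X) F) (tau1_unit X) = f"
    and "is_functor (tau1 X) D F \<Longrightarrow> is_functor (tau1 X) D F' \<Longrightarrow>
      scomp X (nerve_map (tau1 X) F) (tau1_unit X) = f \<Longrightarrow>
      scomp X (nerve_map (tau1 X) F') (tau1_unit X) = f \<Longrightarrow>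
      (\<forall>x\<in>Simp X 0. FOb F x = FOb F' x) \<and> (\<forall>x y. \<forall>c\<in>Hom (tau1 X) x y. FArr F x y c = FArr F' x y c)"
proof -
  let ?P = "tau1_pres X"
  have unit: "tau1_unit X n x \<in> nerve_simp (tau1 X) n" if "x \<in> Simp X n" for n x
    using tau1_unit_sHom[OF X] that by (auto simp: sHom_def nerve_def)
  have transp: "scomp X (nerve_map (tau1 X) F) (tau1_unit X) n x =
      (\<lambda>i\<in>{..n}. FOb F (svert X n i x),
       \<lambda>(i, j)\<in>{(i, j). i \<le> j \<and> j \<le> n}. FArr F (svert X n i x) (svert X n j x) (eclass X n i j x))"
    if x: "x \<in> Simp X n" for F :: "('a, ('a \<times> 'a \<times> 'a) list set, 'b, 'c) fctr" and n x
    using unit[OF x] x by (auto simp: scomp_def compose_def nerve_map_def tau1_unit_def fun_eq_iff)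
  show "(\<forall>x\<in>Simp X 0. FOb F x = FOb F' x) \<and> (\<forall>x y. \<forall>c\<in>Hom (tau1 X) x y. FArr F x y c = FArr F' x y c)"
    if F: "is_functor (tau1 X) D F" and F': "is_functor (tau1 X) D F'"
      and "scomp X (nerve_map (tau1 X) F) (tau1_unit X) = f"
      and "scomp X (nerve_map (tau1 X) F') (tau1_unit X) = f"
  proof -
    have eq: "scomp X (nerve_map (tau1 X) F) (tau1_unit X) n x = scomp X (nerve_map (tau1 X) F') (tau1_unit X) n x" for n x
      using that by simp
    have ob: "FOb F x = FOb F' x" if x: "x \<in> Simp X 0" for x
      using fun_cong[OF arg_cong[OF eq[of 0 x], of fst], of 0] x by (simp add: transp svert_0[OF X])
    have ed: "FArr F x y (path_class ?P x y [(x, e, y)]) = FArr F' x y (path_class ?P x y [(x, e, y)])"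
      if "e \<in> Edges ?P x y" for x y e
    proof -
      from that have e: "e \<in> Simp X 1" "svert X 1 0 e = x" "svert X 1 1 e = y" by (auto simp: tau1_pres_def)
      show ?thesis
        using fun_cong[OF arg_cong[OF eq[of 1 e], of snd], of "(0, 1)"] e
        by (simp add: transp sedge_01[OF X, simplified])
    qed
    show ?thesis
      using presented_functors_agree[OF F[unfolded tau1_def] F'[unfolded tau1_def]] ob ed
      unfolding tau1_def by (simp add: tau1_pres_def)
  qed
  define g0 where "g0 x = fst (f 0 x) 0" for x
  define g1 where "g1 = (\<lambda>(x::'a) (y::'a) e. snd (f 1 e) (0, 1::nat))"
  have fn: "f n x \<in> nerve_simp D n" if "x \<in> Simp X n" for n x
    using f that by (auto simp: sHom_def nerve_def)
  have nat: "f m (Act X m n \<theta> x) = Act (nerve D) m n \<theta> (f n x)" if "\<theta> \<in> Delta m n" "x \<in> Simp X n" for m n \<theta> x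
    using f that by (auto simp: sHom_def)
  have f0: "fst (f n x) i = g0 (svert X n i x)" if x: "x \<in> Simp X n" and i: "i \<le> n" for n x i
    using nat[OF vtx_Delta[OF i] x] fn[OF x] vtx_Delta[OF i]
    by (auto simp: g0_def svert_def nerve_def compose_def vtx_def split: prod.splits)
  have f1: "snd (f n x) (i, j) = g1 u v (Act X 1 n (edg i j) x)" if x: "x \<in> Simp X n" and ij: "i \<le> j" "j \<le> n" for n x i j u v
    using nat[OF edg_Delta[OF ij] x] fn[OF x] edg_Delta[OF ij]
    by (auto simp: g1_def nerve_def edg_def split: prod.splits)
  have fp: "(fst (f n x), snd (f n x)) \<in> nerve_simp D n" if "x \<in> Simp X n" for n x
    using fn[OF that] by simp
  note fx = nerve_simpD(3)[OF fp] and fh = nerve_simpD(4)[OF fp] and fi = nerve_simpD(5)[OF fp]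
    and fc = nerve_simpD(6)[OF fp]
  have val1: "path_value D g0 g1 (svert X n i x) [sedge X n i j x] y = snd (f n x) (i, j)"
    if x: "x \<in> Simp X n" "i \<le> j" "j \<le> n" "y = svert X n j x" for n x i j y
  proof -
    have e: "g1 (svert X n i x) (svert X n j x) (Act X 1 n (edg i j) x) \<in> Hom D (g0 (svert X n i x)) (g0 (svert X n j x))"
      using fh[OF x(1-3)] x f0[OF x(1)] f1[OF x(1-3)] by simp
    have o: "g0 (svert X n i x) \<in> Ob D" "g0 (svert X n j x) \<in> Ob D"
      using fx[OF x(1)] f0[OF x(1)] x by auto
    show ?thesis
      using categoryD(4)[OF D o e] f1[OF x(1-3)] x(4) by (simp add: sedge_def)
  qed
  interpret presented_target ?P D g0 g1
  proof
    show "category D" by (fact D)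
    show "g0 x \<in> Ob D" if "x \<in> Verts ?P" for x
      using that fx[of x 0 0] by (simp add: tau1_pres_def g0_def)
    show "g1 x y e \<in> Hom D (g0 x) (g0 y)" if "e \<in> Edges ?P x y" for x y e
      using that fh[of e 1 0 1] f0[of e 1 0] f0[of e 1 1] by (simp add: tau1_pres_def g1_def)
    fix x y p q
    assume "Rels ?P p q" and pp: "is_path ?P x p y" and qq: "is_path ?P x q y"
    then have "tau1_rel X p q" by (simp add: tau1_pres_def)
    then show "path_value D g0 g1 x p y = path_value D g0 g1 x q y"
    proof cases
      case (degenerate v)
      have "x = svert X 0 0 v" "y = x" using pp qq degenerate by (auto simp: sedge_def)
      then show ?thesis
        using val1[OF degenerate(3), of 0 0 x] fi[OF degenerate(3), of 0] f0[OF degenerate(3), of 0] degenerate by simp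
    next
      case (triangle s)
      have xy: "x = svert X 2 0 s" "y = svert X 2 2 s" using pp qq triangle by (auto simp: sedge_def)
      have "path_value D g0 g1 x p y = Comp D (g0 (svert X 2 0 s)) (g0 (svert X 2 1 s)) (g0 y)
          (path_value D g0 g1 (svert X 2 1 s) [sedge X 2 1 2 s] y) (g1 (svert X 2 0 s) (svert X 2 1 s) (Act X 1 2 (edg 0 1) s))"
        unfolding triangle(1) sedge_def[of X 2 0 1] by simp
      also have "\<dots> = snd (f 2 s) (0, 2)"
        using val1[OF triangle(3), of 1 2 y] xy fc[OF triangle(3), of 0 1 2] f0[OF triangle(3)]
          f1[OF triangle(3), of 0 1] by simp
      also have "\<dots> = path_value D g0 g1 x q y"
        using val1[OF triangle(3), of 0 2 y] xy triangle(2) by simp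
      finally show ?thesis .
    qed
  qed
  have ie: "FArr induced (svert X n i x) (svert X n j x) (eclass X n i j x) = snd (f n x) (i, j)"
    if "x \<in> Simp X n" "i \<le> j" "j \<le> n" for n x i j
    using induced_class[OF sedge_path[OF X that]] val1[OF that] by simp
  have io: "FOb induced = g0" by (simp add: induced_def)
  have "scomp X (nerve_map (tau1 X) induced) (tau1_unit X) n x = f n x" for n x
  proof (cases "x \<in> Simp X n")
    case True
    obtain a h where ah: "f n x = (a, h)" by (cases "f n x")
    have "a \<in> extensional {..n}" "h \<in> extensional {(i, j). i \<le> j \<and> j \<le> n}"
      using nerve_simpD(1,2)[OF fp[OF True]] by (simp_all add: ah)
    then show ?thesis
      unfolding transp[OF True] ah io using ie[OF True] f0[OF True]
      by (auto simp: ah fun_eq_iff extensional_def)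
  next
    case False
    then show ?thesis using f by (auto simp: scomp_def compose_def sHom_def PiE_def extensional_def)
  qed
  then show "\<exists>F. is_functor (tau1 X) D F \<and> scomp X (nerve_map (tau1 X) F) (tau1_unit X) = f"
    using is_functor_induced unfolding tau1_def[symmetric] by (intro exI[of _ induced]) (simp add: fun_eq_iff)
qed

subsection \<open>Exponentials\<close>

lemma compose_Delta: "\<phi> \<in> Delta k m \<Longrightarrow> \<theta> \<in> Delta m n \<Longrightarrow> compose {..k} \<theta> \<phi> \<in> Delta k n"
  using Delta_le[of \<phi> k m] Delta_le[of \<theta> m n] Delta_mono[of \<phi> k m] Delta_mono[of \<theta> m n]
  by (auto simp: Delta_def compose_def mono_on_def)

lemma Delta_compose_assoc:
  "\<phi> \<in> Delta k m \<Longrightarrow> compose {..k} \<sigma> (compose {..k} \<theta> \<phi>) = compose {..k} (compose {..m} \<sigma> \<theta>) \<phi>"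
  by (auto simp: compose_def Delta_le fun_eq_iff)

lemma Delta_id: "(\<lambda>i\<in>{..n}. i) \<in> Delta n n"
  by (auto simp: Delta_def mono_on_def)

lemma compose_Delta_id: "\<sigma> \<in> Delta m n \<Longrightarrow> compose {..m} \<sigma> (\<lambda>i\<in>{..m}. i) = \<sigma>"
  "\<sigma> \<in> Delta m n \<Longrightarrow> compose {..m} (\<lambda>i\<in>{..n}. i) \<sigma> = \<sigma>"
  using Delta_le[of \<sigma> m n]
  by (auto simp: Delta_def compose_def fun_eq_iff PiE_def extensional_def)

lemma simplicial_set_std_simplex: "simplicial_set (std_simplex n)"
  unfolding simplicial_set_def
  by (auto simp: std_simplex_def compose_Delta compose_Delta_id Delta_id Delta_compose_assoc)

lemma simplicial_set_sprod:
  assumes X: "simplicial_set X" and Y: "simplicial_set Y"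
  shows "simplicial_set (sprod X Y)"
  unfolding simplicial_set_def
  using Act_in[OF X] Act_in[OF Y] Act_id[OF X] Act_id[OF Y] Act_Act[OF X] Act_Act[OF Y]
  by (auto simp: sprod_def compose_Delta Delta_id)

lemma sprod_simplex_simps:
  "Simp (sprod (std_simplex n) X) k = Delta k n \<times> Simp X k"
  "\<theta> \<in> Delta l k \<Longrightarrow> \<sigma> \<in> Delta k n \<Longrightarrow> x \<in> Simp X k \<Longrightarrow>
   Act (sprod (std_simplex n) X) l k \<theta> (\<sigma>, x) = (compose {..l} \<sigma> \<theta>, Act X l k \<theta> x)"
  by (simp_all add: sprod_def std_simplex_def)

lemma esimp_iff:
  "u \<in> sHom (sprod (std_simplex n) X) Y \<longleftrightarrow>
    (\<forall>k. u k \<in> extensional (Delta k n \<times> Simp X k)) \<and>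
    (\<forall>k. \<forall>\<sigma>\<in>Delta k n. \<forall>x\<in>Simp X k. u k (\<sigma>, x) \<in> Simp Y k) \<and>
    (\<forall>l k. \<forall>\<theta>\<in>Delta l k. \<forall>\<sigma>\<in>Delta k n. \<forall>x\<in>Simp X k.
       u l (compose {..l} \<sigma> \<theta>, Act X l k \<theta> x) = Act Y l k \<theta> (u k (\<sigma>, x)))"
  unfolding sHom_def by (auto simp: sprod_simplex_simps PiE_def)

lemma simplicial_set_sexp:
  assumes X: "simplicial_set X"
  shows "simplicial_set (sexp X Y)"
proof -
  have mem: "(\<lambda>k. \<lambda>(\<sigma>, x)\<in>Delta k m \<times> Simp X k. u k (compose {..k} \<theta> \<sigma>, x)) \<in> sHom (sprod (std_simplex m) X) Y"
    if t: "\<theta> \<in> Delta m n" and u: "u \<in> sHom (sprod (std_simplex n) X) Y" for m n \<theta> u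
    unfolding esimp_iff
  proof (intro conjI allI ballI)
    fix l k \<phi> \<sigma> x assume p: "\<phi> \<in> Delta l k" and s: "\<sigma> \<in> Delta k m" and x: "x \<in> Simp X k"
    have "u l (compose {..l} (compose {..k} \<theta> \<sigma>) \<phi>, Act X l k \<phi> x) = Act Y l k \<phi> (u k (compose {..k} \<theta> \<sigma>, x))"
      using u compose_Delta[OF s t] p x unfolding esimp_iff by blast
    then show "(\<lambda>(\<sigma>, x)\<in>Delta l m \<times> Simp X l. u l (compose {..l} \<theta> \<sigma>, x)) (compose {..l} \<sigma> \<phi>, Act X l k \<phi> x) =
       Act Y l k \<phi> ((\<lambda>(\<sigma>, x)\<in>Delta k m \<times> Simp X k. u k (compose {..k} \<theta> \<sigma>, x)) (\<sigma>, x))"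
      using p s x compose_Delta[OF p s] Act_in[OF X p x] by (simp add: Delta_compose_assoc[OF p])
  qed (use u compose_Delta[OF _ t] in \<open>auto simp: esimp_iff\<close>)
  have ext: "u k (\<sigma>, x) = undefined" if "u \<in> sHom (sprod (std_simplex n) X) Y" "\<not> (\<sigma> \<in> Delta k n \<and> x \<in> Simp X k)" for u n k \<sigma> x
    using that unfolding esimp_iff extensional_def by blast
  show ?thesis
    unfolding simplicial_set_def
  proof (intro conjI allI impI ballI)
    fix m n \<theta> assume t: "\<theta> \<in> Delta m n"
    show "Act (sexp X Y) m n \<theta> \<in> Simp (sexp X Y) n \<rightarrow>\<^sub>E Simp (sexp X Y) m"
      using t mem[OF t] by (auto simp: sexp_def)
  next
    fix m n \<theta> assume "\<theta> \<notin> Delta m n"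
    then show "Act (sexp X Y) m n \<theta> = (\<lambda>_. undefined)" by (simp add: sexp_def)
  next
    fix n u assume "u \<in> Simp (sexp X Y) n"
    then have u: "u \<in> sHom (sprod (std_simplex n) X) Y" by (simp add: sexp_def)
    then show "Act (sexp X Y) n n (\<lambda>i\<in>{..n}. i) u = u"
      using ext[OF u] by (auto simp: sexp_def Delta_id compose_Delta_id fun_eq_iff)
  next
    fix k m n \<phi> \<theta> u assume p: "\<phi> \<in> Delta k m" and t: "\<theta> \<in> Delta m n" and "u \<in> Simp (sexp X Y) n"
    then have u: "u \<in> sHom (sprod (std_simplex n) X) Y" by (simp add: sexp_def)
    show "Act (sexp X Y) k n (compose {..k} \<theta> \<phi>) u = Act (sexp X Y) k m \<phi> (Act (sexp X Y) m n \<theta> u)"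
      using p t u mem[OF t u] compose_Delta[OF p t] compose_Delta[OF _ p]
      by (auto simp: sexp_def Delta_compose_assoc fun_eq_iff)
  qed
qed

lemma bij_betw_sname:
  fixes X :: "'a sset" and Y :: "'b sset"
  assumes X: "simplicial_set X"
  shows "bij_betw (sname X) (sHom X Y) (Simp (sexp X Y) 0)"
proof (rule bij_betw_byWitness[where f' = "\<lambda>u k. \<lambda>x\<in>Simp X k. u k (\<lambda>_\<in>{..k}. 0, x)"])
  have D0: "\<sigma> \<in> Delta k 0 \<longleftrightarrow> \<sigma> = (\<lambda>_\<in>{..k}. 0)" for \<sigma> k
    by (auto simp: Delta_def mono_on_def fun_eq_iff PiE_def extensional_def)
  have c0: "compose {..l} (\<lambda>_\<in>{..k}. 0) \<theta> = (\<lambda>_\<in>{..l}. 0)" if "\<theta> \<in> Delta l k" for l k \<theta>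
    using Delta_le[OF that] by (auto simp: compose_def fun_eq_iff)
  show "\<forall>f\<in>sHom X Y. (\<lambda>k. \<lambda>x\<in>Simp X k. sname X f k (\<lambda>_\<in>{..k}. 0, x)) = f"
    by (auto simp: sname_def sHom_def D0 fun_eq_iff PiE_def extensional_def)
  show "\<forall>u\<in>Simp (sexp X Y) 0. sname X (\<lambda>k. \<lambda>x\<in>Simp X k. u k (\<lambda>_\<in>{..k}. 0, x)) = u"
  proof (intro ballI ext)
    fix u :: "((nat \<Rightarrow> nat) \<times> 'a, 'b) smap" and k :: nat and p :: "(nat \<Rightarrow> nat) \<times> 'a" assume u: "u \<in> Simp (sexp X Y) 0"
    obtain \<sigma> x where p: "p = (\<sigma>, x)" by (cases p)
    show "sname X (\<lambda>k. \<lambda>x\<in>Simp X k. u k (\<lambda>_\<in>{..k}. 0, x)) k p = u k p"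
    proof (cases "p \<in> Delta k 0 \<times> Simp X k")
      case True
      then show ?thesis using D0[of \<sigma> k] by (auto simp: p sname_def)
    next
      case False
      moreover have "u k \<in> extensional (Delta k 0 \<times> Simp X k)"
        using u unfolding sexp_def esimp_iff[symmetric] by (simp add: esimp_iff)
      ultimately show ?thesis by (auto simp: p sname_def extensional_def)
    qed
  qed
  show "sname X ` sHom X Y \<subseteq> Simp (sexp X Y) 0"
  proof
    fix u :: "((nat \<Rightarrow> nat) \<times> 'a, 'b) smap" assume "u \<in> sname X ` sHom X Y"
    then obtain f where u: "u = sname X f" and f: "f \<in> sHom X Y" by auto
    have "f k x \<in> Simp Y k" "\<theta> \<in> Delta l k \<Longrightarrow> f l (Act X l k \<theta> x) = Act Y l k \<theta> (f k x)"
      if "x \<in> Simp X k" for l k \<theta> x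
      using f that by (auto simp: sHom_def)
    then have "u \<in> sHom (sprod (std_simplex 0) X) Y"
      unfolding esimp_iff u using Act_in[OF X] by (auto simp: sname_def D0 c0)
    then show "u \<in> Simp (sexp X Y) 0" by (simp add: sexp_def)
  qed
  show "(\<lambda>u k. \<lambda>x\<in>Simp X k. u k (\<lambda>_\<in>{..k}. 0, x)) ` Simp (sexp X Y) 0 \<subseteq> sHom X Y"
  proof
    fix f assume "f \<in> (\<lambda>u k. \<lambda>x\<in>Simp X k. u k (\<lambda>_\<in>{..k}. 0, x)) ` Simp (sexp X Y) 0"
    then obtain u where u: "u \<in> sHom (sprod (std_simplex 0) X) Y"
      and f: "f = (\<lambda>k. \<lambda>x\<in>Simp X k. u k (\<lambda>_\<in>{..k}. 0, x))" by (auto simp: sexp_def)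
    have "u l (\<lambda>_\<in>{..l}. 0, Act X l k \<theta> x) = Act Y l k \<theta> (u k (\<lambda>_\<in>{..k}. 0, x))"
      if "\<theta> \<in> Delta l k" "x \<in> Simp X k" for l k \<theta> x
      using u that c0[OF that(1)] D0[of "\<lambda>_\<in>{..k}. 0" k] unfolding esimp_iff by metis
    moreover have "u k (\<lambda>_\<in>{..k}. 0, x) \<in> Simp Y k" if "x \<in> Simp X k" for k x
      using u that D0[of "\<lambda>_\<in>{..k}. 0" k] unfolding esimp_iff by blast
    ultimately show "f \<in> sHom X Y"
      using Act_in[OF X] by (auto simp: sHom_def f)
  qed
qed

end

theory Submission
  imports Defs
begin

text \<open>
  Let \<open>C\<close> be the category of cofibrant-fibrant objects of \<open>M\<close>, and suppose that a functor \<open>F\<close> from \<open>C\<close> to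
  quasicategories is given that preserves weak equivalences and induces an equivalence \<open>Ho F\<close>. The
  2-category that is asked for has the objects and arrows of \<open>C\<close>, and as 2-cells \<open>f \<rightarrow> g\<close> the 2-cells
  \<open>F f \<rightarrow> F g\<close> between the images (\<open>pullback_cat\<close>). The evident 2-functor is bijective on 2-cells, so it is a
  bicategorical equivalence as soon as \<open>F\<close> is surjective on objects up to equivalence and on 1-cells up to
  isomorphism (\<open>bicategorical_equivalence_pullback\<close>). Both properties are visible in \<open>Ho F\<close>:

  \<^item> By a Yoneda argument, a weak categorical equivalence between quasicategories has an inverse up to
    invertible 2-cells (\<open>weak_cat_equiv_inverse\<close>). Hence the passage from morphisms of quasicategories to
    isomorphism classes of 1-cells factors through \<open>Ho Qcat\<close> (\<open>Ho_Qcat_to_hcat\<close>). So isomorphic objects of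
    \<open>Ho Qcat\<close> are equivalent, and morphisms that are equal in \<open>Ho Qcat\<close> are isomorphic 1-cells.

  \<^item> By Whitehead's theorem, every arrow of \<open>Ho C\<close> comes from an arrow of \<open>C\<close> (\<open>unit_full_cf\<close>).

  The functor \<open>F\<close> is composed of one functor for each step of the zigzag: \<open>R F'\<close> for a left Quillen
  equivalence \<open>F'\<close> with fibrant replacement \<open>R\<close>, or \<open>Q G'\<close> for its right adjoint \<open>G'\<close> with cofibrant
  replacement \<open>Q\<close>. In a Quillen equivalence an arrow \<open>F' X \<rightarrow> Y\<close>, with \<open>X\<close> cofibrant and \<open>Y\<close> fibrant, is a weak
  equivalence if and only if its transpose is. Transposing replacement maps, one finds from this that
  both functors preserve weak equivalences, and that zigzags of natural weak equivalences connect their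
  composites with the identities (\<open>derived_equivalences\<close>). At the end of the zigzag, the
  cofibrant-fibrant objects of the Joyal model structure are the quasicategories (\<open>cf_subcat_joyal\<close>).

  It remains that quasicategories form a 2-category (\<open>two_category_QCAT\<close>). Horizontal composition is
  defined through the fact that the fundamental category preserves products: an arrow over \<open>A \<times> B\<close> is a
  composite of an arrow along \<open>A\<close> and an arrow along \<open>B\<close>, in either order, and is determined by them
  (\<open>tau1_pair_eq\<close>). So a horizontal composite is a composite of two whiskerings, and each whiskering is
  induced by a simplicial map between exponentials. The axioms of a 2-category follow from strict
  equalities between such maps (locale \<open>whiskering\<close>).
\<close>

section \<open>Categories\<close>

lemma inverse_arrows_sym: "inverse_arrows C X Y f g \<Longrightarrow> inverse_arrows C Y X g f"
  by (auto simp: inverse_arrows_def)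

lemma inverse_arrows_Id: "category C \<Longrightarrow> X \<in> Ob C \<Longrightarrow> inverse_arrows C X X (Id C X) (Id C X)"
  by (auto simp: inverse_arrows_def categoryD)

lemma inverse_arrows_Comp:
  assumes C: "category C" and ob: "X \<in> Ob C" "Y \<in> Ob C" "Z \<in> Ob C"
    and fg: "inverse_arrows C X Y f g" and hk: "inverse_arrows C Y Z h k"
  shows "inverse_arrows C X Z (Comp C X Y Z h f) (Comp C Z Y X g k)"
proof -
  have m: "f \<in> Hom C X Y" "g \<in> Hom C Y X" "h \<in> Hom C Y Z" "k \<in> Hom C Z Y"
    using fg hk by (auto simp: inverse_arrows_def)
  have 1: "Comp C X Z X (Comp C Z Y X g k) (Comp C X Y Z h f) = Id C X"
  proof -
    have "Comp C X Z X (Comp C Z Y X g k) (Comp C X Y Z h f) =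
        Comp C X Y X g (Comp C X Z Y k (Comp C X Y Z h f))"
      using C ob m by (intro categoryD(5)) (auto intro: categoryD)
    also have "Comp C X Z Y k (Comp C X Y Z h f) = Comp C X Y Y (Comp C Y Z Y k h) f"
      using C ob m by (intro categoryD(5)[symmetric]) (auto intro: categoryD)
    finally show ?thesis using C ob m fg hk by (simp add: inverse_arrows_def categoryD(3,4))
  qed
  have 2: "Comp C Z X Z (Comp C X Y Z h f) (Comp C Z Y X g k) = Id C Z"
  proof -
    have "Comp C Z X Z (Comp C X Y Z h f) (Comp C Z Y X g k) =
        Comp C Z Y Z h (Comp C Z X Y f (Comp C Z Y X g k))"
      using C ob m by (intro categoryD(5)) (auto intro: categoryD)
    also have "Comp C Z X Y f (Comp C Z Y X g k) = Comp C Z Y Y (Comp C Y X Y f g) k"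
      using C ob m by (intro categoryD(5)[symmetric]) (auto intro: categoryD)
    finally show ?thesis using C ob m fg hk by (simp add: inverse_arrows_def categoryD(3,4))
  qed
  show ?thesis using 1 2 m ob C by (auto simp: inverse_arrows_def intro: categoryD)
qed

lemma isomorphic_refl: "category C \<Longrightarrow> X \<in> Ob C \<Longrightarrow> isomorphic C X X"
  unfolding isomorphic_def by (meson inverse_arrows_Id)

lemma isomorphic_sym: "isomorphic C X Y \<Longrightarrow> isomorphic C Y X"
  unfolding isomorphic_def by (meson inverse_arrows_sym)

lemma isomorphic_trans: "category C \<Longrightarrow> isomorphic C X Y \<Longrightarrow> isomorphic C Y Z \<Longrightarrow> isomorphic C X Z"
  unfolding isomorphic_def by (meson inverse_arrows_Comp)

lemma inverse_arrows_functor: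
  assumes F: "is_functor C D F" and ob: "X \<in> Ob C" "Y \<in> Ob C" and fg: "inverse_arrows C X Y f g"
  shows "inverse_arrows D (FOb F X) (FOb F Y) (FArr F X Y f) (FArr F Y X g)"
  using fg ob is_functorD(4,5)[OF F] is_functorD(6)[OF F, of X Y X f g, symmetric]
    is_functorD(6)[OF F, of Y X Y g f, symmetric]
  by (auto simp: inverse_arrows_def)

lemma isomorphic_functor: "is_functor C D F \<Longrightarrow> isomorphic C X Y \<Longrightarrow> isomorphic D (FOb F X) (FOb F Y)"
  unfolding isomorphic_def using inverse_arrows_functor is_functorD(3) by metis

lemma inverse_cancel_left:
  assumes C: "category C" and ob: "X \<in> Ob C" "Y \<in> Ob C" "Z \<in> Ob C"
    and m: "u \<in> Hom C X Y" "v \<in> Hom C X Y" and inv: "inverse_arrows C Y Z h k"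
    and eq: "Comp C X Y Z h u = Comp C X Y Z h v"
  shows "u = v"
proof -
  have hk: "h \<in> Hom C Y Z" "k \<in> Hom C Z Y" "Comp C Y Z Y k h = Id C Y"
    using inv by (auto simp: inverse_arrows_def)
  have "w = Comp C X Z Y k (Comp C X Y Z h w)" if "w \<in> Hom C X Y" for w
    using categoryD(5)[OF C ob(1,2,3,2) that hk(1,2)] categoryD(4)[OF C ob(1,2) that] hk by simp
  then show ?thesis using m eq by metis
qed

lemma inverse_cancel_right:
  assumes C: "category C" and ob: "X \<in> Ob C" "Y \<in> Ob C" "Z \<in> Ob C"
    and m: "u \<in> Hom C Y Z" "v \<in> Hom C Y Z" and inv: "inverse_arrows C X Y h k"
    and eq: "Comp C X Y Z u h = Comp C X Y Z v h"
  shows "u = v"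
proof -
  have hk: "h \<in> Hom C X Y" "k \<in> Hom C Y X" "Comp C Y X Y h k = Id C Y"
    using inv by (auto simp: inverse_arrows_def)
  have "w = Comp C Y X Z (Comp C X Y Z w h) k" if "w \<in> Hom C Y Z" for w
    using categoryD(5)[OF C ob(2,1,2,3) hk(2,1) that] categoryD(3)[OF C ob(2,3) that] hk by simp
  then show ?thesis using m eq by metis
qed

text \<open>
  A commutative square stays commutative when two opposite sides are replaced by their inverses.
  Applied to naturality squares this inverts a natural isomorphism.
\<close>

lemma square_inverse:
  assumes C: "category C" and ob: "X \<in> Ob C" "Y \<in> Ob C" "X' \<in> Ob C" "Y' \<in> Ob C"
    and u: "inverse_arrows C X X' u u'" and v: "inverse_arrows C Y Y' v v'"
    and a: "a \<in> Hom C X Y" and b: "b \<in> Hom C X' Y'"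
    and sq: "Comp C X X' Y' b u = Comp C X Y Y' v a"
  shows "Comp C X' X Y a u' = Comp C X' Y' Y v' b"
proof -
  have m: "u \<in> Hom C X X'" "u' \<in> Hom C X' X" "v \<in> Hom C Y Y'" "v' \<in> Hom C Y' Y"
    "Comp C Y Y' Y v' v = Id C Y" "Comp C X' X X' u u' = Id C X'"
    using u v by (auto simp: inverse_arrows_def)
  have au: "Comp C X' X Y a u' \<in> Hom C X' Y" using categoryD(2)[OF C] ob m a by blast
  have "Comp C X' X Y a u' = Comp C X' Y' Y v' (Comp C X' Y Y' v (Comp C X' X Y a u'))"
    using categoryD(5)[OF C ob(3,2,4,2) au m(3,4)] categoryD(4)[OF C ob(3,2) au] m by simp
  also have "Comp C X' Y Y' v (Comp C X' X Y a u') = Comp C X' X Y' (Comp C X Y Y' v a) u'"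
    using categoryD(5)[OF C ob(3,1,2,4) m(2) a m(3)] by simp
  also have "\<dots> = Comp C X' X' Y' b (Comp C X' X X' u u')"
    unfolding sq[symmetric] using categoryD(5)[OF C ob(3,1,3,4) m(2,1) b] by simp
  also have "\<dots> = b" using categoryD(3)[OF C ob(3,4) b] m by simp
  finally show ?thesis .
qed

lemma square_Comp:
  assumes C: "category C"
    and ob: "X \<in> Ob C" "Y \<in> Ob C" "X' \<in> Ob C" "Y' \<in> Ob C" "X'' \<in> Ob C" "Y'' \<in> Ob C"
    and m: "u \<in> Hom C X X'" "v \<in> Hom C Y Y'" "u' \<in> Hom C X' X''" "v' \<in> Hom C Y' Y''"
      "a \<in> Hom C X Y" "b \<in> Hom C X' Y'" "c \<in> Hom C X'' Y''"
    and sq: "Comp C X X' Y' b u = Comp C X Y Y' v a"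
    and sq': "Comp C X' X'' Y'' c u' = Comp C X' Y' Y'' v' b"
  shows "Comp C X X'' Y'' c (Comp C X X' X'' u' u) = Comp C X Y Y'' (Comp C Y Y' Y'' v' v) a"
proof -
  have "Comp C X X'' Y'' c (Comp C X X' X'' u' u) = Comp C X X' Y'' (Comp C X' X'' Y'' c u') u"
    using categoryD(5)[OF C ob(1,3,5,6) m(1,3,7)] by simp
  also have "\<dots> = Comp C X Y' Y'' v' (Comp C X X' Y' b u)"
    unfolding sq' using categoryD(5)[OF C ob(1,3,4,6) m(1,6,4)] by simp
  also have "\<dots> = Comp C X Y Y'' (Comp C Y Y' Y'' v' v) a"
    unfolding sq using categoryD(5)[OF C ob(1,2,4,6) m(5,2,4)] by simp
  finally show ?thesis .
qed

text \<open>
  Four consecutive arrows, the middle two of which form a side of a commutative square, are regrouped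
  around the square. This is the calculation behind middle four interchange for 2-cells.
\<close>

lemma middle_four:
  assumes C: "category C"
    and ob: "x0 \<in> Ob C" "x1 \<in> Ob C" "x2 \<in> Ob C" "x3 \<in> Ob C" "x4 \<in> Ob C" "y \<in> Ob C"
    and m: "b \<in> Hom C x0 x1" "b' \<in> Hom C x1 x2" "a \<in> Hom C x2 x3" "a' \<in> Hom C x3 x4"
      "c \<in> Hom C x1 y" "d' \<in> Hom C y x3"
    and sq: "Comp C x1 x2 x3 a b' = Comp C x1 y x3 d' c"
  shows "Comp C x0 x2 x4 (Comp C x2 x3 x4 a' a) (Comp C x0 x1 x2 b' b) =
    Comp C x0 y x4 (Comp C y x3 x4 a' d') (Comp C x0 x1 y c b)"
proof -
  have "Comp C x0 x2 x4 (Comp C x2 x3 x4 a' a) (Comp C x0 x1 x2 b' b) =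
      Comp C x0 x3 x4 a' (Comp C x0 x2 x3 a (Comp C x0 x1 x2 b' b))"
    by (rule categoryD(5)[OF C ob(1,3,4,5) categoryD(2)[OF C ob(1,2,3) m(1,2)] m(3,4)])
  also have "Comp C x0 x2 x3 a (Comp C x0 x1 x2 b' b) = Comp C x0 x1 x3 (Comp C x1 x2 x3 a b') b"
    by (rule categoryD(5)[OF C ob(1-4) m(1-3), symmetric])
  also have "\<dots> = Comp C x0 y x3 d' (Comp C x0 x1 y c b)"
    unfolding sq by (rule categoryD(5)[OF C ob(1,2,6,4) m(1,5,6)])
  also have "Comp C x0 x3 x4 a' (Comp C x0 y x3 d' (Comp C x0 x1 y c b)) =
      Comp C x0 y x4 (Comp C y x3 x4 a' d') (Comp C x0 x1 y c b)"
    by (rule categoryD(5)[OF C ob(1,6,4,5) categoryD(2)[OF C ob(1,2,6) m(1,5)] m(6,4), symmetric])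
  finally show ?thesis .
qed

definition id_fctr :: "('o, 'm, 'o, 'm) fctr" where
  "id_fctr = \<lparr>FOb = (\<lambda>X. X), FArr = (\<lambda>_ _ f. f)\<rparr>"

lemma id_fctr_simps [simp]: "FOb id_fctr X = X" "FArr id_fctr X Y f = f"
  by (simp_all add: id_fctr_def)

lemma is_functor_id: "category C \<Longrightarrow> is_functor C C id_fctr"
  by (simp add: is_functor_def)

definition comp_fctr :: "('p, 'n, 'q, 'k) fctr \<Rightarrow> ('o, 'm, 'p, 'n) fctr \<Rightarrow> ('o, 'm, 'q, 'k) fctr" where
  "comp_fctr G F = \<lparr>FOb = (\<lambda>X. FOb G (FOb F X)),
     FArr = (\<lambda>X Y f. FArr G (FOb F X) (FOb F Y) (FArr F X Y f))\<rparr>"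

lemma comp_fctr_simps [simp]:
  "FOb (comp_fctr G F) X = FOb G (FOb F X)"
  "FArr (comp_fctr G F) X Y f = FArr G (FOb F X) (FOb F Y) (FArr F X Y f)"
  by (simp_all add: comp_fctr_def)

lemma is_functor_comp: "is_functor C D F \<Longrightarrow> is_functor D E G \<Longrightarrow> is_functor C E (comp_fctr G F)"
  by (simp add: is_functor_def)

lemma categorical_equivalenceD:
  assumes "categorical_equivalence C D F"
  shows "is_functor C D F"
    and "X \<in> Ob C \<Longrightarrow> Y \<in> Ob C \<Longrightarrow> bij_betw (FArr F X Y) (Hom C X Y) (Hom D (FOb F X) (FOb F Y))"
    and "Z \<in> Ob D \<Longrightarrow> \<exists>X\<in>Ob C. isomorphic D (FOb F X) Z"
  using assms by (simp_all add: categorical_equivalence_def)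

lemma categorical_equivalence_comp:
  assumes F: "categorical_equivalence C D F" and G: "categorical_equivalence D E G"
  shows "categorical_equivalence C E (comp_fctr G F)"
proof -
  have f: "is_functor C D F" and g: "is_functor D E G"
    using assms by (auto simp: categorical_equivalence_def)
  have "bij_betw (FArr (comp_fctr G F) X Y) (Hom C X Y) (Hom E (FOb (comp_fctr G F) X) (FOb (comp_fctr G F) Y))"
    if "X \<in> Ob C" "Y \<in> Ob C" for X Y
  proof -
    have "bij_betw (FArr F X Y) (Hom C X Y) (Hom D (FOb F X) (FOb F Y))"
      "bij_betw (FArr G (FOb F X) (FOb F Y)) (Hom D (FOb F X) (FOb F Y)) (Hom E (FOb G (FOb F X)) (FOb G (FOb F Y)))"
      using F G that is_functorD(3)[OF f] by (auto simp: categorical_equivalence_def)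
    from bij_betw_trans[OF this] show ?thesis by (simp add: comp_def comp_fctr_def)
  qed
  moreover have "\<exists>X\<in>Ob C. isomorphic E (FOb (comp_fctr G F) X) Z" if Z: "Z \<in> Ob E" for Z
  proof -
    obtain Y where Y: "Y \<in> Ob D" "isomorphic E (FOb G Y) Z"
      using categorical_equivalenceD(3)[OF G Z] by blast
    obtain X where X: "X \<in> Ob C" "isomorphic D (FOb F X) Y"
      using categorical_equivalenceD(3)[OF F Y(1)] by blast
    have "isomorphic E (FOb G (FOb F X)) Z"
      by (rule isomorphic_trans[OF is_functorD(2)[OF g] isomorphic_functor[OF g X(2)] Y(2)])
    then show ?thesis using X by auto
  qed
  ultimately show ?thesis
    using is_functor_comp[OF f g] by (simp add: categorical_equivalence_def)
qed

text \<open>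
  The arrow part of a functor is a total function with arbitrary values outside the category, so functors
  that agree on the category are in general different records.
\<close>

lemma categorical_equivalence_cong:
  assumes F: "categorical_equivalence C D F" and G: "is_functor C D G"
    and ob: "\<And>X. X \<in> Ob C \<Longrightarrow> FOb F X = FOb G X"
    and ar: "\<And>X Y f. X \<in> Ob C \<Longrightarrow> Y \<in> Ob C \<Longrightarrow> f \<in> Hom C X Y \<Longrightarrow> FArr F X Y f = FArr G X Y f"
  shows "categorical_equivalence C D G"
  unfolding categorical_equivalence_def
proof (intro conjI ballI)
  fix X Y assume "X \<in> Ob C" "Y \<in> Ob C"
  moreover from this have "bij_betw (FArr F X Y) (Hom C X Y) (Hom D (FOb F X) (FOb F Y))"
    using categorical_equivalenceD(2)[OF F] by blast
  ultimately show "bij_betw (FArr G X Y) (Hom C X Y) (Hom D (FOb G X) (FOb G Y))"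
    using ob[of X] ob[of Y] ar bij_betw_cong[of "Hom C X Y" "FArr F X Y" "FArr G X Y"] by simp
qed (use G ob categorical_equivalenceD(3)[OF F] in auto)

lemma nat_transD:
  assumes "nat_trans C D F G \<eta>"
  shows "X \<in> Ob C \<Longrightarrow> \<eta> X \<in> Hom D (FOb F X) (FOb G X)"
    and "X \<in> Ob C \<Longrightarrow> Y \<in> Ob C \<Longrightarrow> f \<in> Hom C X Y \<Longrightarrow>
      Comp D (FOb F X) (FOb F Y) (FOb G Y) (\<eta> Y) (FArr F X Y f) =
      Comp D (FOb F X) (FOb G X) (FOb G Y) (FArr G X Y f) (\<eta> X)"
  using assms by (simp_all add: nat_trans_def)

definition natural_iso ::
  "('o, 'm, 'z) cat_scheme \<Rightarrow> ('p, 'n, 'w) cat_scheme \<Rightarrow>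
   ('o, 'm, 'p, 'n) fctr \<Rightarrow> ('o, 'm, 'p, 'n) fctr \<Rightarrow> ('o \<Rightarrow> 'n) \<Rightarrow> ('o \<Rightarrow> 'n) \<Rightarrow> bool" where
  "natural_iso C D S T t t' \<longleftrightarrow> nat_trans C D S T t \<and>
    (\<forall>X\<in>Ob C. inverse_arrows D (FOb S X) (FOb T X) (t X) (t' X))"

lemma natural_isoD:
  assumes "natural_iso C D S T t t'"
  shows "is_functor C D S" "is_functor C D T"
    and "X \<in> Ob C \<Longrightarrow> inverse_arrows D (FOb S X) (FOb T X) (t X) (t' X)"
    and "X \<in> Ob C \<Longrightarrow> t X \<in> Hom D (FOb S X) (FOb T X)"
    and "X \<in> Ob C \<Longrightarrow> Y \<in> Ob C \<Longrightarrow> f \<in> Hom C X Y \<Longrightarrow>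
      Comp D (FOb S X) (FOb T X) (FOb T Y) (FArr T X Y f) (t X) =
      Comp D (FOb S X) (FOb S Y) (FOb T Y) (t Y) (FArr S X Y f)"
  using assms by (simp_all add: natural_iso_def nat_trans_def)

lemma natural_iso_sym:
  assumes "natural_iso C D S T t t'"
  shows "natural_iso C D T S t' t"
proof -
  note N = natural_isoD[OF assms]
  note ob = is_functorD(3)[OF N(1)] is_functorD(3)[OF N(2)] and ar = is_functorD(4)[OF N(1)] is_functorD(4)[OF N(2)]
  show ?thesis
    unfolding natural_iso_def nat_trans_def
  proof (intro conjI ballI N(1,2))
    fix X Y f assume X: "X \<in> Ob C" and Y: "Y \<in> Ob C" and f: "f \<in> Hom C X Y"
    show "Comp D (FOb T X) (FOb T Y) (FOb S Y) (t' Y) (FArr T X Y f) = Comp D (FOb T X) (FOb S X) (FOb S Y) (FArr S X Y f) (t' X)"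
      by (rule square_inverse[OF is_functorD(2)[OF N(1)] ob(1)[OF X] ob(1)[OF Y] ob(2)[OF X] ob(2)[OF Y]
            N(3)[OF X] N(3)[OF Y] ar(1)[OF X Y f] ar(2)[OF X Y f] N(5)[OF X Y f], symmetric])
  qed (use N(3) in \<open>auto simp: inverse_arrows_def\<close>)
qed

lemma natural_iso_trans:
  assumes "natural_iso C D S T t t'" "natural_iso C D T U u u'"
  shows "natural_iso C D S U (\<lambda>X. Comp D (FOb S X) (FOb T X) (FOb U X) (u X) (t X))
    (\<lambda>X. Comp D (FOb U X) (FOb T X) (FOb S X) (t' X) (u' X))"
proof -
  note N = natural_isoD[OF assms(1)] and N' = natural_isoD[OF assms(2)]
  note D = is_functorD(2)[OF N(1)]
  note ob = is_functorD(3)[OF N(1)] is_functorD(3)[OF N(2)] is_functorD(3)[OF N'(2)]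
    and ar = is_functorD(4)[OF N(1)] is_functorD(4)[OF N(2)] is_functorD(4)[OF N'(2)]
  show ?thesis
    unfolding natural_iso_def nat_trans_def
  proof (intro conjI ballI N(1) N'(2))
    fix X assume X: "X \<in> Ob C"
    note o = ob(1)[OF X] ob(2)[OF X] ob(3)[OF X]
    show "Comp D (FOb S X) (FOb T X) (FOb U X) (u X) (t X) \<in> Hom D (FOb S X) (FOb U X)"
      by (rule categoryD(2)[OF D o N(4)[OF X] N'(4)[OF X]])
    show "inverse_arrows D (FOb S X) (FOb U X) (Comp D (FOb S X) (FOb T X) (FOb U X) (u X) (t X))
        (Comp D (FOb U X) (FOb T X) (FOb S X) (t' X) (u' X))"
      by (rule inverse_arrows_Comp[OF D o N(3)[OF X] N'(3)[OF X]])
  next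
    fix X Y f assume X: "X \<in> Ob C" and Y: "Y \<in> Ob C" and f: "f \<in> Hom C X Y"
    show "Comp D (FOb S X) (FOb S Y) (FOb U Y) (Comp D (FOb S Y) (FOb T Y) (FOb U Y) (u Y) (t Y)) (FArr S X Y f) =
        Comp D (FOb S X) (FOb U X) (FOb U Y) (FArr U X Y f) (Comp D (FOb S X) (FOb T X) (FOb U X) (u X) (t X))"
      by (rule square_Comp[OF D ob(1)[OF X] ob(1)[OF Y] ob(2)[OF X] ob(2)[OF Y] ob(3)[OF X] ob(3)[OF Y]
            N(4)[OF X] N(4)[OF Y] N'(4)[OF X] N'(4)[OF Y] ar(1)[OF X Y f] ar(2)[OF X Y f] ar(3)[OF X Y f]
            N(5)[OF X Y f] N'(5)[OF X Y f], symmetric])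
  qed
qed

text \<open>
  This and fullness are applied to the two composites of the functors of an equivalence. A component of
  \<open>\<alpha>\<close> can be cancelled from the naturality squares of \<open>f\<close> and \<open>g\<close>.
\<close>

lemma natural_iso_id_faithful:
  assumes N: "natural_iso C C id_fctr H \<alpha> \<alpha>'"
    and f: "X \<in> Ob C" "Y \<in> Ob C" "f \<in> Hom C X Y" "g \<in> Hom C X Y" "FArr H X Y f = FArr H X Y g"
  shows "f = g"
  using inverse_cancel_left[OF is_functorD(1)[OF natural_isoD(2)[OF N]] f(1,2) is_functorD(3)[OF natural_isoD(2)[OF N] f(2)] f(3,4)]
    natural_isoD(3)[OF N f(2)] natural_isoD(5)[OF N f(1-3)] natural_isoD(5)[OF N f(1,2,4)] f(5) by simp

lemma natural_iso_id_full:
  assumes N: "natural_iso C C id_fctr H \<alpha> \<alpha>'" and ob: "X \<in> Ob C" "Y \<in> Ob C" and h: "h \<in> Hom C (FOb H X) (FOb H Y)"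
  shows "\<exists>f\<in>Hom C X Y. FArr H X Y f = h"
proof -
  note H = natural_isoD(2)[OF N] and inv = natural_isoD(3)[OF N, simplified] and nat = natural_isoD(5)[OF N, simplified]
  note C = is_functorD(1)[OF H] and hob = is_functorD(3)[OF H]
  have a: "\<alpha> X \<in> Hom C X (FOb H X)" "\<alpha> Y \<in> Hom C Y (FOb H Y)" "\<alpha>' Y \<in> Hom C (FOb H Y) Y"
    "Comp C (FOb H Y) Y (FOb H Y) (\<alpha> Y) (\<alpha>' Y) = Id C (FOb H Y)"
    using inv ob by (auto simp: inverse_arrows_def)
  have ha: "Comp C X (FOb H X) (FOb H Y) h (\<alpha> X) \<in> Hom C X (FOb H Y)"
    using categoryD(2)[OF C] ob hob h a by blast
  \<comment> \<open>naturality forces the preimage of \<open>h\<close> to be this conjugate by the components of \<open>\<alpha>\<close>\<close>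
  define f where "f = Comp C X (FOb H Y) Y (\<alpha>' Y) (Comp C X (FOb H X) (FOb H Y) h (\<alpha> X))"
  have f: "f \<in> Hom C X Y" unfolding f_def using categoryD(2)[OF C] ob hob ha a by blast
  have "Comp C X Y (FOb H Y) (\<alpha> Y) f = Comp C X (FOb H X) (FOb H Y) h (\<alpha> X)"
    unfolding f_def using categoryD(5)[OF C _ _ _ _ ha, of Y "FOb H Y" "\<alpha>' Y" "\<alpha> Y"]
      categoryD(4)[OF C _ _ ha] a hob ob by simp
  then have "FArr H X Y f = h"
    using inverse_cancel_right[OF C ob(1) hob hob, of X Y "FArr H X Y f" h "\<alpha> X" "\<alpha>' X"]
      nat[OF ob f] is_functorD(4)[OF H ob f] inv ob h by simp
  then show ?thesis using f by blast
qed

text \<open>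
  An arrow \<open>h : F X \<rightarrow> F Y\<close> has a preimage under \<open>F\<close>, namely a preimage of \<open>G h\<close> under the full functor
  \<open>G F\<close>: its image under \<open>F\<close> agrees with \<open>h\<close> because \<open>F G\<close>, and hence \<open>G\<close>, is faithful.
\<close>

lemma categorical_equivalence_inverse:
  assumes F: "is_functor C D F" and G: "is_functor D C G"
    and \<alpha>: "natural_iso C C id_fctr (comp_fctr G F) \<alpha> \<alpha>'"
    and \<beta>: "natural_iso D D id_fctr (comp_fctr F G) \<beta> \<beta>'"
  shows "categorical_equivalence C D F"
proof -
  note Fd = is_functorD[OF F] and Gd = is_functorD[OF G]
  have "bij_betw (FArr F X Y) (Hom C X Y) (Hom D (FOb F X) (FOb F Y))"
    if ob: "X \<in> Ob C" "Y \<in> Ob C" for X Y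
    unfolding bij_betw_def
  proof
    show "inj_on (FArr F X Y) (Hom C X Y)"
      using natural_iso_id_faithful[OF \<alpha> ob] by (auto intro: inj_onI)
    have "\<exists>f\<in>Hom C X Y. FArr F X Y f = h" if h: "h \<in> Hom D (FOb F X) (FOb F Y)" for h
    proof -
      have "FArr G (FOb F X) (FOb F Y) h \<in> Hom C (FOb (comp_fctr G F) X) (FOb (comp_fctr G F) Y)"
        using Fd Gd ob h by simp
      from natural_iso_id_full[OF \<alpha> ob this] obtain f where f: "f \<in> Hom C X Y"
        and eq: "FArr G (FOb F X) (FOb F Y) (FArr F X Y f) = FArr G (FOb F X) (FOb F Y) h" by auto
      have "FArr F X Y f = h"
        using natural_iso_id_faithful[OF \<beta>, of "FOb F X" "FOb F Y" "FArr F X Y f" h] Fd ob f h by (simp add: eq)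
      then show ?thesis using f by blast
    qed
    then show "FArr F X Y ` Hom C X Y = Hom D (FOb F X) (FOb F Y)"
      using Fd ob by auto
  qed
  moreover have "\<exists>X\<in>Ob C. isomorphic D (FOb F X) Y" if "Y \<in> Ob D" for Y
    using natural_isoD(3)[OF \<beta> that] Fd Gd that inverse_arrows_sym unfolding isomorphic_def by (metis comp_fctr_simps(1) id_fctr_simps(1))
  ultimately show ?thesis using F by (simp add: categorical_equivalence_def)
qed

section \<open>Localisations in which every arrow comes from an arrow\<close>

abbreviation ho_arr where "ho_arr C X Y f \<equiv> FArr (ho_unit C) X Y f"

text \<open>
  The localisation functor is full when every zigzag is equal in the localisation to an arrow. Naturality
  and fullness in \<open>Ho C\<close> can then be tested on the arrows of \<open>C\<close>. For cofibrant-fibrant objects of a model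
  category this is Whitehead's theorem.
\<close>

definition unit_full :: "('o, 'm, 'z) relcat_scheme \<Rightarrow> bool" where
  "unit_full C \<longleftrightarrow> (\<forall>X\<in>Ob C. \<forall>Y\<in>Ob C. \<forall>c\<in>Hom (Ho C) X Y. \<exists>f\<in>Hom C X Y. ho_arr C X Y f = c)"

lemma unit_fullD:
  "unit_full C \<Longrightarrow> X \<in> Ob C \<Longrightarrow> Y \<in> Ob C \<Longrightarrow> c \<in> Hom (Ho C) X Y \<Longrightarrow> \<exists>f\<in>Hom C X Y. ho_arr C X Y f = c"
  by (simp add: unit_full_def)

lemma Ob_Ho [simp]: "Ob (Ho C) = Ob C"
  by (simp add: Ho_def presented_cat_simps ho_pres_simps)

lemma category_Ho: "category (Ho C)"
  by (simp add: Ho_def category_presented_cat)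

lemma FOb_ho_unit [simp]: "FOb (ho_unit C) X = X"
  by (simp add: ho_unit_def)

lemma
  assumes C: "relative_category C"
  shows ho_arr_Hom: "X \<in> Ob C \<Longrightarrow> Y \<in> Ob C \<Longrightarrow> f \<in> Hom C X Y \<Longrightarrow> ho_arr C X Y f \<in> Hom (Ho C) X Y"
    and ho_arr_Id: "X \<in> Ob C \<Longrightarrow> ho_arr C X X (Id C X) = Id (Ho C) X"
    and ho_arr_Comp: "X \<in> Ob C \<Longrightarrow> Y \<in> Ob C \<Longrightarrow> Z \<in> Ob C \<Longrightarrow> f \<in> Hom C X Y \<Longrightarrow> g \<in> Hom C Y Z \<Longrightarrow>
      ho_arr C X Z (Comp C X Y Z g f) = Comp (Ho C) X Y Z (ho_arr C Y Z g) (ho_arr C X Y f)"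
  using is_functorD(4-6)[OF Ho_localisation(1)[OF C]] by simp_all

lemma relative_categoryD:
  assumes "relative_category C"
  shows "category C"
    and "X \<in> Ob C \<Longrightarrow> Y \<in> Ob C \<Longrightarrow> w \<in> Weq C X Y \<Longrightarrow> w \<in> Hom C X Y"
  using assms by (auto simp: relative_category_def arrow_class_def)

lemma formal_inverse:
  assumes C: "relative_category C" and w: "X \<in> Ob C" "Y \<in> Ob C" "w \<in> Weq C X Y"
  shows "inverse_arrows (Ho C) X Y (ho_arr C X Y w) (path_class (ho_pres C) Y X [(Y, Inr w, X)])"
proof -
  let ?P = "ho_pres C"
  note wH = relative_categoryD(2)[OF C w]
  have p: "is_path ?P X [(X, Inl w, Y)] Y" "is_path ?P Y [(Y, Inr w, X)] X"
    using w wH by (auto simp: ho_pres_simps)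
  have "path_eq ?P X X [(X, Inl w, Y), (Y, Inr w, X)] []" "path_eq ?P Y Y [(Y, Inr w, X), (X, Inl w, Y)] []"
    using w wH by (auto intro!: path_eq.rel simp: ho_pres_simps intro: ho_rel.intros)
  from this[THEN path_class_eq] show ?thesis
    using p unfolding inverse_arrows_def Ho_def
    by (auto simp: ho_unit_def presented_cat_simps presented_Comp)
qed

text \<open>
  Inverses are unique, so in a path each formal inverse may be replaced by the arrow \<open>v\<close>; the path is then
  a composite of arrows of \<open>C\<close>.
\<close>

lemma unit_fullI:
  assumes C: "relative_category C"
    and inv: "\<And>X Y w. X \<in> Ob C \<Longrightarrow> Y \<in> Ob C \<Longrightarrow> w \<in> Weq C X Y \<Longrightarrow>
      \<exists>v\<in>Hom C Y X. inverse_arrows (Ho C) X Y (ho_arr C X Y w) (ho_arr C Y X v)"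
  shows "unit_full C"
proof -
  let ?P = "ho_pres C"
  note catC = relative_categoryD(1)[OF C]
  have edge: "\<exists>f\<in>Hom C X Y. ho_arr C X Y f = path_class ?P X Y [(X, e, Y)]"
    if ob: "X \<in> Ob C" "Y \<in> Ob C" and e: "e \<in> Edges ?P X Y" for X Y e
  proof (cases e)
    case (Inl f)
    then show ?thesis using e ob by (auto simp: ho_pres_simps ho_unit_def)
  next
    case (Inr w)
    then have w: "w \<in> Weq C Y X" using e ob by (auto simp: ho_pres_simps)
    obtain v where v: "v \<in> Hom C X Y" "inverse_arrows (Ho C) Y X (ho_arr C Y X w) (ho_arr C X Y v)"
      using inv[OF ob(2,1) w] by blast
    note i = formal_inverse[OF C ob(2,1) w]
    have "ho_arr C X Y v = path_class ?P X Y [(X, Inr w, Y)]"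
      using inverse_cancel_left[OF category_Ho, of X C Y X "ho_arr C X Y v" "path_class ?P X Y [(X, Inr w, Y)]" "ho_arr C Y X w" "ho_arr C X Y v"]
        ob i v(2) by (simp add: inverse_arrows_def)
    then show ?thesis using v Inr by blast
  qed
  have "\<exists>f\<in>Hom C X Y. ho_arr C X Y f = path_class ?P X Y p" if "is_path ?P X p Y" for X Y p
    using that
  proof (induction p arbitrary: X)
    case Nil
    then have "X \<in> Ob C" "Y = X" by (auto simp: ho_pres_simps)
    then show ?case using categoryD(1)[OF catC] ho_arr_Id[OF C, of X]
      by (intro bexI[of _ "Id C X"]) (auto simp: Ho_def presented_cat_simps)
  next
    case (Cons t p)
    obtain a e b where t: "t = (a, e, b)" by (cases t)
    have *: "X = a" "a \<in> Verts ?P" "e \<in> Edges ?P a b" "is_path ?P b p Y" using Cons.prems by (auto simp: t)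
    have ob: "X \<in> Ob C" "b \<in> Ob C" "Y \<in> Ob C"
      using * is_path_Verts[OF *(4)] by (auto simp: ho_pres_simps)
    obtain f where f: "f \<in> Hom C b Y" "ho_arr C b Y f = path_class ?P b Y p" using Cons.IH[OF *(4)] by blast
    obtain g where g: "g \<in> Hom C X b" "ho_arr C X b g = path_class ?P X b [t]"
      using edge[OF ob(1,2)] * t by auto
    have "is_path ?P X [t] b" using * is_path_Verts[OF *(4)] by (simp add: t)
    then have "ho_arr C X Y (Comp C X b Y f g) = path_class ?P X Y (t # p)"
      using presented_Comp[OF _ *(4)] ho_arr_Comp[OF C ob g(1) f(1)] f g by (simp add: Ho_def)
    then show ?case using categoryD(2)[OF catC ob g(1) f(1)] by blast
  qed
  then show ?thesis by (auto simp: unit_full_def Ho_def presented_cat_simps)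
qed

subsection \<open>Natural isomorphisms in the localisation\<close>

text \<open>
  Pointwise weak equivalences become isomorphisms in the localisation, and formal inverses compose there:
  a zigzag of natural weak equivalences gives a natural isomorphism after localisation. The latter is
  recorded for functors on \<open>C\<close>, with naturality required for arrows of \<open>C\<close>.
\<close>

definition natural_weq ::
  "('o, 'm, 'z) relcat_scheme \<Rightarrow> ('o, 'm, 'o, 'm) fctr \<Rightarrow> ('o, 'm, 'o, 'm) fctr \<Rightarrow> ('o \<Rightarrow> 'm) \<Rightarrow> bool" where
  "natural_weq C S T \<tau> \<longleftrightarrow> nat_trans C C S T \<tau> \<and> (\<forall>X\<in>Ob C. \<tau> X \<in> Weq C (FOb S X) (FOb T X))"

lemma natural_weqI:
  assumes "is_functor C C S" "is_functor C C T"
    and "\<And>X. X \<in> Ob C \<Longrightarrow> \<tau> X \<in> Hom C (FOb S X) (FOb T X)"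
    and "\<And>X. X \<in> Ob C \<Longrightarrow> \<tau> X \<in> Weq C (FOb S X) (FOb T X)"
    and "\<And>X Y f. X \<in> Ob C \<Longrightarrow> Y \<in> Ob C \<Longrightarrow> f \<in> Hom C X Y \<Longrightarrow>
      Comp C (FOb S X) (FOb S Y) (FOb T Y) (\<tau> Y) (FArr S X Y f) =
      Comp C (FOb S X) (FOb T X) (FOb T Y) (FArr T X Y f) (\<tau> X)"
  shows "natural_weq C S T \<tau>"
  using assms by (simp add: natural_weq_def nat_trans_def)

definition ho_natural_iso ::
  "('o, 'm, 'z) relcat_scheme \<Rightarrow> ('o, 'm, 'o, 'm) fctr \<Rightarrow> ('o, 'm, 'o, 'm) fctr \<Rightarrow> bool" where
  "ho_natural_iso C S T \<longleftrightarrow>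
    (\<exists>t t'. natural_iso C (Ho C) (comp_fctr (ho_unit C) S) (comp_fctr (ho_unit C) T) t t')"

lemma natural_weq_ho_natural_iso:
  assumes C: "relative_category C" and \<tau>: "natural_weq C S T \<tau>"
  shows "ho_natural_iso C S T"
proof -
  have N: "nat_trans C C S T \<tau>" and w: "\<And>X. X \<in> Ob C \<Longrightarrow> \<tau> X \<in> Weq C (FOb S X) (FOb T X)"
    using \<tau> by (simp_all add: natural_weq_def)
  have S: "is_functor C C S" and T: "is_functor C C T" using N by (simp_all add: nat_trans_def)
  note ob = is_functorD(3)[OF S] is_functorD(3)[OF T] and ar = is_functorD(4)[OF S] is_functorD(4)[OF T]
  define t where "t X = ho_arr C (FOb S X) (FOb T X) (\<tau> X)" for X
  have "\<forall>X\<in>Ob C. \<exists>v. inverse_arrows (Ho C) (FOb S X) (FOb T X) (t X) v"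
    unfolding t_def using formal_inverse[OF C] ob w by blast
  then obtain t' where t': "\<forall>X\<in>Ob C. inverse_arrows (Ho C) (FOb S X) (FOb T X) (t X) (t' X)"
    by metis
  have "natural_iso C (Ho C) (comp_fctr (ho_unit C) S) (comp_fctr (ho_unit C) T) t t'"
    unfolding natural_iso_def nat_trans_def
    using is_functor_comp[OF S Ho_localisation(1)[OF C]] is_functor_comp[OF T Ho_localisation(1)[OF C]] t'
      ob ar nat_transD[OF N]
    by (simp add: t_def ho_arr_Hom[OF C] flip: ho_arr_Comp[OF C])
  then show ?thesis unfolding ho_natural_iso_def by (intro exI)
qed

lemma ho_natural_iso_sym: "ho_natural_iso C S T \<Longrightarrow> ho_natural_iso C T S"
  unfolding ho_natural_iso_def by (elim exE) (intro exI, erule natural_iso_sym)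

lemma ho_natural_iso_trans: "ho_natural_iso C S T \<Longrightarrow> ho_natural_iso C T U \<Longrightarrow> ho_natural_iso C S U"
  unfolding ho_natural_iso_def by (elim exE) (intro exI, erule (1) natural_iso_trans)

text \<open>
  Here \<open>\<Phi>\<close> is the functor that \<open>H\<close> induces on the localisation. Fullness of the localisation functor makes
  naturality on \<open>C\<close> the same as naturality on \<open>Ho C\<close>.
\<close>

lemma ho_natural_iso_to_id:
  assumes C: "unit_full C" and iso: "ho_natural_iso C id_fctr H"
    and \<Phi>: "is_functor (Ho C) (Ho C) \<Phi>" and ob: "\<And>X. X \<in> Ob C \<Longrightarrow> FOb \<Phi> X = FOb H X"
    and ar: "\<And>X Y f. X \<in> Ob C \<Longrightarrow> Y \<in> Ob C \<Longrightarrow> f \<in> Hom C X Y \<Longrightarrow>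
      FArr \<Phi> X Y (ho_arr C X Y f) = ho_arr C (FOb H X) (FOb H Y) (FArr H X Y f)"
  shows "\<exists>t t'. natural_iso (Ho C) (Ho C) id_fctr \<Phi> t t'"
proof -
  obtain t t' where "natural_iso C (Ho C) (comp_fctr (ho_unit C) id_fctr) (comp_fctr (ho_unit C) H) t t'"
    using iso unfolding ho_natural_iso_def by (elim exE)
  note N = natural_isoD(3-5)[OF this, simplified]
  have "natural_iso (Ho C) (Ho C) id_fctr \<Phi> t t'"
    unfolding natural_iso_def nat_trans_def
  proof (intro conjI ballI is_functor_id category_Ho \<Phi>)
    fix X Y c assume X: "X \<in> Ob (Ho C)" and Y: "Y \<in> Ob (Ho C)" and c: "c \<in> Hom (Ho C) X Y"
    then obtain f where "f \<in> Hom C X Y" "ho_arr C X Y f = c" using unit_fullD[OF C] by (metis Ob_Ho)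
    then show "Comp (Ho C) (FOb id_fctr X) (FOb id_fctr Y) (FOb \<Phi> Y) (t Y) (FArr id_fctr X Y c) =
        Comp (Ho C) (FOb id_fctr X) (FOb \<Phi> X) (FOb \<Phi> Y) (FArr \<Phi> X Y c) (t X)"
      using X Y N ob ar by auto
  qed (use N ob in simp_all)
  then show ?thesis by (intro exI)
qed

definition ho_equivalence ::
  "('o, 'm, 'z) relcat_scheme \<Rightarrow> ('p, 'n, 'w) relcat_scheme \<Rightarrow> ('o, 'm, 'p, 'n) fctr \<Rightarrow> bool" where
  "ho_equivalence C D F \<longleftrightarrow> relative_category C \<and> relative_category D \<and>
     is_functor C D F \<and> preserves_weq C D F \<and> categorical_equivalence (Ho C) (Ho D) (Ho_functor D F)"

lemma ho_equivalence_inverse: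
  assumes C: "relative_category C" "unit_full C" and D: "relative_category D" "unit_full D"
    and F: "is_functor C D F" "preserves_weq C D F" and G: "is_functor D C G" "preserves_weq D C G"
    and GF: "ho_natural_iso C id_fctr (comp_fctr G F)" and FG: "ho_natural_iso D id_fctr (comp_fctr F G)"
  shows "ho_equivalence C D F"
proof -
  note HF = Ho_functor_induced[OF C(1) D(1) F] and HG = Ho_functor_induced[OF D(1) C(1) G]
  note Fd = is_functorD[OF F(1)] and Gd = is_functorD[OF G(1)]
  obtain a a' where a: "natural_iso (Ho C) (Ho C) id_fctr (comp_fctr (Ho_functor C G) (Ho_functor D F)) a a'"
    using ho_natural_iso_to_id[OF C(2) GF is_functor_comp[OF HF(1) HG(1)]] HF HG Fd by auto
  obtain b b' where b: "natural_iso (Ho D) (Ho D) id_fctr (comp_fctr (Ho_functor D F) (Ho_functor C G)) b b'"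
    using ho_natural_iso_to_id[OF D(2) FG is_functor_comp[OF HG(1) HF(1)]] HF HG Gd by auto
  show ?thesis
    using categorical_equivalence_inverse[OF HF(1) HG(1) a b] C D F by (simp add: ho_equivalence_def)
qed

text \<open>
  The functor induced by a composite is a different record from the composite of the induced functors,
  but both extend the same functor on \<open>C\<close>, so the uniqueness part of the universal property identifies
  them on arrows.
\<close>

lemma ho_equivalence_trans:
  assumes F: "ho_equivalence C D F" and G: "ho_equivalence D E G"
  shows "ho_equivalence C E (comp_fctr G F)"
proof -
  have C: "relative_category C" and D: "relative_category D" and E: "relative_category E"
    and f: "is_functor C D F" "preserves_weq C D F" and g: "is_functor D E G" "preserves_weq D E G"
    and e: "categorical_equivalence (Ho C) (Ho D) (Ho_functor D F)" "categorical_equivalence (Ho D) (Ho E) (Ho_functor E G)"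
    using F G by (auto simp: ho_equivalence_def)
  have gf: "is_functor C E (comp_fctr G F)" "preserves_weq C E (comp_fctr G F)"
    using is_functor_comp[OF f(1) g(1)] f g is_functorD(3)[OF f(1)] by (auto simp: preserves_weq_def)
  note HF = Ho_functor_induced[OF C D f] and HG = Ho_functor_induced[OF D E g] and HGF = Ho_functor_induced[OF C E gf]
  have ob: "FOb (comp_fctr (Ho_functor E G) (Ho_functor D F)) X = FOb (Ho_functor E (comp_fctr G F)) X"
    if "X \<in> Ob C" for X
    using that HF(2) HG(2) HGF(2) is_functorD(3)[OF f(1)] by simp
  have "categorical_equivalence (Ho C) (Ho E) (Ho_functor E (comp_fctr G F))"
  proof (rule categorical_equivalence_cong[OF categorical_equivalence_comp[OF e] HGF(1)])
    fix X Y c assume c: "c \<in> Hom (Ho C) X Y"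
    show "FArr (comp_fctr (Ho_functor E G) (Ho_functor D F)) X Y c = FArr (Ho_functor E (comp_fctr G F)) X Y c"
      by (rule Ho_localisation(4)[OF C is_functor_comp[OF HF(1) HG(1)] HGF(1) ob _ c])
        (use HF HG HGF is_functorD(3,4)[OF f(1)] in simp_all)
  qed (use ob in simp)
  then show ?thesis using C E gf by (simp add: ho_equivalence_def)
qed

section \<open>Model categories\<close>

lemma small_empty: "small ({} :: 'u::universe set)"
  unfolding small_def using ordLeq_ordLess_trans[OF card_of_empty universe_uncountable] .

text \<open>
  A terminal object is a limit of the empty diagram.
\<close>

lemma complete_cat_terminal:
  assumes C: "category C" and compl: "complete_cat (U :: 'u::universe itself) C"
  shows "\<exists>T. terminal C T"
proof -
  define J :: "('u, 'u) cat" where "J = \<lparr>Ob = {}, Hom = (\<lambda>_ _. {}), Id = undefined, Comp = undefined\<rparr>"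
  have "small_category J" "is_functor J C D" for D
    using C by (simp_all add: J_def small_category_def category_def is_functor_def small_empty)
  then obtain L p where "limit_cone J C undefined L p" using compl unfolding complete_cat_def by blast
  then have L: "L \<in> Ob C" "\<And>T. T \<in> Ob C \<Longrightarrow> \<exists>!h. h \<in> Hom C T L"
    by (simp_all add: limit_cone_def cone_def J_def)
  then show ?thesis unfolding terminal_def by blast
qed

lemma category_op: "category C \<Longrightarrow> category (op_cat C)"
  by (simp add: category_def op_cat_def)

lemma terminal_op: "terminal (op_cat C) T = initial C T"
  by (simp add: terminal_def initial_def op_cat_def)

locale model =
  fixes U :: "'u::universe itself" and M :: "('o, 'm, 'z) model_cat_scheme"
  assumes M: "model_category U M"
begin

lemma cat: "category M"
  using M by (simp add: model_category_def)

lemmas cat_simps = categoryD[OF cat]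

lemma arrows:
  "X \<in> Ob M \<Longrightarrow> Y \<in> Ob M \<Longrightarrow> w \<in> Weq M X Y \<Longrightarrow> w \<in> Hom M X Y"
  "X \<in> Ob M \<Longrightarrow> Y \<in> Ob M \<Longrightarrow> w \<in> Cof M X Y \<Longrightarrow> w \<in> Hom M X Y"
  "X \<in> Ob M \<Longrightarrow> Y \<in> Ob M \<Longrightarrow> w \<in> Fib M X Y \<Longrightarrow> w \<in> Hom M X Y"
proof -
  have "arrow_class M (Weq M)" "arrow_class M (Cof M)" "arrow_class M (Fib M)"
    using M by (simp_all add: model_category_def)
  then show "X \<in> Ob M \<Longrightarrow> Y \<in> Ob M \<Longrightarrow> w \<in> Weq M X Y \<Longrightarrow> w \<in> Hom M X Y"
    "X \<in> Ob M \<Longrightarrow> Y \<in> Ob M \<Longrightarrow> w \<in> Cof M X Y \<Longrightarrow> w \<in> Hom M X Y"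
    "X \<in> Ob M \<Longrightarrow> Y \<in> Ob M \<Longrightarrow> w \<in> Fib M X Y \<Longrightarrow> w \<in> Hom M X Y"
    unfolding arrow_class_def by blast+
qed

lemma two_of_three:
  assumes "X \<in> Ob M" "Y \<in> Ob M" "Z \<in> Ob M" "f \<in> Hom M X Y" "g \<in> Hom M Y Z"
  shows "f \<in> Weq M X Y \<Longrightarrow> g \<in> Weq M Y Z \<Longrightarrow> Comp M X Y Z g f \<in> Weq M X Z"
    and "f \<in> Weq M X Y \<Longrightarrow> Comp M X Y Z g f \<in> Weq M X Z \<Longrightarrow> g \<in> Weq M Y Z"
    and "g \<in> Weq M Y Z \<Longrightarrow> Comp M X Y Z g f \<in> Weq M X Z \<Longrightarrow> f \<in> Weq M X Y"
proof -
  have "two_out_of_three M (Weq M)" using M by (simp add: model_category_def)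
  then show "f \<in> Weq M X Y \<Longrightarrow> g \<in> Weq M Y Z \<Longrightarrow> Comp M X Y Z g f \<in> Weq M X Z"
    and "f \<in> Weq M X Y \<Longrightarrow> Comp M X Y Z g f \<in> Weq M X Z \<Longrightarrow> g \<in> Weq M Y Z"
    and "g \<in> Weq M Y Z \<Longrightarrow> Comp M X Y Z g f \<in> Weq M X Z \<Longrightarrow> f \<in> Weq M X Y"
    using assms unfolding two_out_of_three_def by blast+
qed

lemma lift:
  assumes "A \<in> Ob M" "B \<in> Ob M" "X \<in> Ob M" "Y \<in> Ob M" "i \<in> Cof M A B" "p \<in> Fib M X Y"
    and "i \<in> Weq M A B \<or> p \<in> Weq M X Y"
    and "u \<in> Hom M A X" "v \<in> Hom M B Y" "Comp M A X Y p u = Comp M A B Y v i"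
  shows "\<exists>h\<in>Hom M B X. Comp M A B X h i = u \<and> Comp M B X Y p h = v"
proof -
  have "lifting_property M (\<lambda>X Y. Cof M X Y \<inter> Weq M X Y) (Fib M)"
    "lifting_property M (Cof M) (\<lambda>X Y. Fib M X Y \<inter> Weq M X Y)"
    using M by (simp_all add: model_category_def)
  then have "lifts M A B i X Y p" using assms(1-7) unfolding lifting_property_def by blast
  then show ?thesis using assms(8-10) unfolding lifts_def by blast
qed

lemma factorisations:
  "functorial_factorisation M (\<lambda>X Y. Cof M X Y \<inter> Weq M X Y) (Fib M)"
  "functorial_factorisation M (Cof M) (\<lambda>X Y. Fib M X Y \<inter> Weq M X Y)"
  using M by (simp_all add: model_category_def)

lemma factor:
  assumes "functorial_factorisation M L R" "X \<in> Ob M" "Y \<in> Ob M" "f \<in> Hom M X Y"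
  shows "\<exists>E\<in>Ob M. \<exists>i\<in>L X E. \<exists>p\<in>R E Y. Comp M X E Y p i = f"
proof -
  obtain E l r where E: "is_functor (arrow_cat M) M E" and
    lr: "l (X, Y, f) \<in> L X (FOb E (X, Y, f))" "r (X, Y, f) \<in> R (FOb E (X, Y, f)) Y"
      "Comp M X (FOb E (X, Y, f)) Y (r (X, Y, f)) (l (X, Y, f)) = f"
    using assms unfolding functorial_factorisation_def nat_trans_def by blast
  have "FOb E (X, Y, f) \<in> Ob M"
    using is_functorD(3)[OF E] assms by (simp add: arrow_cat_def)
  then show ?thesis using lr by blast
qed

lemma ex_initial: "\<exists>I. initial M I" and ex_terminal: "\<exists>T. terminal M T"
proof -
  have "complete_cat U M" "complete_cat U (op_cat M)"
    using M by (simp_all add: model_category_def cocomplete_cat_def)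
  then show "\<exists>I. initial M I" "\<exists>T. terminal M T"
    using complete_cat_terminal[OF category_op[OF cat]] complete_cat_terminal[OF cat]
    by (simp_all add: terminal_op)
qed

lemma cofibrant_lift:
  assumes X: "cofibrant M X" and ob: "A \<in> Ob M" "B \<in> Ob M"
    and p: "p \<in> Fib M A B" "p \<in> Weq M A B" and v: "v \<in> Hom M X B"
  shows "\<exists>h\<in>Hom M X A. Comp M X A B p h = v"
proof -
  obtain I where I: "initial M I" using ex_initial by blast
  have XO: "X \<in> Ob M" and IO: "I \<in> Ob M" using X I by (auto simp: cofibrant_def initial_def)
  obtain i u where i: "i \<in> Hom M I X" and u: "u \<in> Hom M I A"
    using I XO ob unfolding initial_def by metis
  have "i \<in> Cof M I X" using X I i by (auto simp: cofibrant_def)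
  moreover have "Comp M I A B p u = Comp M I X B v i"
    using I ob(2) cat_simps(2)[OF IO ob(1,2) u arrows(3)[OF ob p(1)]] cat_simps(2)[OF IO XO ob(2) i v]
    unfolding initial_def by blast
  ultimately show ?thesis using lift[OF IO XO ob _ p(1) _ u v] p(2) by blast
qed

text \<open>
  The retract argument: factor the arrow \<open>u : I \<rightarrow> X\<close> from an initial object as a cofibration \<open>i\<close> followed by
  a trivial fibration \<open>p\<close>. A lift of the identity of \<open>X\<close> along \<open>p\<close> makes \<open>u\<close> a retract of \<open>i\<close>.
\<close>

lemma cofibrantI:
  assumes X: "X \<in> Ob M"
    and lft: "\<And>A B p v. A \<in> Ob M \<Longrightarrow> B \<in> Ob M \<Longrightarrow> p \<in> Fib M A B \<Longrightarrow> p \<in> Weq M A B \<Longrightarrow>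
      v \<in> Hom M X B \<Longrightarrow> \<exists>h\<in>Hom M X A. Comp M X A B p h = v"
  shows "cofibrant M X"
  unfolding cofibrant_def
proof (intro conjI allI impI subsetI X)
  fix I u assume I: "initial M I" and u: "u \<in> Hom M I X"
  have IO: "I \<in> Ob M" using I by (simp add: initial_def)
  obtain E i p where E: "E \<in> Ob M" and i: "i \<in> Cof M I E" and p: "p \<in> Fib M E X" "p \<in> Weq M E X"
    and pi: "Comp M I E X p i = u"
    using factor[OF factorisations(2) IO X u] by blast
  have m: "i \<in> Hom M I E" "p \<in> Hom M E X" using arrows IO X E i p by auto
  obtain s where s: "s \<in> Hom M X E" "Comp M X E X p s = Id M X"
    using lft[OF E X p cat_simps(1)[OF X]] by blast
  \<comment> \<open>both sides are arrows out of the initial object\<close>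
  have su: "Comp M I X E s u = i"
    using I E m cat_simps(2)[OF IO X E u s(1)] unfolding initial_def by blast
  have "retract_of M (I, X, u) (I, E, i)"
    unfolding retract_of_def
    by (rule bexI[of _ "(Id M I, s)"], rule bexI[of _ "(Id M I, p)"])
      (use IO X E u s m su pi in \<open>auto simp: arrow_cat_def cat_simps\<close>)
  moreover have "retract_closed M (Cof M)" using M by (simp add: model_category_def)
  ultimately show "u \<in> Cof M I X" using IO X E u i unfolding retract_closed_def by blast
qed

lemma fibrant_extend:
  assumes Y: "fibrant M Y" and ob: "A \<in> Ob M" "B \<in> Ob M"
    and i: "i \<in> Cof M A B" "i \<in> Weq M A B" and u: "u \<in> Hom M A Y"
  shows "\<exists>h\<in>Hom M B Y. Comp M A B Y h i = u"
proof -
  obtain T where T: "terminal M T" using ex_terminal by blast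
  have YO: "Y \<in> Ob M" and TO: "T \<in> Ob M" using Y T by (auto simp: fibrant_def terminal_def)
  obtain p v where p: "p \<in> Hom M Y T" and v: "v \<in> Hom M B T"
    using T YO ob unfolding terminal_def by metis
  have "p \<in> Fib M Y T" using Y T p by (auto simp: fibrant_def)
  moreover have "Comp M A Y T p u = Comp M A B T v i"
    using T ob(1) cat_simps(2)[OF ob TO arrows(2)[OF ob i(1)] v] cat_simps(2)[OF ob(1) YO TO u p]
    unfolding terminal_def by blast
  ultimately show ?thesis using lift[OF ob YO TO i(1) _ _ u v] i(2) by blast
qed

text \<open>
  The retract argument dual to the one for cofibrant objects.
\<close>

lemma fibrantI:
  assumes Y: "Y \<in> Ob M"
    and ext: "\<And>A B i u. A \<in> Ob M \<Longrightarrow> B \<in> Ob M \<Longrightarrow> i \<in> Cof M A B \<Longrightarrow> i \<in> Weq M A B \<Longrightarrow>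
      u \<in> Hom M A Y \<Longrightarrow> \<exists>h\<in>Hom M B Y. Comp M A B Y h i = u"
  shows "fibrant M Y"
  unfolding fibrant_def
proof (intro conjI allI impI subsetI Y)
  fix T u assume T: "terminal M T" and u: "u \<in> Hom M Y T"
  have TO: "T \<in> Ob M" using T by (simp add: terminal_def)
  obtain E i p where E: "E \<in> Ob M" and i: "i \<in> Cof M Y E" "i \<in> Weq M Y E" and p: "p \<in> Fib M E T"
    and pi: "Comp M Y E T p i = u"
    using factor[OF factorisations(1) Y TO u] by blast
  have m: "i \<in> Hom M Y E" "p \<in> Hom M E T" using arrows TO Y E i p by auto
  obtain s where s: "s \<in> Hom M E Y" "Comp M Y E Y s i = Id M Y"
    using ext[OF Y E i cat_simps(1)[OF Y]] by blast
  \<comment> \<open>both sides are arrows into the terminal object\<close>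
  have us: "Comp M E Y T u s = p"
    using T E m cat_simps(2)[OF E Y TO s(1) u] unfolding terminal_def by blast
  have "retract_of M (Y, T, u) (E, T, p)"
    unfolding retract_of_def
    by (rule bexI[of _ "(i, Id M T)"], rule bexI[of _ "(s, Id M T)"])
      (use TO Y E u s m us pi in \<open>auto simp: arrow_cat_def cat_simps\<close>)
  moreover have "retract_closed M (Fib M)" using M by (simp add: model_category_def)
  ultimately show "u \<in> Fib M Y T" using TO Y E u p unfolding retract_closed_def by blast
qed

lemma cofibrant_Ob: "cofibrant M X \<Longrightarrow> X \<in> Ob M" and fibrant_Ob: "fibrant M X \<Longrightarrow> X \<in> Ob M"
  by (simp_all add: cofibrant_def fibrant_def)

lemma cofibrant_cof:
  assumes X: "cofibrant M X" and E: "E \<in> Ob M" and i: "i \<in> Cof M X E"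
  shows "cofibrant M E"
proof (rule cofibrantI[OF E])
  fix A B p v assume p: "A \<in> Ob M" "B \<in> Ob M" "p \<in> Fib M A B" "p \<in> Weq M A B" and v: "v \<in> Hom M E B"
  note XO = cofibrant_Ob[OF X]
  have "Comp M X E B v i \<in> Hom M X B" using cat_simps(2)[OF XO E p(2) arrows(2)[OF XO E i] v] .
  from cofibrant_lift[OF X p this] obtain h where h: "h \<in> Hom M X A" "Comp M X A B p h = Comp M X E B v i" by blast
  show "\<exists>h\<in>Hom M E A. Comp M E A B p h = v"
    using lift[OF XO E p(1,2) i p(3) _ h(1) v h(2)] p(4) by blast
qed

lemma fibrant_fib:
  assumes Y: "fibrant M Y" and E: "E \<in> Ob M" and q: "q \<in> Fib M E Y"
  shows "fibrant M E"
proof (rule fibrantI[OF E])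
  fix A B i u assume i: "A \<in> Ob M" "B \<in> Ob M" "i \<in> Cof M A B" "i \<in> Weq M A B" and u: "u \<in> Hom M A E"
  note YO = fibrant_Ob[OF Y]
  have "Comp M A E Y q u \<in> Hom M A Y" using cat_simps(2)[OF i(1) E YO u arrows(3)[OF E YO q]] .
  from fibrant_extend[OF Y i this] obtain h where h: "h \<in> Hom M B Y" "Comp M A B Y h i = Comp M A E Y q u" by blast
  show "\<exists>h\<in>Hom M B E. Comp M A B E h i = u"
    using lift[OF i(1,2) E YO i(3) q _ u h(1) h(2)[symmetric]] i(4) by blast
qed

text \<open>
  The functorial factorisation is a functor on the arrow category. Precomposing it with the functor \<open>S\<close> that
  sends \<open>X\<close> to the arrow from an initial object to \<open>X\<close> gives a cofibrant replacement functor together with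
  its natural trivial fibration.
\<close>

lemma cofibrant_replacement:
  "\<exists>Q q. is_functor M M Q \<and>
    (\<forall>X\<in>Ob M. q X \<in> Fib M (FOb Q X) X \<and> q X \<in> Weq M (FOb Q X) X \<and> cofibrant M (FOb Q X)) \<and>
    (\<forall>X\<in>Ob M. \<forall>Y\<in>Ob M. \<forall>f\<in>Hom M X Y.
       Comp M (FOb Q X) (FOb Q Y) Y (q Y) (FArr Q X Y f) = Comp M (FOb Q X) X Y f (q X))"
proof -
  obtain I where I: "initial M I" using ex_initial by blast
  then have IO: "I \<in> Ob M" by (simp add: initial_def)
  define e where "e X = (THE f. f \<in> Hom M I X)" for X
  have uniq: "u = v" if "X \<in> Ob M" "u \<in> Hom M I X" "v \<in> Hom M I X" for X u v
    using I that unfolding initial_def by blast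
  have e: "e X \<in> Hom M I X" if "X \<in> Ob M" for X
    unfolding e_def using I that theI' unfolding initial_def by metis
  obtain E l r where r: "nat_trans (arrow_cat M) M E cod_functor r"
    and fac: "\<forall>X\<in>Ob M. \<forall>Y\<in>Ob M. \<forall>f\<in>Hom M X Y.
      l (X, Y, f) \<in> Cof M X (FOb E (X, Y, f)) \<and> r (X, Y, f) \<in> Fib M (FOb E (X, Y, f)) Y \<inter> Weq M (FOb E (X, Y, f)) Y"
    using factorisations(2) unfolding functorial_factorisation_def by blast
  have E: "is_functor (arrow_cat M) M E" using r by (simp add: nat_trans_def)
  define S :: "('o, 'm, 'o \<times> 'o \<times> 'm, 'm \<times> 'm) fctr"
    where "S = \<lparr>FOb = (\<lambda>X. (I, X, e X)), FArr = (\<lambda>X Y f. (Id M I, f))\<rparr>"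
  have S: "is_functor M (arrow_cat M) S"
    using is_functorD(1)[OF E] cat e uniq IO
    by (auto simp: is_functor_def S_def arrow_cat_def cat_simps)
  note Q = is_functor_comp[OF S E]
  define q where "q X = r (I, X, e X)" for X
  show ?thesis
  proof (intro exI[of _ "comp_fctr E S"] exI[of _ q] conjI ballI Q)
    fix X assume X: "X \<in> Ob M"
    show "q X \<in> Fib M (FOb (comp_fctr E S) X) X" "q X \<in> Weq M (FOb (comp_fctr E S) X) X"
      using fac X IO e by (auto simp: q_def S_def)
    have "cofibrant M I"
      using I IO uniq cat_simps(2) by (intro cofibrantI) (auto simp: initial_def, metis arrows(3))
    then show "cofibrant M (FOb (comp_fctr E S) X)"
      using cofibrant_cof[of I _ "l (I, X, e X)"] is_functorD(3)[OF Q X] fac X IO e by (simp add: S_def)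
  next
    fix X Y f assume X: "X \<in> Ob M" and Y: "Y \<in> Ob M" and f: "f \<in> Hom M X Y"
    have "(Id M I, f) \<in> Hom (arrow_cat M) (I, X, e X) (I, Y, e Y)"
      using is_functorD(4)[OF S X Y f] by (simp add: S_def)
    then show "Comp M (FOb (comp_fctr E S) X) (FOb (comp_fctr E S) Y) Y (q Y) (FArr (comp_fctr E S) X Y f) =
        Comp M (FOb (comp_fctr E S) X) X Y f (q X)"
      using nat_transD(2)[OF r, of "(I, X, e X)" "(I, Y, e Y)" "(Id M I, f)"] is_functorD(3)[OF S X] is_functorD(3)[OF S Y]
      by (simp add: q_def S_def cod_functor_def)
  qed
qed

text \<open>
  The dual of the cofibrant replacement, with \<open>S\<close> sending \<open>X\<close> to its arrow to a terminal object.
\<close>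

lemma fibrant_replacement:
  "\<exists>R r. is_functor M M R \<and>
    (\<forall>X\<in>Ob M. r X \<in> Cof M X (FOb R X) \<and> r X \<in> Weq M X (FOb R X) \<and> fibrant M (FOb R X)) \<and>
    (\<forall>X\<in>Ob M. \<forall>Y\<in>Ob M. \<forall>f\<in>Hom M X Y.
       Comp M X Y (FOb R Y) (r Y) f = Comp M X (FOb R X) (FOb R Y) (FArr R X Y f) (r X))"
proof -
  obtain T where T: "terminal M T" using ex_terminal by blast
  then have TO: "T \<in> Ob M" by (simp add: terminal_def)
  define e where "e X = (THE f. f \<in> Hom M X T)" for X
  have uniq: "u = v" if "X \<in> Ob M" "u \<in> Hom M X T" "v \<in> Hom M X T" for X u v
    using T that unfolding terminal_def by blast
  have e: "e X \<in> Hom M X T" if "X \<in> Ob M" for X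
    unfolding e_def using T that theI' unfolding terminal_def by metis
  obtain E l r where l: "nat_trans (arrow_cat M) M dom_functor E l"
    and fac: "\<forall>X\<in>Ob M. \<forall>Y\<in>Ob M. \<forall>f\<in>Hom M X Y.
      l (X, Y, f) \<in> Cof M X (FOb E (X, Y, f)) \<inter> Weq M X (FOb E (X, Y, f)) \<and> r (X, Y, f) \<in> Fib M (FOb E (X, Y, f)) Y"
    using factorisations(1) unfolding functorial_factorisation_def by blast
  have E: "is_functor (arrow_cat M) M E" using l by (simp add: nat_trans_def)
  define S :: "('o, 'm, 'o \<times> 'o \<times> 'm, 'm \<times> 'm) fctr"
    where "S = \<lparr>FOb = (\<lambda>X. (X, T, e X)), FArr = (\<lambda>X Y f. (f, Id M T))\<rparr>"
  have S: "is_functor M (arrow_cat M) S"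
    using is_functorD(1)[OF E] cat e uniq TO
    by (auto simp: is_functor_def S_def arrow_cat_def cat_simps)
  note R = is_functor_comp[OF S E]
  define q where "q X = l (X, T, e X)" for X
  show ?thesis
  proof (intro exI[of _ "comp_fctr E S"] exI[of _ q] conjI ballI R)
    fix X assume X: "X \<in> Ob M"
    show "q X \<in> Cof M X (FOb (comp_fctr E S) X)" "q X \<in> Weq M X (FOb (comp_fctr E S) X)"
      using fac X TO e by (auto simp: q_def S_def)
    have "fibrant M T"
      using T TO uniq cat_simps(2) by (intro fibrantI) (auto simp: terminal_def, metis arrows(2))
    then show "fibrant M (FOb (comp_fctr E S) X)"
      using fibrant_fib[of T _ "r (X, T, e X)"] is_functorD(3)[OF R X] fac X TO e by (simp add: S_def)
  next
    fix X Y f assume X: "X \<in> Ob M" and Y: "Y \<in> Ob M" and f: "f \<in> Hom M X Y"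
    have "(f, Id M T) \<in> Hom (arrow_cat M) (X, T, e X) (Y, T, e Y)"
      using is_functorD(4)[OF S X Y f] by (simp add: S_def)
    then show "Comp M X Y (FOb (comp_fctr E S) Y) (q Y) f =
        Comp M X (FOb (comp_fctr E S) X) (FOb (comp_fctr E S) Y) (FArr (comp_fctr E S) X Y f) (q X)"
      using nat_transD(2)[OF l, of "(X, T, e X)" "(Y, T, e Y)" "(f, Id M T)"] is_functorD(3)[OF S X] is_functorD(3)[OF S Y]
      by (simp add: q_def S_def dom_functor_def)
  qed
qed

lemma cf_simps:
  "Ob (cf_subcat M) = {X. cofibrant M X \<and> fibrant M X}"
  "Hom (cf_subcat M) = Hom M" "Id (cf_subcat M) = Id M" "Comp (cf_subcat M) = Comp M" "Weq (cf_subcat M) = Weq M"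
  using cofibrant_Ob by (auto simp: cf_subcat_def full_subcat_def relcat.truncate_def)

lemma relative_category_cf: "relative_category (cf_subcat M)"
  using cat arrows(1) cofibrant_Ob
  by (auto simp: relative_category_def arrow_class_def cf_simps category_def)

text \<open>
  Whitehead's theorem. A weak equivalence \<open>w\<close> between cofibrant-fibrant objects factors as a trivial
  cofibration \<open>i\<close> followed by a trivial fibration \<open>p\<close>. Fibrancy of the source gives a retraction \<open>r\<close> of \<open>i\<close>,
  cofibrancy of the target a section \<open>s\<close> of \<open>p\<close>. A one-sided inverse of an isomorphism is its inverse, so in
  the localisation \<open>r\<close> and \<open>s\<close> invert \<open>i\<close> and \<open>p\<close>, and \<open>r s\<close> inverts \<open>w\<close>.
\<close>

lemma unit_full_cf: "unit_full (cf_subcat M)"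
proof (rule unit_fullI[OF relative_category_cf])
  let ?C = "cf_subcat M"
  note C = relative_category_cf
  fix X Y w assume X: "X \<in> Ob ?C" and Y: "Y \<in> Ob ?C" and w: "w \<in> Weq ?C X Y"
  then have cf: "cofibrant M X" "fibrant M X" "cofibrant M Y" "fibrant M Y" and wM: "w \<in> Weq M X Y"
    by (simp_all add: cf_simps)
  note ob = cf(1,3)[THEN cofibrant_Ob]
  note wH = arrows(1)[OF ob wM]
  obtain E i p where E: "E \<in> Ob M" and i: "i \<in> Cof M X E" "i \<in> Weq M X E" and p: "p \<in> Fib M E Y"
    and pi: "Comp M X E Y p i = w"
    using factor[OF factorisations(1) ob wH] by blast
  have m: "i \<in> Hom M X E" "p \<in> Hom M E Y" using arrows ob E i p by auto
  have pw: "p \<in> Weq M E Y" using two_of_three(2)[OF ob(1) E ob(2) m i(2)] pi wM by simp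
  have EC: "E \<in> Ob ?C" using cofibrant_cof[OF cf(1) E i(1)] fibrant_fib[OF cf(4) E p] by (simp add: cf_simps)
  obtain r where r: "r \<in> Hom M E X" "Comp M X E X r i = Id M X"
    using fibrant_extend[OF cf(2) ob(1) E i cat_simps(1)[OF ob(1)]] by blast
  obtain s where s: "s \<in> Hom M Y E" "Comp M Y E Y p s = Id M Y"
    using cofibrant_lift[OF cf(3) E ob(2) p pw cat_simps(1)[OF ob(2)]] by blast
  have inv1: "inverse_arrows (Ho ?C) X E (ho_arr ?C X E i) (ho_arr ?C E X r)"
  proof -
    obtain i' where i': "inverse_arrows (Ho ?C) X E (ho_arr ?C X E i) i'"
      using formal_inverse[OF C X EC] i by (auto simp: cf_simps)
    have "ho_arr ?C E X r = i'"
      by (rule inverse_cancel_right[OF category_Ho _ _ _ _ _ i', of X])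
        (use X EC m r i' ho_arr_Comp[OF C X EC X, of i r] ho_arr_Hom[OF C EC X, of r] ho_arr_Id[OF C X] in
          \<open>simp_all add: cf_simps(2-) inverse_arrows_def\<close>)
    then show ?thesis using i' by simp
  qed
  have inv2: "inverse_arrows (Ho ?C) E Y (ho_arr ?C E Y p) (ho_arr ?C Y E s)"
  proof -
    obtain p' where p': "inverse_arrows (Ho ?C) E Y (ho_arr ?C E Y p) p'"
      using formal_inverse[OF C EC Y] pw by (auto simp: cf_simps)
    have "ho_arr ?C Y E s = p'"
      by (rule inverse_cancel_left[OF category_Ho _ _ _ _ _ p', of Y])
        (use Y EC m s p' ho_arr_Comp[OF C Y EC Y, of s p] ho_arr_Hom[OF C Y EC, of s] ho_arr_Id[OF C Y] in
          \<open>simp_all add: cf_simps(2-) inverse_arrows_def\<close>)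
    then show ?thesis using p' by simp
  qed
  have "inverse_arrows (Ho ?C) X Y (ho_arr ?C X Y w) (ho_arr ?C Y X (Comp M Y E X r s))"
    using inverse_arrows_Comp[OF category_Ho _ _ _ inv1 inv2] X Y EC m r s
      ho_arr_Comp[OF C X EC Y, of i p] ho_arr_Comp[OF C Y EC X, of s r]
    by (simp add: cf_simps(2-) pi)
  moreover have "Comp M Y E X r s \<in> Hom ?C Y X" using cat_simps(2)[OF ob(2) E ob(1) s(1) r(1)] by (simp add: cf_simps)
  ultimately show "\<exists>v\<in>Hom ?C Y X. inverse_arrows (Ho ?C) X Y (ho_arr ?C X Y w) (ho_arr ?C Y X v)" by blast
qed

end

section \<open>Quillen equivalences\<close>

lemma (in model) is_functor_cf:
  assumes N: "model U N" and H: "is_functor M N H"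
    and cf: "\<And>X. cofibrant M X \<Longrightarrow> fibrant M X \<Longrightarrow> cofibrant N (FOb H X) \<and> fibrant N (FOb H X)"
  shows "is_functor (cf_subcat M) (cf_subcat N) H"
  using relative_categoryD(1)[OF relative_category_cf] relative_categoryD(1)[OF model.relative_category_cf[OF N]]
    is_functorD(4-6)[OF H] cf cofibrant_Ob
  unfolding is_functor_def cf_simps model.cf_simps[OF N] by simp

locale quillen =
  fixes U :: "'u::universe itself" and M :: "('o, 'm, 'z) model_cat_scheme" and N :: "('p, 'n, 'w) model_cat_scheme"
    and F :: "('o, 'm, 'p, 'n) fctr" and G :: "('p, 'n, 'o, 'm) fctr" and \<phi> :: "'o \<Rightarrow> 'p \<Rightarrow> 'n \<Rightarrow> 'm"
  assumes Q: "quillen_equivalence U M N F G \<phi>"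
begin

sublocale M: model U M
  using Q by unfold_locales (simp add: quillen_equivalence_def)

sublocale N: model U N
  using Q by unfold_locales (simp add: quillen_equivalence_def)

lemma adj: "adjunction M N F G \<phi>"
  using Q by (simp add: quillen_equivalence_def quillen_adjunction_def)

lemma F: "is_functor M N F" and G: "is_functor N M G"
  using adj by (simp_all add: adjunction_def)

lemma F_cof:
  assumes "X \<in> Ob M" "Y \<in> Ob M" "f \<in> Cof M X Y"
  shows "FArr F X Y f \<in> Cof N (FOb F X) (FOb F Y)"
    and "f \<in> Weq M X Y \<Longrightarrow> FArr F X Y f \<in> Weq N (FOb F X) (FOb F Y)"
  using Q assms by (simp_all add: quillen_equivalence_def quillen_adjunction_def)

lemma weq_iff:
  assumes "cofibrant M X" "fibrant N Y" "f \<in> Hom N (FOb F X) Y"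
  shows "\<phi> X Y f \<in> Weq M X (FOb G Y) \<longleftrightarrow> f \<in> Weq N (FOb F X) Y"
  using Q assms M.cofibrant_Ob[OF assms(1)] N.fibrant_Ob[OF assms(2)] by (simp add: quillen_equivalence_def)

lemma phi_bij: "X \<in> Ob M \<Longrightarrow> Y \<in> Ob N \<Longrightarrow> bij_betw (\<phi> X Y) (Hom N (FOb F X) Y) (Hom M X (FOb G Y))"
  using adj by (simp add: adjunction_def)

lemma phi_Hom: "X \<in> Ob M \<Longrightarrow> Y \<in> Ob N \<Longrightarrow> f \<in> Hom N (FOb F X) Y \<Longrightarrow> \<phi> X Y f \<in> Hom M X (FOb G Y)"
  using bij_betwE[OF phi_bij] by blast

lemma phi_inj:
  "X \<in> Ob M \<Longrightarrow> Y \<in> Ob N \<Longrightarrow> f \<in> Hom N (FOb F X) Y \<Longrightarrow> g \<in> Hom N (FOb F X) Y \<Longrightarrow> \<phi> X Y f = \<phi> X Y g \<Longrightarrow> f = g"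
  using bij_betw_imp_inj_on[OF phi_bij] by (auto dest: inj_onD)

lemma phi_surj:
  "X \<in> Ob M \<Longrightarrow> Y \<in> Ob N \<Longrightarrow> g \<in> Hom M X (FOb G Y) \<Longrightarrow> \<exists>f\<in>Hom N (FOb F X) Y. \<phi> X Y f = g"
  using bij_betw_imp_surj_on[OF phi_bij, of X Y] by (metis imageE)

lemma phi_natural:
  assumes "X \<in> Ob M" "X' \<in> Ob M" "Y \<in> Ob N" "Y' \<in> Ob N"
    "u \<in> Hom M X' X" "f \<in> Hom N (FOb F X) Y" "v \<in> Hom N Y Y'"
  shows "\<phi> X' Y' (Comp N (FOb F X') Y Y' v (Comp N (FOb F X') (FOb F X) Y f (FArr F X' X u))) =
    Comp M X' (FOb G Y) (FOb G Y') (FArr G Y Y' v) (Comp M X' X (FOb G Y) (\<phi> X Y f) u)"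
  using adj assms by (simp add: adjunction_def)

text \<open>
  Naturality of the adjunction in one variable, with the identity inserted in the other.
\<close>

lemma phi_pre:
  assumes "X \<in> Ob M" "X' \<in> Ob M" "Y \<in> Ob N" "u \<in> Hom M X' X" "f \<in> Hom N (FOb F X) Y"
  shows "\<phi> X' Y (Comp N (FOb F X') (FOb F X) Y f (FArr F X' X u)) = Comp M X' X (FOb G Y) (\<phi> X Y f) u"
proof -
  note ob = is_functorD(3)[OF F] is_functorD(3)[OF G] and ar = is_functorD(4)[OF F]
  have "Comp N (FOb F X') (FOb F X) Y f (FArr F X' X u) \<in> Hom N (FOb F X') Y"
    "Comp M X' X (FOb G Y) (\<phi> X Y f) u \<in> Hom M X' (FOb G Y)"
    using assms ob ar phi_Hom by (auto intro!: N.cat_simps(2) M.cat_simps(2))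
  then show ?thesis
    using phi_natural[OF assms(1-3,3,4,5) N.cat_simps(1)[OF assms(3)]] assms ob is_functorD(5)[OF G]
    by (simp add: M.cat_simps(4) N.cat_simps(4))
qed

lemma phi_post:
  assumes "X \<in> Ob M" "Y \<in> Ob N" "Y' \<in> Ob N" "f \<in> Hom N (FOb F X) Y" "v \<in> Hom N Y Y'"
  shows "\<phi> X Y' (Comp N (FOb F X) Y Y' v f) = Comp M X (FOb G Y) (FOb G Y') (FArr G Y Y' v) (\<phi> X Y f)"
  using phi_natural[OF assms(1,1-3) M.cat_simps(1)[OF assms(1)] assms(4,5)] assms
    is_functorD(3,5)[OF F] is_functorD(3)[OF G] phi_Hom
  by (simp add: M.cat_simps(3) N.cat_simps(3))

text \<open>
  If \<open>I\<close> is initial, then so is \<open>F I\<close>, since arrows out of \<open>F I\<close> correspond to arrows out of \<open>I\<close>. Hence \<open>F\<close>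
  of the cofibration \<open>I \<rightarrow> X\<close> provides the lifts that characterise cofibrancy of \<open>F X\<close>.
\<close>

lemma F_cofibrant:
  assumes X: "cofibrant M X"
  shows "cofibrant N (FOb F X)"
proof -
  obtain I where I: "initial M I" using M.ex_initial by blast
  have XO: "X \<in> Ob M" and IO: "I \<in> Ob M" using X I by (auto simp: cofibrant_def initial_def)
  obtain i where i: "i \<in> Hom M I X" using I XO unfolding initial_def by metis
  have ic: "i \<in> Cof M I X" using X I i by (auto simp: cofibrant_def)
  note FI = is_functorD(3)[OF F IO] and FX = is_functorD(3)[OF F XO]
  show ?thesis
  proof (rule N.cofibrantI[OF FX])
    fix A B p v assume p: "A \<in> Ob N" "B \<in> Ob N" "p \<in> Fib N A B" "p \<in> Weq N A B" and v: "v \<in> Hom N (FOb F X) B"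
    have uniq: "f = g" if "f \<in> Hom N (FOb F I) A'" "g \<in> Hom N (FOb F I) A'" "A' \<in> Ob N" for f g A'
      using phi_inj[OF IO that(3,1,2)] phi_Hom[OF IO that(3)] that is_functorD(3)[OF G that(3)] I
      unfolding initial_def by metis
    obtain w where "w \<in> Hom M I (FOb G A)" using I is_functorD(3)[OF G p(1)] unfolding initial_def by metis
    then obtain u where u: "u \<in> Hom N (FOb F I) A" using phi_surj[OF IO p(1)] by blast
    have "Comp N (FOb F I) A B p u = Comp N (FOb F I) (FOb F X) B v (FArr F I X i)"
      using uniq[OF N.cat_simps(2)[OF FI p(1,2) u N.arrows(3)[OF p(1-3)]]
          N.cat_simps(2)[OF FI FX p(2) is_functorD(4)[OF F IO XO i] v] p(2)] .
    from N.lift[OF FI FX p(1,2) F_cof(1)[OF IO XO ic] p(3) _ u v this]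
    show "\<exists>h\<in>Hom N (FOb F X) A. Comp N (FOb F X) A B p h = v" using p(4) by blast
  qed
qed

lemma G_fibrant:
  assumes Y: "fibrant N Y"
  shows "fibrant M (FOb G Y)"
proof -
  note YO = N.fibrant_Ob[OF Y]
  show ?thesis
  proof (rule M.fibrantI[OF is_functorD(3)[OF G YO]])
    fix A B i u assume i: "A \<in> Ob M" "B \<in> Ob M" "i \<in> Cof M A B" "i \<in> Weq M A B" and u: "u \<in> Hom M A (FOb G Y)"
    obtain f where f: "f \<in> Hom N (FOb F A) Y" "\<phi> A Y f = u" using phi_surj[OF i(1) YO u] by blast
    note Fi = F_cof[OF i(1-3)] and FAB = is_functorD(3)[OF F i(1)] is_functorD(3)[OF F i(2)]
    obtain h where h: "h \<in> Hom N (FOb F B) Y" "Comp N (FOb F A) (FOb F B) Y h (FArr F A B i) = f"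
      using N.fibrant_extend[OF Y FAB Fi(1) Fi(2)[OF i(4)] f(1)] by blast
    have "Comp M A B (FOb G Y) (\<phi> B Y h) i = u"
      using phi_pre[OF i(2,1) YO M.arrows(2)[OF i(1-3)] h(1)] h(2) f(2) by simp
    then show "\<exists>h\<in>Hom M B (FOb G Y). Comp M A B (FOb G Y) h i = u"
      using phi_Hom[OF i(2) YO h(1)] by blast
  qed
qed

text \<open>
  Let \<open>r : F Y \<rightarrow> Z\<close> be a fibrant replacement. Its transpose \<open>Y \<rightarrow> G Z\<close> is a weak equivalence, hence so is the
  transpose after \<open>w\<close>. But this is the transpose of \<open>r \<circ> F w\<close>, which is therefore a weak equivalence, and two
  out of three applies. The argument for \<open>G\<close> is dual.
\<close>

lemma F_weq:
  assumes X: "cofibrant M X" "cofibrant M Y" and w: "w \<in> Weq M X Y"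
  shows "FArr F X Y w \<in> Weq N (FOb F X) (FOb F Y)"
proof -
  note ob = X[THEN M.cofibrant_Ob]
  note wH = M.arrows(1)[OF ob w] and Fob = is_functorD(3)[OF F ob(1)] is_functorD(3)[OF F ob(2)]
  note Fw = is_functorD(4)[OF F ob wH]
  obtain Rr r where R: "is_functor N N Rr" and r: "\<forall>X\<in>Ob N. r X \<in> Cof N X (FOb Rr X) \<and> r X \<in> Weq N X (FOb Rr X) \<and> fibrant N (FOb Rr X)"
    using N.fibrant_replacement by blast
  let ?Z = "FOb Rr (FOb F Y)" and ?r = "r (FOb F Y)"
  have Z: "?Z \<in> Ob N" "fibrant N ?Z" "?r \<in> Weq N (FOb F Y) ?Z"
    using r Fob is_functorD(3)[OF R] by auto
  note rH = N.arrows(1)[OF Fob(2) Z(1,3)]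
  have "Comp M X Y (FOb G ?Z) (\<phi> Y ?Z ?r) w \<in> Weq M X (FOb G ?Z)"
    using M.two_of_three(1)[OF ob is_functorD(3)[OF G Z(1)] wH phi_Hom[OF ob(2) Z(1) rH] w] weq_iff[OF X(2) Z(2) rH] Z(3)
    by blast
  then have "Comp N (FOb F X) (FOb F Y) ?Z ?r (FArr F X Y w) \<in> Weq N (FOb F X) ?Z"
    using phi_pre[OF ob(2,1) Z(1) wH rH] weq_iff[OF X(1) Z(2) N.cat_simps(2)[OF Fob Z(1) Fw rH]] by simp
  then show ?thesis using N.two_of_three(3)[OF Fob Z(1) Fw rH Z(3)] by blast
qed

lemma G_weq:
  assumes X: "fibrant N X" "fibrant N Y" and w: "w \<in> Weq N X Y"
  shows "FArr G X Y w \<in> Weq M (FOb G X) (FOb G Y)"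
proof -
  note ob = X[THEN N.fibrant_Ob]
  note wH = N.arrows(1)[OF ob w] and Gob = is_functorD(3)[OF G ob(1)] is_functorD(3)[OF G ob(2)]
  note Gw = is_functorD(4)[OF G ob wH]
  obtain Qq q where Q: "is_functor M M Qq" and q: "\<forall>X\<in>Ob M. q X \<in> Fib M (FOb Qq X) X \<and> q X \<in> Weq M (FOb Qq X) X \<and> cofibrant M (FOb Qq X)"
    using M.cofibrant_replacement by blast
  let ?Z = "FOb Qq (FOb G X)" and ?q = "q (FOb G X)"
  have Z: "?Z \<in> Ob M" "cofibrant M ?Z" "?q \<in> Weq M ?Z (FOb G X)"
    using q Gob is_functorD(3)[OF Q] by auto
  note qH = M.arrows(1)[OF Z(1) Gob(1) Z(3)]
  obtain e where e: "e \<in> Hom N (FOb F ?Z) X" "\<phi> ?Z X e = ?q" using phi_surj[OF Z(1) ob(1) qH] by blast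
  have FZ: "FOb F ?Z \<in> Ob N" using is_functorD(3)[OF F Z(1)] .
  have "Comp N (FOb F ?Z) X Y w e \<in> Weq N (FOb F ?Z) Y"
    using N.two_of_three(1)[OF FZ ob e(1) wH _ w] weq_iff[OF Z(2) X(1) e(1)] e(2) Z(3) by simp
  then have "Comp M ?Z (FOb G X) (FOb G Y) (FArr G X Y w) ?q \<in> Weq M ?Z (FOb G Y)"
    using phi_post[OF Z(1) ob e(1) wH] weq_iff[OF Z(2) X(2) N.cat_simps(2)[OF FZ ob e(1) wH]] e(2) by simp
  then show ?thesis using M.two_of_three(2)[OF Z(1) Gob qH Gw Z(3)] by blast
qed

text \<open>
  The two functors are \<open>R F\<close> and \<open>Q G\<close>, where \<open>R\<close> and \<open>Q\<close> are fibrant and cofibrant replacement. They are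
  inverse to each other after localisation because of the natural weak equivalences
  \<open>X \<leftarrow> Q X \<rightarrow> Q G R F X\<close> and \<open>R F Q G Y \<rightarrow> R Y \<leftarrow> Y\<close>. The arrows that are not replacement maps come from
  the transpose \<open>\<eta> : X \<rightarrow> G R F X\<close> of \<open>F X \<rightarrow> R F X\<close> and the transpose \<open>\<epsilon> : F Q G Y \<rightarrow> Y\<close> of \<open>Q G Y \<rightarrow> G Y\<close>.
  All objects in these zigzags are cofibrant and fibrant.
\<close>

theorem derived_equivalences:
  "\<exists>F' G'. ho_equivalence (cf_subcat M) (cf_subcat N) F' \<and> ho_equivalence (cf_subcat N) (cf_subcat M) G'"
proof -
  obtain Qq q where Q: "is_functor M M Qq"
    and q: "\<And>X. X \<in> Ob M \<Longrightarrow> q X \<in> Fib M (FOb Qq X) X" "\<And>X. X \<in> Ob M \<Longrightarrow> q X \<in> Weq M (FOb Qq X) X"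
      "\<And>X. X \<in> Ob M \<Longrightarrow> cofibrant M (FOb Qq X)"
    and qnat: "\<And>X Y f. X \<in> Ob M \<Longrightarrow> Y \<in> Ob M \<Longrightarrow> f \<in> Hom M X Y \<Longrightarrow>
       Comp M (FOb Qq X) (FOb Qq Y) Y (q Y) (FArr Qq X Y f) = Comp M (FOb Qq X) X Y f (q X)"
    using M.cofibrant_replacement by blast
  obtain Rr r where R: "is_functor N N Rr"
    and r: "\<And>X. X \<in> Ob N \<Longrightarrow> r X \<in> Cof N X (FOb Rr X)" "\<And>X. X \<in> Ob N \<Longrightarrow> r X \<in> Weq N X (FOb Rr X)"
      "\<And>X. X \<in> Ob N \<Longrightarrow> fibrant N (FOb Rr X)"
    and rnat: "\<And>X Y f. X \<in> Ob N \<Longrightarrow> Y \<in> Ob N \<Longrightarrow> f \<in> Hom N X Y \<Longrightarrow>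
       Comp N X Y (FOb Rr Y) (r Y) f = Comp N X (FOb Rr X) (FOb Rr Y) (FArr Rr X Y f) (r X)"
    using N.fibrant_replacement by blast
  note Fob = is_functorD(3)[OF F] and Far = is_functorD(4)[OF F] and Gob = is_functorD(3)[OF G] and Gar = is_functorD(4)[OF G]
    and Qob = is_functorD(3)[OF Q] and Qar = is_functorD(4)[OF Q] and Rob = is_functorD(3)[OF R] and Rar = is_functorD(4)[OF R]
  note cof = M.cofibrant_Ob N.cofibrant_Ob and fib = M.fibrant_Ob N.fibrant_Ob
  have qH: "q X \<in> Hom M (FOb Qq X) X" if "X \<in> Ob M" for X using M.arrows(1) q(2) that Qob by blast
  have rH: "r X \<in> Hom N X (FOb Rr X)" if "X \<in> Ob N" for X using N.arrows(1) r(2) that Rob by blast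
  have Q_weq: "FArr Qq X Y w \<in> Weq M (FOb Qq X) (FOb Qq Y)" if ob: "X \<in> Ob M" "Y \<in> Ob M" and w: "w \<in> Weq M X Y" for X Y w
    using M.two_of_three(3)[OF Qob[OF ob(1)] Qob[OF ob(2)] ob(2) Qar[OF ob M.arrows(1)[OF ob w]] qH[OF ob(2)] q(2)[OF ob(2)]]
      M.two_of_three(1)[OF Qob[OF ob(1)] ob qH[OF ob(1)] M.arrows(1)[OF ob w] q(2)[OF ob(1)] w]
      qnat[OF ob M.arrows(1)[OF ob w]] by simp
  have R_weq: "FArr Rr X Y w \<in> Weq N (FOb Rr X) (FOb Rr Y)" if ob: "X \<in> Ob N" "Y \<in> Ob N" and w: "w \<in> Weq N X Y" for X Y w
    using N.two_of_three(2)[OF ob(1) Rob[OF ob(1)] Rob[OF ob(2)] rH[OF ob(1)] Rar[OF ob N.arrows(1)[OF ob w]] r(2)[OF ob(1)]]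
      N.two_of_three(1)[OF ob Rob[OF ob(2)] N.arrows(1)[OF ob w] rH[OF ob(2)] w r(2)[OF ob(2)]]
      rnat[OF ob N.arrows(1)[OF ob w]] by simp
  have Q_fib: "fibrant M X \<Longrightarrow> fibrant M (FOb Qq X)" for X
    using M.fibrant_fib q(1) fib Qob by blast
  have R_cof: "cofibrant N X \<Longrightarrow> cofibrant N (FOb Rr X)" for X
    using N.cofibrant_cof r(1) cof Rob by blast
  let ?C = "cf_subcat M" and ?D = "cf_subcat N"
  let ?F = "comp_fctr Rr F" and ?G = "comp_fctr Qq G"
  have F': "is_functor ?C ?D ?F"
    by (rule M.is_functor_cf[OF N.model_axioms is_functor_comp[OF F R]])
      (use r(3) R_cof F_cofibrant Fob cof in simp)
  have G': "is_functor ?D ?C ?G"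
    by (rule N.is_functor_cf[OF M.model_axioms is_functor_comp[OF G Q]])
      (use q(3) Q_fib G_fibrant Gob fib in simp)
  have Q': "is_functor ?C ?C Qq"
    by (rule M.is_functor_cf[OF M.model_axioms Q]) (use q(3) Q_fib fib in simp)
  have R': "is_functor ?D ?D Rr"
    by (rule N.is_functor_cf[OF N.model_axioms R]) (use r(3) R_cof cof in simp)
  have F_pres: "preserves_weq ?C ?D ?F"
    using F_weq R_weq Fob cof by (simp add: preserves_weq_def M.cf_simps N.cf_simps)
  have G_pres: "preserves_weq ?D ?C ?G"
    using G_weq Q_weq Gob fib by (simp add: preserves_weq_def M.cf_simps N.cf_simps)
  note relM = M.relative_category_cf and relN = N.relative_category_cf
  define \<eta> where "\<eta> X = \<phi> X (FOb Rr (FOb F X)) (r (FOb F X))" for X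
  have \<eta>H: "\<eta> X \<in> Hom M X (FOb G (FOb Rr (FOb F X)))" if "X \<in> Ob M" for X
    unfolding \<eta>_def using phi_Hom that Fob Rob rH by blast
  have \<eta>w: "\<eta> X \<in> Weq M X (FOb G (FOb Rr (FOb F X)))" if "cofibrant M X" for X
    unfolding \<eta>_def using weq_iff[OF that r(3) rH] r(2) that Fob cof by simp
  have \<eta>nat: "Comp M X Y (FOb G (FOb Rr (FOb F Y))) (\<eta> Y) f =
      Comp M X (FOb G (FOb Rr (FOb F X))) (FOb G (FOb Rr (FOb F Y)))
        (FArr G (FOb Rr (FOb F X)) (FOb Rr (FOb F Y)) (FArr Rr (FOb F X) (FOb F Y) (FArr F X Y f))) (\<eta> X)"
    if X: "X \<in> Ob M" "Y \<in> Ob M" and f: "f \<in> Hom M X Y" for X Y f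
    unfolding \<eta>_def
    using phi_pre[OF X(2,1) Rob[OF Fob[OF X(2)]] f rH[OF Fob[OF X(2)]]]
      phi_post[OF X(1) Rob[OF Fob[OF X(1)]] Rob[OF Fob[OF X(2)]] rH[OF Fob[OF X(1)]]
        Rar[OF Fob[OF X(1)] Fob[OF X(2)] Far[OF X f]]]
      rnat[OF Fob[OF X(1)] Fob[OF X(2)] Far[OF X f]] by simp
  define \<epsilon> where "\<epsilon> Y = (SOME e. e \<in> Hom N (FOb F (FOb Qq (FOb G Y))) Y \<and> \<phi> (FOb Qq (FOb G Y)) Y e = q (FOb G Y))" for Y
  have \<epsilon>: "\<epsilon> Y \<in> Hom N (FOb F (FOb Qq (FOb G Y))) Y" "\<phi> (FOb Qq (FOb G Y)) Y (\<epsilon> Y) = q (FOb G Y)" if "Y \<in> Ob N" for Y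
  proof -
    have "\<exists>e. e \<in> Hom N (FOb F (FOb Qq (FOb G Y))) Y \<and> \<phi> (FOb Qq (FOb G Y)) Y e = q (FOb G Y)"
      using phi_surj[OF Qob[OF Gob[OF that]] that qH[OF Gob[OF that]]] by blast
    from someI_ex[OF this] show "\<epsilon> Y \<in> Hom N (FOb F (FOb Qq (FOb G Y))) Y" "\<phi> (FOb Qq (FOb G Y)) Y (\<epsilon> Y) = q (FOb G Y)"
      unfolding \<epsilon>_def by blast+
  qed
  have \<epsilon>w: "\<epsilon> Y \<in> Weq N (FOb F (FOb Qq (FOb G Y))) Y" if "fibrant N Y" for Y
    using weq_iff[OF q(3) that \<epsilon>(1)] q(2) \<epsilon>(2) that Gob fib by simp
  have \<epsilon>nat: "Comp N (FOb F (FOb Qq (FOb G X))) (FOb F (FOb Qq (FOb G Y))) Y (\<epsilon> Y)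
        (FArr F (FOb Qq (FOb G X)) (FOb Qq (FOb G Y)) (FArr Qq (FOb G X) (FOb G Y) (FArr G X Y f))) =
      Comp N (FOb F (FOb Qq (FOb G X))) X Y f (\<epsilon> X)"
    if X: "X \<in> Ob N" "Y \<in> Ob N" and f: "f \<in> Hom N X Y" for X Y f
  proof -
    let ?X = "FOb Qq (FOb G X)" and ?Y = "FOb Qq (FOb G Y)" and ?f = "FArr Qq (FOb G X) (FOb G Y) (FArr G X Y f)"
    have ob: "?X \<in> Ob M" "?Y \<in> Ob M" using X Gob Qob by auto
    have h: "?f \<in> Hom M ?X ?Y" using X f Gob Gar Qar by blast
    show ?thesis
    proof (rule phi_inj[OF ob(1) X(2)])
      show "Comp N (FOb F ?X) (FOb F ?Y) Y (\<epsilon> Y) (FArr F ?X ?Y ?f) \<in> Hom N (FOb F ?X) Y"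
        by (rule N.cat_simps(2)[OF Fob[OF ob(1)] Fob[OF ob(2)] X(2) Far[OF ob h] \<epsilon>(1)[OF X(2)]])
      show "Comp N (FOb F ?X) X Y f (\<epsilon> X) \<in> Hom N (FOb F ?X) Y"
        by (rule N.cat_simps(2)[OF Fob[OF ob(1)] X \<epsilon>(1)[OF X(1)] f])
      show "\<phi> ?X Y (Comp N (FOb F ?X) (FOb F ?Y) Y (\<epsilon> Y) (FArr F ?X ?Y ?f)) = \<phi> ?X Y (Comp N (FOb F ?X) X Y f (\<epsilon> X))"
        using phi_pre[OF ob(2,1) X(2) h \<epsilon>(1)[OF X(2)]] phi_post[OF ob(1) X \<epsilon>(1)[OF X(1)] f] \<epsilon>(2) X
          qnat[OF Gob[OF X(1)] Gob[OF X(2)] Gar[OF X f]] by simp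
    qed
  qed
  have "natural_weq ?C Qq id_fctr q"
    by (rule natural_weqI[OF Q' is_functor_id[OF relative_categoryD(1)[OF relM]]])
      (use qH qnat q(2) cof in \<open>simp_all add: M.cf_simps\<close>)
  moreover have "natural_weq ?C Qq (comp_fctr ?G ?F) (\<lambda>X. FArr Qq X (FOb G (FOb Rr (FOb F X))) (\<eta> X))"
  proof (rule natural_weqI[OF Q' is_functor_comp[OF F' G']])
    fix X assume "X \<in> Ob ?C"
    then have X: "cofibrant M X" "X \<in> Ob M" using cof by (simp_all add: M.cf_simps)
    note Z = Gob[OF Rob[OF Fob[OF X(2)]]]
    show "FArr Qq X (FOb G (FOb Rr (FOb F X))) (\<eta> X) \<in> Hom ?C (FOb Qq X) (FOb (comp_fctr ?G ?F) X)"
      using Qar[OF X(2) Z \<eta>H[OF X(2)]] by (simp add: M.cf_simps)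
    show "FArr Qq X (FOb G (FOb Rr (FOb F X))) (\<eta> X) \<in> Weq ?C (FOb Qq X) (FOb (comp_fctr ?G ?F) X)"
      using Q_weq[OF X(2) Z \<eta>w[OF X(1)]] by (simp add: M.cf_simps)
  next
    fix X Y f assume "X \<in> Ob ?C" "Y \<in> Ob ?C" "f \<in> Hom ?C X Y"
    then have X: "X \<in> Ob M" "Y \<in> Ob M" and f: "f \<in> Hom M X Y" using cof by (simp_all add: M.cf_simps)
    note RF = Rob[OF Fob[OF X(1)]] Rob[OF Fob[OF X(2)]]
    note Z = Gob[OF RF(1)] Gob[OF RF(2)]
    note h = Gar[OF RF Rar[OF Fob[OF X(1)] Fob[OF X(2)] Far[OF X f]]]
    show "Comp ?C (FOb Qq X) (FOb Qq Y) (FOb (comp_fctr ?G ?F) Y) (FArr Qq Y (FOb G (FOb Rr (FOb F Y))) (\<eta> Y)) (FArr Qq X Y f) =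
        Comp ?C (FOb Qq X) (FOb (comp_fctr ?G ?F) X) (FOb (comp_fctr ?G ?F) Y) (FArr (comp_fctr ?G ?F) X Y f)
          (FArr Qq X (FOb G (FOb Rr (FOb F X))) (\<eta> X))"
      using is_functorD(6)[OF Q X Z(2) f \<eta>H[OF X(2)]] is_functorD(6)[OF Q X(1) Z \<eta>H[OF X(1)] h] \<eta>nat[OF X f]
      by (simp add: M.cf_simps)
  qed
  ultimately have C: "ho_natural_iso ?C id_fctr (comp_fctr ?G ?F)"
    using ho_natural_iso_trans[OF ho_natural_iso_sym] natural_weq_ho_natural_iso[OF relM] by blast
  have "natural_weq ?D id_fctr Rr r"
    by (rule natural_weqI[OF is_functor_id[OF relative_categoryD(1)[OF relN]] R'])
      (use rH rnat r(2) fib in \<open>simp_all add: N.cf_simps\<close>)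
  moreover have "natural_weq ?D (comp_fctr ?F ?G) Rr (\<lambda>Y. FArr Rr (FOb F (FOb Qq (FOb G Y))) Y (\<epsilon> Y))"
  proof (rule natural_weqI[OF is_functor_comp[OF G' F'] R'])
    fix Y assume "Y \<in> Ob ?D"
    then have Y: "fibrant N Y" "Y \<in> Ob N" using fib by (simp_all add: N.cf_simps)
    note Z = Fob[OF Qob[OF Gob[OF Y(2)]]]
    show "FArr Rr (FOb F (FOb Qq (FOb G Y))) Y (\<epsilon> Y) \<in> Hom ?D (FOb (comp_fctr ?F ?G) Y) (FOb Rr Y)"
      using Rar[OF Z Y(2) \<epsilon>(1)[OF Y(2)]] by (simp add: N.cf_simps)
    show "FArr Rr (FOb F (FOb Qq (FOb G Y))) Y (\<epsilon> Y) \<in> Weq ?D (FOb (comp_fctr ?F ?G) Y) (FOb Rr Y)"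
      using R_weq[OF Z Y(2) \<epsilon>w[OF Y(1)]] by (simp add: N.cf_simps)
  next
    fix X Y f assume "X \<in> Ob ?D" "Y \<in> Ob ?D" "f \<in> Hom ?D X Y"
    then have X: "X \<in> Ob N" "Y \<in> Ob N" and f: "f \<in> Hom N X Y" using fib by (simp_all add: N.cf_simps)
    note QG = Qob[OF Gob[OF X(1)]] Qob[OF Gob[OF X(2)]]
    note Z = Fob[OF QG(1)] Fob[OF QG(2)]
    note h = Far[OF QG Qar[OF Gob[OF X(1)] Gob[OF X(2)] Gar[OF X f]]]
    show "Comp ?D (FOb (comp_fctr ?F ?G) X) (FOb (comp_fctr ?F ?G) Y) (FOb Rr Y)
          (FArr Rr (FOb F (FOb Qq (FOb G Y))) Y (\<epsilon> Y)) (FArr (comp_fctr ?F ?G) X Y f) =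
        Comp ?D (FOb (comp_fctr ?F ?G) X) (FOb Rr X) (FOb Rr Y) (FArr Rr X Y f)
          (FArr Rr (FOb F (FOb Qq (FOb G X))) X (\<epsilon> X))"
      using is_functorD(6)[OF R Z X(2) h \<epsilon>(1)[OF X(2)]] is_functorD(6)[OF R Z(1) X \<epsilon>(1)[OF X(1)] f] \<epsilon>nat[OF X f]
      by (simp add: N.cf_simps)
  qed
  ultimately have D: "ho_natural_iso ?D id_fctr (comp_fctr ?F ?G)"
    using ho_natural_iso_trans ho_natural_iso_sym natural_weq_ho_natural_iso[OF relN] by blast
  show ?thesis
    using ho_equivalence_inverse[OF relM M.unit_full_cf relN N.unit_full_cf F' F_pres G' G_pres C D]
      ho_equivalence_inverse[OF relN N.unit_full_cf relM M.unit_full_cf G' G_pres F' F_pres D C] by blast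
qed

end

lemma quillen_step_ho_equivalence:
  assumes "quillen_step U M N"
  shows "\<exists>F. ho_equivalence (cf_subcat M) (cf_subcat N) F"
  using assms quillen.derived_equivalences[OF quillen.intro] unfolding quillen_step_def by metis

lemma quillen_zigzag_ho_equivalence:
  assumes "quillen_zigzag U M Ps N"
  shows "\<exists>F. ho_equivalence (cf_subcat M) (cf_subcat N) F"
proof (cases "Ps = []")
  case True
  then show ?thesis using assms quillen_step_ho_equivalence by (auto simp: quillen_zigzag_def)
next
  case False
  have "\<exists>F. ho_equivalence (cf_subcat (hd Ps)) (cf_subcat N) F"
    if "Ps \<noteq> []" "successively (quillen_step U) Ps" "quillen_step U (last Ps) N"
    using that
  proof (induction Ps rule: induct_list012)
    case (2 P)
    then show ?case using quillen_step_ho_equivalence by simp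
  next
    case (3 P P' Ps)
    then obtain F G where "ho_equivalence (cf_subcat P) (cf_subcat P') F" "ho_equivalence (cf_subcat P') (cf_subcat N) G"
      using quillen_step_ho_equivalence[of U P P'] by fastforce
    then have "ho_equivalence (cf_subcat P) (cf_subcat N) (comp_fctr G F)" by (rule ho_equivalence_trans)
    then show ?case by auto
  qed simp
  then obtain F G where "ho_equivalence (cf_subcat M) (cf_subcat (hd Ps)) F" "ho_equivalence (cf_subcat (hd Ps)) (cf_subcat N) G"
    using assms False quillen_step_ho_equivalence[of U M "hd Ps"] by (auto simp: quillen_zigzag_def)
  then show ?thesis using ho_equivalence_trans by blast
qed

section \<open>The fundamental category of a product\<close>

lemma sHomD:
  assumes "f \<in> sHom X Y"
  shows "x \<in> Simp X n \<Longrightarrow> f n x \<in> Simp Y n"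
    and "\<theta> \<in> Delta m n \<Longrightarrow> x \<in> Simp X n \<Longrightarrow> f m (Act X m n \<theta> x) = Act Y m n \<theta> (f n x)"
    and "x \<notin> Simp X n \<Longrightarrow> f n x = undefined"
proof -
  have "f n \<in> Simp X n \<rightarrow>\<^sub>E Simp Y n" for n using assms by (simp add: sHom_def)
  then show "x \<in> Simp X n \<Longrightarrow> f n x \<in> Simp Y n" "x \<notin> Simp X n \<Longrightarrow> f n x = undefined"
    by (auto simp: PiE_def extensional_def)
  show "\<theta> \<in> Delta m n \<Longrightarrow> x \<in> Simp X n \<Longrightarrow> f m (Act X m n \<theta> x) = Act Y m n \<theta> (f n x)"
    using assms by (simp add: sHom_def)
qed

lemma sHomI:
  assumes "\<And>n x. x \<in> Simp X n \<Longrightarrow> f n x \<in> Simp Y n"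
    and "\<And>n x. x \<notin> Simp X n \<Longrightarrow> f n x = undefined"
    and "\<And>m n \<theta> x. \<theta> \<in> Delta m n \<Longrightarrow> x \<in> Simp X n \<Longrightarrow> f m (Act X m n \<theta> x) = Act Y m n \<theta> (f n x)"
  shows "f \<in> sHom X Y"
  using assms by (auto simp: sHom_def PiE_def extensional_def)

lemma sHom_eqI:
  assumes "f \<in> sHom X Y" "g \<in> sHom X Z" "\<And>n x. x \<in> Simp X n \<Longrightarrow> f n x = g n x"
  shows "f = g"
proof (intro ext)
  fix n x show "f n x = g n x"
    using assms(3) sHomD(3)[OF assms(1)] sHomD(3)[OF assms(2)] by (cases "x \<in> Simp X n") auto
qed

lemma scomp_apply: "x \<in> Simp X n \<Longrightarrow> scomp X g f n x = g n (f n x)"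
  by (simp add: scomp_def compose_def)

lemma sid_apply: "x \<in> Simp X n \<Longrightarrow> sid X n x = x"
  by (simp add: sid_def)

lemma sid_sHom: "simplicial_set X \<Longrightarrow> sid X \<in> sHom X X"
  by (rule sHomI) (auto simp: sid_def Act_in)

lemma scomp_sHom: "simplicial_set X \<Longrightarrow> f \<in> sHom X Y \<Longrightarrow> g \<in> sHom Y Z \<Longrightarrow> scomp X g f \<in> sHom X Z"
  by (rule sHomI) (auto simp: scomp_def compose_def Act_in sHomD)

subsection \<open>Arrows of the fundamental category\<close>

text \<open>
  The generator of the fundamental category given by an edge.
\<close>

definition tedge :: "'a sset \<Rightarrow> 'a \<Rightarrow> ('a \<times> 'a \<times> 'a) list set" where
  "tedge X e = path_class (tau1_pres X) (svert X 1 0 e) (svert X 1 1 e) [(svert X 1 0 e, e, svert X 1 1 e)]"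

lemma Ob_tau1 [simp]: "Ob (tau1 X) = Simp X 0"
  by (simp add: tau1_def presented_cat_simps tau1_pres_def)

lemma category_tau1: "category (tau1 X)"
  by (simp add: tau1_def category_presented_cat)

lemma sedge_edge:
  assumes X: "simplicial_set X" and x: "x \<in> Simp X n" and ij: "i \<le> j" "j \<le> n"
  shows "Act X 1 n (edg i j) x \<in> Simp X 1"
    and "svert X 1 0 (Act X 1 n (edg i j) x) = svert X n i x"
    and "svert X 1 1 (Act X 1 n (edg i j) x) = svert X n j x"
    and "tedge X (Act X 1 n (edg i j) x) = eclass X n i j x"
proof -
  show "Act X 1 n (edg i j) x \<in> Simp X 1" using Act_in[OF X edg_Delta[OF ij] x] .
  show 1: "svert X 1 0 (Act X 1 n (edg i j) x) = svert X n i x" "svert X 1 1 (Act X 1 n (edg i j) x) = svert X n j x"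
    using svert_Act[OF X edg_Delta[OF ij] x, of 0] svert_Act[OF X edg_Delta[OF ij] x, of 1] by (simp_all add: edg_def)
  show "tedge X (Act X 1 n (edg i j) x) = eclass X n i j x"
    unfolding tedge_def sedge_def 1 ..
qed

lemma tedge_path:
  assumes X: "simplicial_set X" and e: "e \<in> Simp X 1"
  shows "is_path (tau1_pres X) (svert X 1 0 e) [(svert X 1 0 e, e, svert X 1 1 e)] (svert X 1 1 e)"
  using sedge_path[OF X e, of 0 1] sedge_01[OF X e] by simp

lemma tedge_Hom:
  assumes X: "simplicial_set X" and e: "e \<in> Simp X 1"
  shows "tedge X e \<in> Hom (tau1 X) (svert X 1 0 e) (svert X 1 1 e)"
  using tedge_path[OF assms] by (simp add: tau1_def presented_cat_simps tedge_def)

lemma tedge_triangle: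
  assumes X: "simplicial_set X" and s: "s \<in> Simp X 2"
  shows "tedge X (Act X 1 2 (edg 0 2) s) = Comp (tau1 X) (svert X 2 0 s) (svert X 2 1 s) (svert X 2 2 s)
    (tedge X (Act X 1 2 (edg 1 2) s)) (tedge X (Act X 1 2 (edg 0 1) s))"
  using sedge_edge(4)[OF X s, of 0 2] sedge_edge(4)[OF X s, of 0 1] sedge_edge(4)[OF X s, of 1 2]
    eclass_trans[OF X s, of 0 1 2] presented_Comp[OF sedge_path[OF X s, of 0 1] sedge_path[OF X s, of 1 2]]
  by (simp add: tau1_def)

lemma tau1_induct [consumes 2, case_names Id edge]:
  assumes X: "simplicial_set X" and c: "c \<in> Hom (tau1 X) x y"
    and Id: "\<And>x. x \<in> Simp X 0 \<Longrightarrow> P x x (Id (tau1 X) x)"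
    and edge: "\<And>e y c. e \<in> Simp X 1 \<Longrightarrow> y \<in> Simp X 0 \<Longrightarrow> c \<in> Hom (tau1 X) (svert X 1 1 e) y \<Longrightarrow>
      P (svert X 1 1 e) y c \<Longrightarrow>
      P (svert X 1 0 e) y (Comp (tau1 X) (svert X 1 0 e) (svert X 1 1 e) y c (tedge X e))"
  shows "P x y c"
proof -
  have "P x y (path_class (tau1_pres X) x y p)" if "is_path (tau1_pres X) x p y" for p x
    using that
  proof (induction p arbitrary: x)
    case Nil
    then show ?case using Id[of x] by (auto simp: tau1_def presented_cat_simps tau1_pres_def)
  next
    case (Cons t p)
    obtain a e b where t: "t = (a, e, b)" by (cases t)
    have *: "e \<in> Simp X 1" "svert X 1 0 e = x" "svert X 1 1 e = b" "a = x" "is_path (tau1_pres X) b p y"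
      using Cons.prems by (auto simp: t tau1_pres_def)
    have y: "y \<in> Simp X 0" using is_path_Verts[OF *(5)] by (simp add: tau1_pres_def)
    have "path_class (tau1_pres X) x y (t # p) =
        Comp (tau1 X) x b y (path_class (tau1_pres X) b y p) (tedge X e)"
      using presented_Comp[OF tedge_path[OF X *(1), unfolded *] *(5)] * by (simp add: t tau1_def tedge_def)
    then show ?case
      using edge[OF *(1) y, of "path_class (tau1_pres X) b y p"] Cons.IH[OF *(5)] *
      by (simp add: tau1_def presented_cat_simps)
  qed
  then show ?thesis using c by (auto simp: tau1_def presented_cat_simps)
qed

lemma tau1_Hom_Ob: "c \<in> Hom (tau1 X) x y \<Longrightarrow> x \<in> Simp X 0 \<and> y \<in> Simp X 0"
  using is_path_Verts[of "tau1_pres X"] by (auto simp: tau1_def presented_cat_simps tau1_pres_def)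

lemma is_path_map:
  assumes f0: "\<And>x. x \<in> Verts P \<Longrightarrow> f0 x \<in> Verts Q"
    and f1: "\<And>x y e. x \<in> Verts P \<Longrightarrow> y \<in> Verts P \<Longrightarrow> e \<in> Edges P x y \<Longrightarrow> f1 x y e \<in> Edges Q (f0 x) (f0 y)"
    and p: "is_path P x p y"
  shows "is_path Q (f0 x) (map (\<lambda>(a, e, b). (f0 a, f1 a b e, f0 b)) p) (f0 y)"
  using p
proof (induction p arbitrary: x)
  case Nil
  then show ?case by (auto simp: f0)
next
  case (Cons t p)
  obtain a e b where t: "t = (a, e, b)" by (cases t)
  show ?case using Cons is_path_Verts[of P b p y] by (auto simp: f0 f1 t)
qed

lemma svert_sHom: "f \<in> sHom X Y \<Longrightarrow> i \<le> n \<Longrightarrow> x \<in> Simp X n \<Longrightarrow> svert Y n i (f n x) = f 0 (svert X n i x)"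
  unfolding svert_def using sHomD(2)[OF _ vtx_Delta] by metis

lemma edge_sHom:
  "f \<in> sHom X Y \<Longrightarrow> i \<le> j \<Longrightarrow> j \<le> n \<Longrightarrow> x \<in> Simp X n \<Longrightarrow> Act Y 1 n (edg i j) (f n x) = f 1 (Act X 1 n (edg i j) x)"
  using sHomD(2)[OF _ edg_Delta] by metis

lemma
  assumes X: "simplicial_set X" and Y: "simplicial_set Y" and f: "f \<in> sHom X Y"
  shows is_functor_tau1: "is_functor (tau1 X) (tau1 Y) (tau1_functor Y f)"
    and tau1_tedge: "e \<in> Simp X 1 \<Longrightarrow> FArr (tau1_functor Y f) (svert X 1 0 e) (svert X 1 1 e) (tedge X e) = tedge Y (f 1 e)"
proof -
  let ?P = "tau1_pres X" and ?Q = "tau1_pres Y"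
  let ?m = "map (\<lambda>(a, e, b). (f 0 a, (\<lambda>_ _. f 1) a b e, f 0 b))"
  have 1: "f 0 x \<in> Verts ?Q" if "x \<in> Verts ?P" for x
    using that sHomD(1)[OF f] by (simp add: tau1_pres_def)
  have 2: "(\<lambda>_ _. f 1) x y e \<in> Edges ?Q (f 0 x) (f 0 y)" if "x \<in> Verts ?P" "y \<in> Verts ?P" "e \<in> Edges ?P x y" for x y e
    using that sHomD(1)[OF f] svert_sHom[OF f, of 0 1 e] svert_sHom[OF f, of 1 1 e] by (simp add: tau1_pres_def)
  have se: "(\<lambda>(a, e, b). (f 0 a, (\<lambda>_ _. f 1) a b e, f 0 b)) (sedge X n i j x) = sedge Y n i j (f n x)"
    if "x \<in> Simp X n" "i \<le> j" "j \<le> n" for n i j x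
    using that svert_sHom[OF f, of i n x] svert_sHom[OF f, of j n x] edge_sHom[OF f, of i j n x]
    by (simp add: sedge_def)
  have 3: "path_eq ?Q (f 0 x) (f 0 y) (?m p) (?m q)"
    if p: "is_path ?P x p y" and q: "is_path ?P x q y" and r: "Rels ?P p q" for x y p q
  proof (rule path_eq.rel)
    show "is_path ?Q (f 0 x) (?m p) (f 0 y)" "is_path ?Q (f 0 x) (?m q) (f 0 y)"
      using is_path_map[where ?f0.0 = "f 0" and ?f1.0 = "\<lambda>_ _. f 1" and P = ?P and Q = ?Q, OF 1 2] p q by blast+
    have "tau1_rel X p q" using r by (simp add: tau1_pres_def)
    then have "tau1_rel Y (?m p) (?m q)"
    proof cases
      case (degenerate x)
      then show ?thesis using tau1_rel.degenerate[of "f 0 x" Y] sHomD(1)[OF f] se[of x 0 0 0] by simp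
    next
      case (triangle s)
      then show ?thesis
        using tau1_rel.triangle[of "f 2 s" Y] sHomD(1)[OF f] se[of s 2 0 1] se[of s 2 1 2] se[of s 2 0 2] by simp
    qed
    then show "Rels ?Q (?m p) (?m q)" by (simp add: tau1_pres_def)
  qed
  note pf = is_functor_presented_functor[of ?P "f 0" ?Q "\<lambda>_ _. f 1", OF 1 2 3]
  show "is_functor (tau1 X) (tau1 Y) (tau1_functor Y f)"
    unfolding tau1_def tau1_functor_def by (rule pf(1))
  show "FArr (tau1_functor Y f) (svert X 1 0 e) (svert X 1 1 e) (tedge X e) = tedge Y (f 1 e)" if e: "e \<in> Simp X 1"
  proof -
    have "FArr (presented_functor ?Q (f 0) (\<lambda>_ _. f 1)) (svert X 1 0 e) (svert X 1 1 e) (tedge X e) =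
        path_class ?Q (f 0 (svert X 1 0 e)) (f 0 (svert X 1 1 e)) (?m [(svert X 1 0 e, e, svert X 1 1 e)])"
      unfolding tedge_def by (rule pf(2), assumption+, rule tedge_path[OF X e])
    then show ?thesis
      using svert_sHom[OF f, of 0 1 e] svert_sHom[OF f, of 1 1 e] e by (simp add: tau1_functor_def tedge_def)
  qed
qed

lemma FOb_tau1_functor [simp]: "FOb (tau1_functor Y f) = f 0"
  by (simp add: tau1_functor_def presented_functor_def)

lemma tau1_functors_agree:
  assumes X: "simplicial_set X" and F: "is_functor (tau1 X) D F" and G: "is_functor (tau1 X) D G"
    and ob: "\<And>x. x \<in> Simp X 0 \<Longrightarrow> FOb F x = FOb G x"
    and ed: "\<And>e. e \<in> Simp X 1 \<Longrightarrow> FArr F (svert X 1 0 e) (svert X 1 1 e) (tedge X e) =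
      FArr G (svert X 1 0 e) (svert X 1 1 e) (tedge X e)"
    and c: "c \<in> Hom (tau1 X) x y"
  shows "FArr F x y c = FArr G x y c"
  by (rule presented_functors_agree[OF F[unfolded tau1_def] G[unfolded tau1_def] _ _ c[unfolded tau1_def]])
    (use ob ed in \<open>auto simp: tau1_pres_def tedge_def\<close>)

lemma tau1_scomp:
  assumes X: "simplicial_set X" and Y: "simplicial_set Y" and Z: "simplicial_set Z"
    and f: "f \<in> sHom X Y" and g: "g \<in> sHom Y Z" and c: "c \<in> Hom (tau1 X) x y"
  shows "FArr (tau1_functor Z (scomp X g f)) x y c =
    FArr (tau1_functor Z g) (f 0 x) (f 0 y) (FArr (tau1_functor Y f) x y c)"
proof -
  note fg = is_functor_comp[OF is_functor_tau1[OF X Y f] is_functor_tau1[OF Y Z g]]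
  note gf = scomp_sHom[OF X f g]
  have "FArr (tau1_functor Z (scomp X g f)) x y c = FArr (comp_fctr (tau1_functor Z g) (tau1_functor Y f)) x y c"
  proof (rule tau1_functors_agree[OF X is_functor_tau1[OF X Z gf] fg _ _ c])
    fix e assume e: "e \<in> Simp X 1"
    show "FArr (tau1_functor Z (scomp X g f)) (svert X 1 0 e) (svert X 1 1 e) (tedge X e) =
      FArr (comp_fctr (tau1_functor Z g) (tau1_functor Y f)) (svert X 1 0 e) (svert X 1 1 e) (tedge X e)"
      using tau1_tedge[OF X Z gf e] tau1_tedge[OF X Y f e] tau1_tedge[OF Y Z g sHomD(1)[OF f e]]
        svert_sHom[OF f, of 0 1 e] svert_sHom[OF f, of 1 1 e] e
      by (simp add: scomp_apply)
  qed (simp add: scomp_apply)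
  then show ?thesis by simp
qed

lemma tau1_sid:
  assumes X: "simplicial_set X" and c: "c \<in> Hom (tau1 X) x y"
  shows "FArr (tau1_functor X (sid X)) x y c = c"
proof -
  have "FArr (tau1_functor X (sid X)) x y c = FArr id_fctr x y c"
    by (rule tau1_functors_agree[OF X is_functor_tau1[OF X X sid_sHom[OF X]] is_functor_id[OF category_tau1] _ _ c])
      (use tau1_tedge[OF X X sid_sHom[OF X]] in \<open>simp_all add: sid_apply\<close>)
  then show ?thesis by simp
qed

subsection \<open>Constant simplices\<close>

definition sconst :: "'a sset \<Rightarrow> 'a \<Rightarrow> nat \<Rightarrow> 'a" where
  "sconst X v n = Act X n 0 (\<lambda>_\<in>{..n}. 0) v"

lemma Delta_0: "(\<lambda>_\<in>{..n}. 0) \<in> Delta n 0"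
  by (auto simp: Delta_def mono_on_def)

lemma
  assumes X: "simplicial_set X" and v: "v \<in> Simp X 0"
  shows sconst_in: "sconst X v n \<in> Simp X n"
    and Act_sconst: "\<theta> \<in> Delta m n \<Longrightarrow> Act X m n \<theta> (sconst X v n) = sconst X v m"
    and sconst_0: "sconst X v 0 = v"
    and tedge_sconst: "tedge X (sconst X v 1) = Id (tau1 X) v"
proof -
  show "sconst X v n \<in> Simp X n" unfolding sconst_def by (rule Act_in[OF X Delta_0 v])
  have c: "compose {..m} (\<lambda>_\<in>{..n}. 0) \<theta> = (\<lambda>_\<in>{..m}. 0)" if "\<theta> \<in> Delta m n" for \<theta> :: "nat \<Rightarrow> nat" and m n
    using Delta_le[OF that] by (auto simp: compose_def fun_eq_iff)
  show A: "Act X m n \<theta> (sconst X v n) = sconst X v m" if "\<theta> \<in> Delta m n" for \<theta> m n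
    unfolding sconst_def Act_Act[OF X that Delta_0 v] c[OF that] ..
  have "(\<lambda>_\<in>{..0::nat}. 0) = (\<lambda>i\<in>{..0}. i)" by auto
  then show 0: "sconst X v 0 = v" using Act_id[OF X v] by (simp add: sconst_def)
  have "edg 0 0 = (\<lambda>_\<in>{..1}. 0)" by (auto simp: edg_def)
  then have "tedge X (sconst X v 1) = eclass X 0 0 0 v"
    using sedge_edge(4)[OF X v, of 0 0] by (simp add: sconst_def)
  also have "\<dots> = Id (tau1 X) v"
    using eclass_refl[OF X v, of 0] svert_0[OF X v] by (simp add: tau1_def presented_cat_simps)
  finally show "tedge X (sconst X v 1) = Id (tau1 X) v" .
qed

text \<open>
  The edges of a constant simplex are degenerate, so a constant map sends every generator to an identity.
\<close>

lemma tau1_constant: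
  assumes X: "simplicial_set X" and Y: "simplicial_set Y" and f: "f \<in> sHom X Y"
    and v: "v \<in> Simp Y 0" and const: "\<And>n x. x \<in> Simp X n \<Longrightarrow> f n x = sconst Y v n"
    and c: "c \<in> Hom (tau1 X) x y"
  shows "FArr (tau1_functor Y f) x y c = Id (tau1 Y) v"
proof -
  have "FArr (tau1_functor Y f) x y c = FArr \<lparr>FOb = (\<lambda>_. v), FArr = (\<lambda>_ _ _. Id (tau1 Y) v)\<rparr> x y c"
    by (rule tau1_functors_agree[OF X is_functor_tau1[OF X Y f] _ _ _ c])
      (use v const sconst_0[OF Y v] tedge_sconst[OF Y v] tau1_tedge[OF X Y f] in
        \<open>simp_all add: is_functor_def category_tau1 categoryD[OF category_tau1]\<close>)
  then show ?thesis by simp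
qed

lemma sprod_simps:
  "Simp (sprod A B) n = Simp A n \<times> Simp B n"
  "\<theta> \<in> Delta m n \<Longrightarrow> x \<in> Simp A n \<Longrightarrow> y \<in> Simp B n \<Longrightarrow>
    Act (sprod A B) m n \<theta> (x, y) = (Act A m n \<theta> x, Act B m n \<theta> y)"
  by (simp_all add: sprod_def)

lemma svert_sprod:
  "i \<le> n \<Longrightarrow> x \<in> Simp A n \<Longrightarrow> y \<in> Simp B n \<Longrightarrow> svert (sprod A B) n i (x, y) = (svert A n i x, svert B n i y)"
  by (simp add: svert_def sprod_simps vtx_Delta)

locale sset_product =
  fixes A :: "'a sset" and B :: "'b sset"
  assumes A: "simplicial_set A" and B: "simplicial_set B"
begin

abbreviation "AB \<equiv> sprod A B"

lemma AB: "simplicial_set AB"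
  using A B by (rule simplicial_set_sprod)

text \<open>
  The slices \<open>A \<cong> A \<times> {b}\<close> and \<open>B \<cong> {a} \<times> B\<close> of the product. Being simplicial maps, they act on fundamental
  categories; these actions are written \<open>L b\<close> and \<open>R a\<close> below.
\<close>

definition inl :: "'b \<Rightarrow> ('a, 'a \<times> 'b) smap" where
  "inl b = (\<lambda>n. \<lambda>x\<in>Simp A n. (x, sconst B b n))"

definition inr :: "'a \<Rightarrow> ('b, 'a \<times> 'b) smap" where
  "inr a = (\<lambda>n. \<lambda>y\<in>Simp B n. (sconst A a n, y))"

lemma inl_sHom: "b \<in> Simp B 0 \<Longrightarrow> inl b \<in> sHom A AB"
  by (rule sHomI) (auto simp: inl_def sprod_simps sconst_in[OF B] Act_sconst[OF B] Act_in[OF A])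

lemma inr_sHom: "a \<in> Simp A 0 \<Longrightarrow> inr a \<in> sHom B AB"
  by (rule sHomI) (auto simp: inr_def sprod_simps sconst_in[OF A] Act_sconst[OF A] Act_in[OF B])

lemma sfst_sHom: "sfst A B \<in> sHom AB A" and ssnd_sHom: "ssnd A B \<in> sHom AB B"
  by (rule sHomI; auto simp: sfst_def ssnd_def sprod_simps Act_in[OF A] Act_in[OF B])+

abbreviation L where "L b \<equiv> FArr (tau1_functor AB (inl b))"
abbreviation R where "R a \<equiv> FArr (tau1_functor AB (inr a))"
abbreviation "p1 \<equiv> FArr (tau1_functor A (sfst A B))"
abbreviation "p2 \<equiv> FArr (tau1_functor B (ssnd A B))"
abbreviation "C \<equiv> tau1 AB"

lemma inl_0: "a \<in> Simp A 0 \<Longrightarrow> b \<in> Simp B 0 \<Longrightarrow> inl b 0 a = (a, b)"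
  and inr_0: "a \<in> Simp A 0 \<Longrightarrow> b \<in> Simp B 0 \<Longrightarrow> inr a 0 b = (a, b)"
  by (simp_all add: inl_def inr_def sconst_0[OF A] sconst_0[OF B])

lemma L_functor: "b \<in> Simp B 0 \<Longrightarrow> is_functor (tau1 A) C (tau1_functor AB (inl b))"
  and R_functor: "a \<in> Simp A 0 \<Longrightarrow> is_functor (tau1 B) C (tau1_functor AB (inr a))"
  using is_functor_tau1[OF A AB inl_sHom] is_functor_tau1[OF B AB inr_sHom] by auto

lemma L_Hom: "b \<in> Simp B 0 \<Longrightarrow> \<alpha> \<in> Hom (tau1 A) a a' \<Longrightarrow> L b a a' \<alpha> \<in> Hom C (a, b) (a', b)"
  using is_functorD(4)[OF L_functor, of b a a' \<alpha>] tau1_Hom_Ob[of \<alpha> A a a'] by (simp add: inl_0)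

lemma R_Hom: "a \<in> Simp A 0 \<Longrightarrow> \<beta> \<in> Hom (tau1 B) b b' \<Longrightarrow> R a b b' \<beta> \<in> Hom C (a, b) (a, b')"
  using is_functorD(4)[OF R_functor, of a b b' \<beta>] tau1_Hom_Ob[of \<beta> B b b'] by (simp add: inr_0)

lemma L_Comp:
  assumes "b \<in> Simp B 0" "\<alpha> \<in> Hom (tau1 A) a a'" "\<alpha>' \<in> Hom (tau1 A) a' a''"
  shows "L b a a'' (Comp (tau1 A) a a' a'' \<alpha>' \<alpha>) = Comp C (a, b) (a', b) (a'', b) (L b a' a'' \<alpha>') (L b a a' \<alpha>)"
  using is_functorD(6)[OF L_functor[OF assms(1)], of a a' a'' \<alpha> \<alpha>'] tau1_Hom_Ob[OF assms(2)] tau1_Hom_Ob[OF assms(3)] assms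
  by (simp add: inl_0)

lemma R_Comp:
  assumes "a \<in> Simp A 0" "\<beta> \<in> Hom (tau1 B) b b'" "\<beta>' \<in> Hom (tau1 B) b' b''"
  shows "R a b b'' (Comp (tau1 B) b b' b'' \<beta>' \<beta>) = Comp C (a, b) (a, b') (a, b'') (R a b' b'' \<beta>') (R a b b' \<beta>)"
  using is_functorD(6)[OF R_functor[OF assms(1)], of b b' b'' \<beta> \<beta>'] tau1_Hom_Ob[OF assms(2)] tau1_Hom_Ob[OF assms(3)] assms
  by (simp add: inr_0)

lemma L_Id: "a \<in> Simp A 0 \<Longrightarrow> b \<in> Simp B 0 \<Longrightarrow> L b a a (Id (tau1 A) a) = Id C (a, b)"
  and R_Id: "a \<in> Simp A 0 \<Longrightarrow> b \<in> Simp B 0 \<Longrightarrow> R a b b (Id (tau1 B) b) = Id C (a, b)"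
  using is_functorD(5)[OF L_functor, of b a] is_functorD(5)[OF R_functor, of a b] by (simp_all add: inl_0 inr_0)

text \<open>
  The edge \<open>(e, f)\<close> is the diagonal of the square \<open>e \<times> f\<close>, which is cut by it into two triangles. Their
  remaining sides are the sides of the square.
\<close>

lemma tedge_pair:
  assumes e: "e \<in> Simp A 1" and f: "f \<in> Simp B 1"
  defines "a \<equiv> svert A 1 0 e" and "a' \<equiv> svert A 1 1 e" and "b \<equiv> svert B 1 0 f" and "b' \<equiv> svert B 1 1 f"
  shows "tedge AB (e, f) = Comp C (a, b) (a', b) (a', b') (R a' b b' (tedge B f)) (L b a a' (tedge A e))"
    and "tedge AB (e, f) = Comp C (a, b) (a, b') (a', b') (L b' a a' (tedge A e)) (R a b b' (tedge B f))"
proof -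
  have v: "a \<in> Simp A 0" "a' \<in> Simp A 0" "b \<in> Simp B 0" "b' \<in> Simp B 0"
    unfolding a_def a'_def b_def b'_def using svert_in[OF A] svert_in[OF B] e f by auto
  have Le: "L c a a' (tedge A e) = tedge AB (e, sconst B c 1)" if "c \<in> Simp B 0" for c
    using tau1_tedge[OF A AB inl_sHom[OF that] e] e by (simp add: inl_def a_def a'_def)
  have Rf: "R c b b' (tedge B f) = tedge AB (sconst A c 1, f)" if "c \<in> Simp A 0" for c
    using tau1_tedge[OF B AB inr_sHom[OF that] f] f by (simp add: inr_def b_def b'_def)
  have t: "tri 0 1 1 \<in> Delta 2 1" "tri 0 0 1 \<in> Delta 2 1" by (auto intro: tri_Delta)
  have e01: "edg 0 1 = (\<lambda>i\<in>{..1}. i)" by (auto simp: edg_def)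
  \<comment> \<open>the triangles are pairs of degenerate 2-simplices: \<open>tri 0 1 1\<close> repeats the last vertex
      of an edge, \<open>tri 0 0 1\<close> the first\<close>
  have degenerate: "Act X 1 1 (edg i i) x = sconst X (svert X 1 i x) 1"
    if X: "simplicial_set X" and x: "x \<in> Simp X 1" and i: "i \<le> 1" for X :: "'c sset" and x i
  proof -
    have "edg i i = compose {..1} (vtx i) (\<lambda>_\<in>{..1}. 0)" by (auto simp: edg_def vtx_def compose_def)
    then show ?thesis unfolding sconst_def svert_def using Act_Act[OF X Delta_0 vtx_Delta[OF i] x] by simp
  qed
  have edges: "Act X 1 2 (edg 0 1) (Act X 2 1 (tri 0 1 1) x) = x"
      "Act X 1 2 (edg 0 2) (Act X 2 1 (tri 0 1 1) x) = x"
      "Act X 1 2 (edg 1 2) (Act X 2 1 (tri 0 1 1) x) = sconst X (svert X 1 1 x) 1"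
      "Act X 1 2 (edg 0 1) (Act X 2 1 (tri 0 0 1) x) = sconst X (svert X 1 0 x) 1"
      "Act X 1 2 (edg 0 2) (Act X 2 1 (tri 0 0 1) x) = x"
      "Act X 1 2 (edg 1 2) (Act X 2 1 (tri 0 0 1) x) = x"
    if X: "simplicial_set X" and x: "x \<in> Simp X 1" for X :: "'c sset" and x
    using edge_Act[OF X t(1) x, of 0 1] edge_Act[OF X t(1) x, of 0 2] edge_Act[OF X t(1) x, of 1 2]
      edge_Act[OF X t(2) x, of 0 1] edge_Act[OF X t(2) x, of 0 2] edge_Act[OF X t(2) x, of 1 2]
      degenerate[OF X x, of 0] degenerate[OF X x, of 1] Act_id[OF X x]
    by (simp_all add: tri_def e01[symmetric, unfolded One_nat_def])
  have vx: "svert X 2 0 (Act X 2 1 (tri 0 1 1) x) = svert X 1 0 x"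
      "svert X 2 1 (Act X 2 1 (tri 0 1 1) x) = svert X 1 1 x"
      "svert X 2 2 (Act X 2 1 (tri 0 1 1) x) = svert X 1 1 x"
      "svert X 2 0 (Act X 2 1 (tri 0 0 1) x) = svert X 1 0 x"
      "svert X 2 1 (Act X 2 1 (tri 0 0 1) x) = svert X 1 0 x"
      "svert X 2 2 (Act X 2 1 (tri 0 0 1) x) = svert X 1 1 x"
    if X: "simplicial_set X" and x: "x \<in> Simp X 1" for X :: "'c sset" and x
    using svert_Act[OF X t(1) x] svert_Act[OF X t(2) x] by (simp_all add: tri_def)
  note in2 = Act_in[OF A t(1) e] Act_in[OF A t(2) e] Act_in[OF B t(1) f] Act_in[OF B t(2) f]
  note ed = edg_Delta[of 0 1 2] edg_Delta[of 0 2 2] edg_Delta[of 1 2 2]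
  have "tedge AB (e, f) = Comp C (a, b) (a', b) (a', b') (tedge AB (sconst A a' 1, f)) (tedge AB (e, sconst B b 1))"
    using tedge_triangle[OF AB, of "(Act A 2 1 (tri 0 1 1) e, Act B 2 1 (tri 0 0 1) f)"] in2 ed
    by (simp add: sprod_simps svert_sprod edges[OF A e] edges[OF B f] vx[OF A e] vx[OF B f] del: One_nat_def flip: a_def a'_def b_def b'_def)
  then show "tedge AB (e, f) = Comp C (a, b) (a', b) (a', b') (R a' b b' (tedge B f)) (L b a a' (tedge A e))"
    by (simp add: Le Rf v)
  have "tedge AB (e, f) = Comp C (a, b) (a, b') (a', b') (tedge AB (e, sconst B b' 1)) (tedge AB (sconst A a 1, f))"
    using tedge_triangle[OF AB, of "(Act A 2 1 (tri 0 0 1) e, Act B 2 1 (tri 0 1 1) f)"] in2 ed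
    by (simp add: sprod_simps svert_sprod edges[OF A e] edges[OF B f] vx[OF A e] vx[OF B f] del: One_nat_def flip: a_def a'_def b_def b'_def)
  then show "tedge AB (e, f) = Comp C (a, b) (a, b') (a', b') (L b' a a' (tedge A e)) (R a b b' (tedge B f))"
    by (simp add: Le Rf v)
qed

text \<open>
  For generators this compares the two triangles of a square. Squares can be pasted, so induction on \<open>\<beta>\<close> for
  a generator in place of \<open>\<alpha>\<close>, and then on \<open>\<alpha>\<close>, gives the general case.
\<close>

lemma interchange:
  assumes \<alpha>: "\<alpha> \<in> Hom (tau1 A) a a'" and \<beta>: "\<beta> \<in> Hom (tau1 B) b b'"
  shows "Comp C (a, b) (a', b) (a', b') (R a' b b' \<beta>) (L b a a' \<alpha>) =
    Comp C (a, b) (a, b') (a', b') (L b' a a' \<alpha>) (R a b b' \<beta>)"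
proof -
  note cC = category_tau1[of AB]
  have step: "Comp C (svert A 1 0 e, b) (svert A 1 1 e, b) (svert A 1 1 e, b') (R (svert A 1 1 e) b b' \<beta>) (L b (svert A 1 0 e) (svert A 1 1 e) (tedge A e)) =
      Comp C (svert A 1 0 e, b) (svert A 1 0 e, b') (svert A 1 1 e, b') (L b' (svert A 1 0 e) (svert A 1 1 e) (tedge A e)) (R (svert A 1 0 e) b b' \<beta>)"
    if e: "e \<in> Simp A 1" for e
    using B \<beta>
  proof (induction rule: tau1_induct)
    case (Id b)
    have "svert A 1 0 e \<in> Simp A 0" "svert A 1 1 e \<in> Simp A 0" using svert_in[OF A] e by auto
    then show ?case using Id L_Hom[OF Id tedge_Hom[OF A e]] categoryD(3,4)[OF cC]
      by (simp add: R_Id sprod_simps del: One_nat_def)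
  next
    case (edge f b' \<beta>)
    let ?a = "svert A 1 0 e" and ?a' = "svert A 1 1 e" and ?b = "svert B 1 0 f" and ?b1 = "svert B 1 1 f"
    have v: "?a \<in> Simp A 0" "?a' \<in> Simp A 0" "?b \<in> Simp B 0" "?b1 \<in> Simp B 0" "b' \<in> Simp B 0"
      using svert_in[OF A] svert_in[OF B] e edge by auto
    note te = tedge_Hom[OF A e] and tf = tedge_Hom[OF B edge(1)]
    show ?case
      unfolding R_Comp[OF v(1) tf edge(3)] R_Comp[OF v(2) tf edge(3)]
      by (rule square_Comp[OF cC, symmetric, where b = "L ?b1 ?a ?a' (tedge A e)"])
        (use v L_Hom[OF _ te] R_Hom[OF _ tf] R_Hom[OF _ edge(3)] edge.IH tedge_pair[OF e edge(1)] in
          \<open>simp_all add: sprod_simps del: One_nat_def\<close>)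
  qed
  show ?thesis
    using A \<alpha>
  proof (induction rule: tau1_induct)
    case (Id a)
    then show ?case using tau1_Hom_Ob[OF \<beta>] R_Hom[OF Id \<beta>] categoryD(3,4)[OF cC]
      by (simp add: L_Id sprod_simps)
  next
    case (edge e a' \<alpha>)
    let ?a = "svert A 1 0 e" and ?a1 = "svert A 1 1 e"
    have v: "?a \<in> Simp A 0" "?a1 \<in> Simp A 0" "a' \<in> Simp A 0" "b \<in> Simp B 0" "b' \<in> Simp B 0"
      using svert_in[OF A] edge tau1_Hom_Ob[OF \<beta>] by auto
    note te = tedge_Hom[OF A edge(1)]
    show ?case
      unfolding L_Comp[OF v(4) te edge(3)] L_Comp[OF v(5) te edge(3)]
      by (rule square_Comp[OF cC, where b = "R ?a1 b b' \<beta>"])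
        (use v L_Hom[OF _ te] L_Hom[OF _ edge(3)] R_Hom[OF _ \<beta>] edge.IH step[OF edge(1)] in
          \<open>simp_all add: sprod_simps del: One_nat_def\<close>)
  qed
qed

definition pair :: "'a \<times> 'b \<Rightarrow> 'a \<times> 'b \<Rightarrow> ('a \<times> 'a \<times> 'a) list set \<Rightarrow> ('b \<times> 'b \<times> 'b) list set \<Rightarrow>
    (('a \<times> 'b) \<times> ('a \<times> 'b) \<times> ('a \<times> 'b)) list set" where
  "pair x y \<alpha> \<beta> = Comp C x (fst y, snd x) y (R (fst y) (snd x) (snd y) \<beta>) (L (snd x) (fst x) (fst y) \<alpha>)"

lemma pair_Hom:
  assumes "\<alpha> \<in> Hom (tau1 A) a a'" "\<beta> \<in> Hom (tau1 B) b b'"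
  shows "pair (a, b) (a', b') \<alpha> \<beta> \<in> Hom C (a, b) (a', b')"
  using assms L_Hom R_Hom tau1_Hom_Ob[OF assms(1)] tau1_Hom_Ob[OF assms(2)]
  by (auto simp: pair_def sprod_simps intro!: categoryD(2)[OF category_tau1])

lemma pair_Comp:
  assumes \<alpha>: "\<alpha> \<in> Hom (tau1 A) a a'" "\<alpha>' \<in> Hom (tau1 A) a' a''"
    and \<beta>: "\<beta> \<in> Hom (tau1 B) b b'" "\<beta>' \<in> Hom (tau1 B) b' b''"
  shows "pair (a, b) (a'', b'') (Comp (tau1 A) a a' a'' \<alpha>' \<alpha>) (Comp (tau1 B) b b' b'' \<beta>' \<beta>) =
    Comp C (a, b) (a', b') (a'', b'') (pair (a', b') (a'', b'') \<alpha>' \<beta>') (pair (a, b) (a', b') \<alpha> \<beta>)"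
proof -
  note cC = category_tau1[of AB]
  have v: "a \<in> Simp A 0" "a' \<in> Simp A 0" "a'' \<in> Simp A 0" "b \<in> Simp B 0" "b' \<in> Simp B 0" "b'' \<in> Simp B 0"
    using tau1_Hom_Ob[OF \<alpha>(1)] tau1_Hom_Ob[OF \<alpha>(2)] tau1_Hom_Ob[OF \<beta>(1)] tau1_Hom_Ob[OF \<beta>(2)] by auto
  have ob: "(x, y) \<in> Ob C" if "x \<in> Simp A 0" "y \<in> Simp B 0" for x y
    using that by (simp add: sprod_simps)
  show ?thesis
    using middle_four[OF cC ob[OF v(1,4)] ob[OF v(2,4)] ob[OF v(3,4)] ob[OF v(3,5)] ob[OF v(3,6)] ob[OF v(2,5)]
        L_Hom[OF v(4) \<alpha>(1)] L_Hom[OF v(4) \<alpha>(2)] R_Hom[OF v(3) \<beta>(1)] R_Hom[OF v(3) \<beta>(2)]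
        R_Hom[OF v(2) \<beta>(1)] L_Hom[OF v(5) \<alpha>(2)] interchange[OF \<alpha>(2) \<beta>(1)]]
    by (simp add: pair_def L_Comp[OF v(4) \<alpha>] R_Comp[OF v(3) \<beta>])
qed

lemma p_functor: "is_functor C (tau1 A) (tau1_functor A (sfst A B))" "is_functor C (tau1 B) (tau1_functor B (ssnd A B))"
  by (rule is_functor_tau1[OF AB A sfst_sHom] is_functor_tau1[OF AB B ssnd_sHom])+

lemma p_0: "x \<in> Simp A 0 \<Longrightarrow> y \<in> Simp B 0 \<Longrightarrow> sfst A B 0 (x, y) = x"
  "x \<in> Simp A 0 \<Longrightarrow> y \<in> Simp B 0 \<Longrightarrow> ssnd A B 0 (x, y) = y"
  by (simp_all add: sfst_def ssnd_def)

lemma p_pair: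
  assumes \<alpha>: "\<alpha> \<in> Hom (tau1 A) a a'" and \<beta>: "\<beta> \<in> Hom (tau1 B) b b'"
  shows "p1 (a, b) (a', b') (pair (a, b) (a', b') \<alpha> \<beta>) = \<alpha>"
    and "p2 (a, b) (a', b') (pair (a, b) (a', b') \<alpha> \<beta>) = \<beta>"
proof -
  have v: "a \<in> Simp A 0" "a' \<in> Simp A 0" "b \<in> Simp B 0" "b' \<in> Simp B 0"
    using tau1_Hom_Ob[OF \<alpha>] tau1_Hom_Ob[OF \<beta>] by auto
  have "scomp A (sfst A B) (inl b) = sid A"
    by (rule sHom_eqI[OF scomp_sHom[OF A inl_sHom[OF v(3)] sfst_sHom] sid_sHom[OF A]])
      (use v sconst_in[OF B] in \<open>simp add: scomp_apply sid_apply inl_def sfst_def\<close>)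
  then have p1L: "p1 (a, b) (a', b) (L b a a' \<alpha>) = \<alpha>"
    using tau1_scomp[OF A AB A inl_sHom[OF v(3)] sfst_sHom \<alpha>] tau1_sid[OF A \<alpha>] v by (simp add: inl_0)
  have "scomp B (ssnd A B) (inr a') = sid B"
    by (rule sHom_eqI[OF scomp_sHom[OF B inr_sHom[OF v(2)] ssnd_sHom] sid_sHom[OF B]])
      (use v sconst_in[OF A] in \<open>simp add: scomp_apply sid_apply inr_def ssnd_def\<close>)
  then have p2R: "p2 (a', b) (a', b') (R a' b b' \<beta>) = \<beta>"
    using tau1_scomp[OF B AB B inr_sHom[OF v(2)] ssnd_sHom \<beta>] tau1_sid[OF B \<beta>] v by (simp add: inr_0)
  have "FArr (tau1_functor B (scomp A (ssnd A B) (inl b))) a a' \<alpha> = Id (tau1 B) b"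
    by (rule tau1_constant[OF A B scomp_sHom[OF A inl_sHom[OF v(3)] ssnd_sHom] v(3) _ \<alpha>])
      (use v sconst_in[OF B] in \<open>simp add: scomp_apply inl_def ssnd_def\<close>)
  then have p2L: "p2 (a, b) (a', b) (L b a a' \<alpha>) = Id (tau1 B) b"
    using tau1_scomp[OF A AB B inl_sHom[OF v(3)] ssnd_sHom \<alpha>] v by (simp add: inl_0)
  have "FArr (tau1_functor A (scomp B (sfst A B) (inr a'))) b b' \<beta> = Id (tau1 A) a'"
    by (rule tau1_constant[OF B A scomp_sHom[OF B inr_sHom[OF v(2)] sfst_sHom] v(2) _ \<beta>])
      (use v sconst_in[OF A] in \<open>simp add: scomp_apply inr_def sfst_def\<close>)
  then have p1R: "p1 (a', b) (a', b') (R a' b b' \<beta>) = Id (tau1 A) a'"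
    using tau1_scomp[OF B AB A inr_sHom[OF v(2)] sfst_sHom \<beta>] v by (simp add: inr_0)
  note cA = category_tau1[of A] and cB = category_tau1[of B]
  show "p1 (a, b) (a', b') (pair (a, b) (a', b') \<alpha> \<beta>) = \<alpha>"
    using is_functorD(6)[OF p_functor(1) _ _ _ L_Hom[OF v(3) \<alpha>] R_Hom[OF v(2) \<beta>]] v \<alpha> categoryD(4)[OF cA _ _ \<alpha>]
    by (simp add: pair_def p_0 sprod_simps p1L p1R)
  show "p2 (a, b) (a', b') (pair (a, b) (a', b') \<alpha> \<beta>) = \<beta>"
    using is_functorD(6)[OF p_functor(2) _ _ _ L_Hom[OF v(3) \<alpha>] R_Hom[OF v(2) \<beta>]] v \<beta> categoryD(3)[OF cB _ _ \<beta>]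
    by (simp add: pair_def p_0 sprod_simps p2L p2R)
qed

text \<open>
  Pairing is functorial, so this need only be seen for generators, where it is the decomposition of a
  diagonal edge. It makes the projections of an arrow determine the arrow.
\<close>

lemma pair_p:
  assumes "\<gamma> \<in> Hom C x y"
  shows "pair x y (p1 x y \<gamma>) (p2 x y \<gamma>) = \<gamma>"
  using AB assms
proof (induction rule: tau1_induct)
  case (Id x)
  then show ?case
    using is_functorD(5)[OF p_functor(1), of x] is_functorD(5)[OF p_functor(2), of x] categoryD(1,3)[OF category_tau1[of AB], of x]
    by (cases x) (simp add: pair_def p_0 sprod_simps L_Id R_Id)
next
  case (edge g y \<gamma>)
  obtain e f where g: "g = (e, f)" by (cases g)
  have ef: "e \<in> Simp A 1" "f \<in> Simp B 1" using edge(1) by (simp_all add: g sprod_simps)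
  obtain a' b' where y: "y = (a', b')" by (cases y)
  let ?a = "svert A 1 0 e" and ?a1 = "svert A 1 1 e" and ?b = "svert B 1 0 f" and ?b1 = "svert B 1 1 f"
  have s: "svert AB 1 0 g = (?a, ?b)" "svert AB 1 1 g = (?a1, ?b1)" using ef by (simp_all add: g svert_sprod)
  have v: "?a \<in> Simp A 0" "?a1 \<in> Simp A 0" "a' \<in> Simp A 0" "?b \<in> Simp B 0" "?b1 \<in> Simp B 0" "b' \<in> Simp B 0"
    using svert_in[OF A] svert_in[OF B] ef edge(2) by (auto simp: y sprod_simps)
  note te = tedge_Hom[OF A ef(1)] and tf = tedge_Hom[OF B ef(2)]
  have tg: "tedge AB g \<in> Hom C (?a, ?b) (?a1, ?b1)" using tedge_Hom[OF AB edge(1)] unfolding s .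
  have c: "\<gamma> \<in> Hom C (?a1, ?b1) (a', b')" using edge(3) unfolding s y .
  have ob: "(?a, ?b) \<in> Ob C" "(?a1, ?b1) \<in> Ob C" "(a', b') \<in> Ob C" using v by (simp_all add: sprod_simps)
  have g1: "p1 (?a, ?b) (?a1, ?b1) (tedge AB g) = tedge A e" "p2 (?a, ?b) (?a1, ?b1) (tedge AB g) = tedge B f"
    using tau1_tedge[OF AB A sfst_sHom edge(1)] tau1_tedge[OF AB B ssnd_sHom edge(1)] ef
    unfolding s by (simp_all add: g sfst_def ssnd_def)
  have c1: "p1 (?a1, ?b1) (a', b') \<gamma> \<in> Hom (tau1 A) ?a1 a'" "p2 (?a1, ?b1) (a', b') \<gamma> \<in> Hom (tau1 B) ?b1 b'"
    using is_functorD(4)[OF p_functor(1) ob(2,3) c] is_functorD(4)[OF p_functor(2) ob(2,3) c] v by (simp_all add: p_0)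
  have "p1 (?a, ?b) (a', b') (Comp C (?a, ?b) (?a1, ?b1) (a', b') \<gamma> (tedge AB g)) =
      Comp (tau1 A) ?a ?a1 a' (p1 (?a1, ?b1) (a', b') \<gamma>) (tedge A e)"
    "p2 (?a, ?b) (a', b') (Comp C (?a, ?b) (?a1, ?b1) (a', b') \<gamma> (tedge AB g)) =
      Comp (tau1 B) ?b ?b1 b' (p2 (?a1, ?b1) (a', b') \<gamma>) (tedge B f)"
    using is_functorD(6)[OF p_functor(1) ob tg c] is_functorD(6)[OF p_functor(2) ob tg c] v
    by (simp_all add: p_0 g1 del: One_nat_def)
  moreover have "pair (?a, ?b) (?a1, ?b1) (tedge A e) (tedge B f) = tedge AB g"
    using tedge_pair(1)[OF ef] by (simp add: pair_def g)
  moreover have "pair (?a1, ?b1) (a', b') (p1 (?a1, ?b1) (a', b') \<gamma>) (p2 (?a1, ?b1) (a', b') \<gamma>) = \<gamma>"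
    using edge.IH unfolding s y .
  ultimately show ?case
    using pair_Comp[OF te c1(1) tf c1(2)] unfolding s y by simp
qed

text \<open>
  The fundamental category preserves binary products: \<open>pair\<close> is a two-sided inverse of the pair of
  projections, so it is the arrow that the definite description in \<open>tau1_pair\<close> denotes.
\<close>

theorem tau1_pair_eq:
  assumes \<alpha>: "\<alpha> \<in> Hom (tau1 A) a a'" and \<beta>: "\<beta> \<in> Hom (tau1 B) b b'"
  shows "tau1_pair A B (a, b) (a', b') \<alpha> \<beta> =
    Comp C (a, b) (a', b) (a', b') (R a' b b' \<beta>) (L b a a' \<alpha>)"
proof -
  have "tau1_pair A B (a, b) (a', b') \<alpha> \<beta> = pair (a, b) (a', b') \<alpha> \<beta>"
    unfolding tau1_pair_def
    using pair_Hom[OF assms] p_pair[OF assms] pair_p by (intro the_equality) auto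
  then show ?thesis by (simp add: pair_def)
qed

end

section \<open>2-categories from whiskering\<close>

lemma category_prod: "category C \<Longrightarrow> category D \<Longrightarrow> category (prod_cat C D)"
  unfolding category_def prod_cat_def by auto

text \<open>
  In a 2-category horizontal composition is determined by composition of a 2-cell with a 1-cell on either
  side. Conversely, suppose that \<open>Pre f\<close> and \<open>Post g\<close> (precomposition with \<open>f\<close> and postcomposition with \<open>g\<close>)
  are functors between hom-categories that satisfy interchange and are strictly functorial and compatible
  in \<open>f\<close> and \<open>g\<close>. Then the axioms of a 2-category hold. The point is that each condition on whiskering
  concerns a single 2-cell, except for interchange.
\<close>

locale whiskering =
  fixes K :: "('o, 'm, 't) two_cat"
    and Pre :: "'o \<Rightarrow> 'o \<Rightarrow> 'o \<Rightarrow> 'm \<Rightarrow> ('m, 't, 'm, 't) fctr"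
    and Post :: "'o \<Rightarrow> 'o \<Rightarrow> 'o \<Rightarrow> 'm \<Rightarrow> ('m, 't, 'm, 't) fctr"
  fixes H and co
  defines "H \<equiv> HomCat K" and "co \<equiv> (\<lambda>X Y Z g f. FOb (CompF K X Y Z) (g, f))"
  assumes cat: "X \<in> Ob0 K \<Longrightarrow> Y \<in> Ob0 K \<Longrightarrow> category (H X Y)"
    and unit: "X \<in> Ob0 K \<Longrightarrow> Unit K X \<in> Ob (H X X)"
    and Pre: "X \<in> Ob0 K \<Longrightarrow> Y \<in> Ob0 K \<Longrightarrow> Z \<in> Ob0 K \<Longrightarrow> f \<in> Ob (H X Y) \<Longrightarrow> is_functor (H Y Z) (H X Z) (Pre X Y Z f)"
    and Post: "X \<in> Ob0 K \<Longrightarrow> Y \<in> Ob0 K \<Longrightarrow> Z \<in> Ob0 K \<Longrightarrow> g \<in> Ob (H Y Z) \<Longrightarrow> is_functor (H X Y) (H X Z) (Post X Y Z g)"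
    and FOb_Pre: "FOb (Pre X Y Z f) g = co X Y Z g f" and FOb_Post: "FOb (Post X Y Z g) f = co X Y Z g f"
    and hcomp: "\<lbrakk>X \<in> Ob0 K; Y \<in> Ob0 K; Z \<in> Ob0 K; f \<in> Ob (H X Y); f' \<in> Ob (H X Y); g \<in> Ob (H Y Z); g' \<in> Ob (H Y Z);
      \<alpha> \<in> Hom (H X Y) f f'; \<beta> \<in> Hom (H Y Z) g g'\<rbrakk> \<Longrightarrow>
      FArr (CompF K X Y Z) (g, f) (g', f') (\<beta>, \<alpha>) =
      Comp (H X Z) (co X Y Z g f) (co X Y Z g' f) (co X Y Z g' f') (FArr (Post X Y Z g') f f' \<alpha>) (FArr (Pre X Y Z f) g g' \<beta>)"
    and interchange: "\<lbrakk>X \<in> Ob0 K; Y \<in> Ob0 K; Z \<in> Ob0 K; f \<in> Ob (H X Y); f' \<in> Ob (H X Y); g \<in> Ob (H Y Z); g' \<in> Ob (H Y Z);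
      \<alpha> \<in> Hom (H X Y) f f'; \<beta> \<in> Hom (H Y Z) g g'\<rbrakk> \<Longrightarrow>
      Comp (H X Z) (co X Y Z g f) (co X Y Z g' f) (co X Y Z g' f') (FArr (Post X Y Z g') f f' \<alpha>) (FArr (Pre X Y Z f) g g' \<beta>) =
      Comp (H X Z) (co X Y Z g f) (co X Y Z g f') (co X Y Z g' f') (FArr (Pre X Y Z f') g g' \<beta>) (FArr (Post X Y Z g) f f' \<alpha>)"
    and co_unit: "X \<in> Ob0 K \<Longrightarrow> Y \<in> Ob0 K \<Longrightarrow> f \<in> Ob (H X Y) \<Longrightarrow> co X X Y f (Unit K X) = f \<and> co X Y Y (Unit K Y) f = f"
    and co_assoc: "\<lbrakk>W \<in> Ob0 K; X \<in> Ob0 K; Y \<in> Ob0 K; Z \<in> Ob0 K; f \<in> Ob (H W X); g \<in> Ob (H X Y); h \<in> Ob (H Y Z)\<rbrakk> \<Longrightarrow>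
      co W X Z (co X Y Z h g) f = co W Y Z h (co W X Y g f)"
    and Pre_unit: "\<lbrakk>X \<in> Ob0 K; Y \<in> Ob0 K; f \<in> Ob (H X Y); f' \<in> Ob (H X Y); \<alpha> \<in> Hom (H X Y) f f'\<rbrakk> \<Longrightarrow>
      FArr (Pre X X Y (Unit K X)) f f' \<alpha> = \<alpha>"
    and Post_unit: "\<lbrakk>X \<in> Ob0 K; Y \<in> Ob0 K; f \<in> Ob (H X Y); f' \<in> Ob (H X Y); \<alpha> \<in> Hom (H X Y) f f'\<rbrakk> \<Longrightarrow>
      FArr (Post X Y Y (Unit K Y)) f f' \<alpha> = \<alpha>"
    and Pre_Pre: "\<lbrakk>W \<in> Ob0 K; X \<in> Ob0 K; Y \<in> Ob0 K; Z \<in> Ob0 K; f \<in> Ob (H W X); g \<in> Ob (H X Y);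
      h \<in> Ob (H Y Z); h' \<in> Ob (H Y Z); \<gamma> \<in> Hom (H Y Z) h h'\<rbrakk> \<Longrightarrow>
      FArr (Pre W X Z f) (co X Y Z h g) (co X Y Z h' g) (FArr (Pre X Y Z g) h h' \<gamma>) = FArr (Pre W Y Z (co W X Y g f)) h h' \<gamma>"
    and Post_Post: "\<lbrakk>W \<in> Ob0 K; X \<in> Ob0 K; Y \<in> Ob0 K; Z \<in> Ob0 K; g \<in> Ob (H X Y); h \<in> Ob (H Y Z);
      f \<in> Ob (H W X); f' \<in> Ob (H W X); \<alpha> \<in> Hom (H W X) f f'\<rbrakk> \<Longrightarrow>
      FArr (Post W Y Z h) (co W X Y g f) (co W X Y g f') (FArr (Post W X Y g) f f' \<alpha>) = FArr (Post W X Z (co X Y Z h g)) f f' \<alpha>"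
    and Post_Pre: "\<lbrakk>W \<in> Ob0 K; X \<in> Ob0 K; Y \<in> Ob0 K; Z \<in> Ob0 K; f \<in> Ob (H W X); h \<in> Ob (H Y Z);
      g \<in> Ob (H X Y); g' \<in> Ob (H X Y); \<beta> \<in> Hom (H X Y) g g'\<rbrakk> \<Longrightarrow>
      FArr (Post W Y Z h) (co W X Y g f) (co W X Y g' f) (FArr (Pre W X Y f) g g' \<beta>) =
      FArr (Pre W X Z f) (co X Y Z h g) (co X Y Z h g') (FArr (Post X Y Z h) g g' \<beta>)"
begin

lemma FOb_CompF: "FOb (CompF K X Y Z) (g, f) = co X Y Z g f"
  by (simp add: co_def)

lemmas co_Ob = is_functorD(3)[OF Pre, unfolded FOb_Pre]
lemmas Pre_Hom = is_functorD(4)[OF Pre, unfolded FOb_Pre] and Post_Hom = is_functorD(4)[OF Post, unfolded FOb_Post]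
lemmas Pre_Id = is_functorD(5)[OF Pre, unfolded FOb_Pre] and Post_Id = is_functorD(5)[OF Post, unfolded FOb_Post]
lemmas Pre_Comp = is_functorD(6)[OF Pre, unfolded FOb_Pre] and Post_Comp = is_functorD(6)[OF Post, unfolded FOb_Post]

text \<open>
  Compatibility with vertical composition is the middle four interchange.
\<close>

lemma CompF_functor:
  assumes X: "X \<in> Ob0 K" and Y: "Y \<in> Ob0 K" and Z: "Z \<in> Ob0 K"
  shows "is_functor (prod_cat (H Y Z) (H X Y)) (H X Z) (CompF K X Y Z)"
proof -
  note O = X Y Z
  note cXZ = cat[OF X Z] and cXY = cat[OF X Y] and cYZ = cat[OF Y Z]
  have ob: "FOb (CompF K X Y Z) (g, f) \<in> Ob (H X Z)" if "g \<in> Ob (H Y Z)" "f \<in> Ob (H X Y)" for f g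
    using co_Ob[OF O that(2,1)] by (simp add: co_def)
  have hm: "FArr (CompF K X Y Z) (g, f) (g', f') (\<beta>, \<alpha>) \<in> Hom (H X Z) (FOb (CompF K X Y Z) (g, f)) (FOb (CompF K X Y Z) (g', f'))"
    if g: "g \<in> Ob (H Y Z)" "g' \<in> Ob (H Y Z)" "\<beta> \<in> Hom (H Y Z) g g'" and f: "f \<in> Ob (H X Y)" "f' \<in> Ob (H X Y)" "\<alpha> \<in> Hom (H X Y) f f'"
    for f g f' g' \<alpha> \<beta>
    using categoryD(2)[OF cXZ co_Ob[OF O f(1) g(1)] co_Ob[OF O f(1) g(2)] co_Ob[OF O f(2) g(2)] Pre_Hom[OF O f(1) g] Post_Hom[OF O g(2) f]]
    by (simp add: hcomp[OF O f(1,2) g(1,2) f(3) g(3)] add: FOb_CompF)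
  have idn: "FArr (CompF K X Y Z) (g, f) (g, f) (Id (H Y Z) g, Id (H X Y) f) = Id (H X Z) (FOb (CompF K X Y Z) (g, f))"
    if g: "g \<in> Ob (H Y Z)" and f: "f \<in> Ob (H X Y)" for f g
    using hcomp[OF O f f g g categoryD(1)[OF cXY f] categoryD(1)[OF cYZ g]] Pre_Id[OF O f g] Post_Id[OF O g f]
      categoryD(4)[OF cXZ co_Ob[OF O f g] co_Ob[OF O f g] categoryD(1)[OF cXZ co_Ob[OF O f g]]]
    by (simp add: co_def)
  have cmp: "FArr (CompF K X Y Z) (g, f) (g'', f'') (Comp (H Y Z) g g' g'' \<beta>' \<beta>, Comp (H X Y) f f' f'' \<alpha>' \<alpha>) =
      Comp (H X Z) (FOb (CompF K X Y Z) (g, f)) (FOb (CompF K X Y Z) (g', f')) (FOb (CompF K X Y Z) (g'', f''))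
        (FArr (CompF K X Y Z) (g', f') (g'', f'') (\<beta>', \<alpha>')) (FArr (CompF K X Y Z) (g, f) (g', f') (\<beta>, \<alpha>))"
    if g: "g \<in> Ob (H Y Z)" "g' \<in> Ob (H Y Z)" "g'' \<in> Ob (H Y Z)" "\<beta> \<in> Hom (H Y Z) g g'" "\<beta>' \<in> Hom (H Y Z) g' g''"
      and f: "f \<in> Ob (H X Y)" "f' \<in> Ob (H X Y)" "f'' \<in> Ob (H X Y)" "\<alpha> \<in> Hom (H X Y) f f'" "\<alpha>' \<in> Hom (H X Y) f' f''"
    for f g f' g' f'' g'' \<alpha> \<beta> \<alpha>' \<beta>'
  proof -
    note m = middle_four[OF cXZ co_Ob[OF O f(1) g(1)] co_Ob[OF O f(1) g(2)] co_Ob[OF O f(1) g(3)]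
        co_Ob[OF O f(2) g(3)] co_Ob[OF O f(3) g(3)] co_Ob[OF O f(2) g(2)]
        Pre_Hom[OF O f(1) g(1,2,4)] Pre_Hom[OF O f(1) g(2,3,5)] Post_Hom[OF O g(3) f(1,2,4)] Post_Hom[OF O g(3) f(2,3,5)]
        Post_Hom[OF O g(2) f(1,2,4)] Pre_Hom[OF O f(2) g(2,3,5)] interchange[OF O f(1,2) g(2,3) f(4) g(5)]]
    show ?thesis
      using m hcomp[OF O f(1,2) g(1,2) f(4) g(4)] hcomp[OF O f(2,3) g(2,3) f(5) g(5)]
        hcomp[OF O f(1,3) g(1,3) categoryD(2)[OF cXY f] categoryD(2)[OF cYZ g]] Pre_Comp[OF O f(1) g] Post_Comp[OF O g(3) f]
      by (simp add: co_def)
  qed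
  show ?thesis
    unfolding is_functor_def
    using category_prod[OF cYZ cXY] cXZ ob hm idn cmp by (auto simp: prod_cat_def)
qed

text \<open>
  Both sides are the composite of the three 2-cells \<open>\<gamma> g f\<close>, \<open>h' \<beta> f\<close> and \<open>h' g' \<alpha>\<close>.
\<close>

lemma hcomp_assoc:
  assumes O: "W \<in> Ob0 K" "X \<in> Ob0 K" "Y \<in> Ob0 K" "Z \<in> Ob0 K"
    and f: "f \<in> Ob (H W X)" "f' \<in> Ob (H W X)" "\<alpha> \<in> Hom (H W X) f f'"
    and g: "g \<in> Ob (H X Y)" "g' \<in> Ob (H X Y)" "\<beta> \<in> Hom (H X Y) g g'"
    and h: "h \<in> Ob (H Y Z)" "h' \<in> Ob (H Y Z)" "\<gamma> \<in> Hom (H Y Z) h h'"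
  shows "FArr (CompF K W X Z) (co X Y Z h g, f) (co X Y Z h' g', f') (FArr (CompF K X Y Z) (h, g) (h', g') (\<gamma>, \<beta>), \<alpha>) =
    FArr (CompF K W Y Z) (h, co W X Y g f) (h', co W X Y g' f') (\<gamma>, FArr (CompF K W X Y) (g, f) (g', f') (\<beta>, \<alpha>))"
proof -
  let ?c = "Comp (H W Z)"
  let ?g = "Pre W X Z f" and ?h' = "Post W Y Z h'"
  note OW = O(1,2,3) and OX = O(2,3,4) and OY = O(1,3,4) and OZ = O(1,2,4)
  note hg = co_Ob[OF OX g(1) h(1)] and h'g = co_Ob[OF OX g(1) h(2)] and h'g' = co_Ob[OF OX g(2) h(2)]
    and gf = co_Ob[OF OW f(1) g(1)] and g'f = co_Ob[OF OW f(1) g(2)] and g'f' = co_Ob[OF OW f(2) g(2)]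
  note cWZ = cat[OF O(1,4)] and cXZ = cat[OF O(2,4)] and cWY = cat[OF O(1,3)]
  note m1 = Pre_Hom[OF OX g(1) h] and m2 = Post_Hom[OF OX h(2) g]
  note n1 = Pre_Hom[OF OW f(1) g] and n2 = Post_Hom[OF OW g(2) f]
  let ?A = "FArr (Post W X Z (co X Y Z h' g')) f f' \<alpha>"
    and ?B = "FArr ?g (co X Y Z h' g) (co X Y Z h' g') (FArr (Post X Y Z h') g g' \<beta>)"
    and ?D = "FArr (Pre W Y Z (co W X Y g f)) h h' \<gamma>"
  let ?x0 = "co W X Z (co X Y Z h g) f" and ?x1 = "co W X Z (co X Y Z h' g) f" and ?x2 = "co W X Z (co X Y Z h' g') f"
    and ?x3 = "co W X Z (co X Y Z h' g') f'"
  note ob = co_Ob[OF OZ f(1) hg] co_Ob[OF OZ f(1) h'g] co_Ob[OF OZ f(1) h'g'] co_Ob[OF OZ f(2) h'g']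
  note A = Post_Hom[OF OZ h'g' f] and B = Pre_Hom[OF OZ f(1) h'g h'g' m2]
  have D: "?D \<in> Hom (H W Z) ?x0 ?x1"
    using Pre_Hom[OF OZ f(1) hg h'g m1] by (simp add: Pre_Pre[OF O f(1) g(1) h])
  have "FArr (CompF K W X Z) (co X Y Z h g, f) (co X Y Z h' g', f') (FArr (CompF K X Y Z) (h, g) (h', g') (\<gamma>, \<beta>), \<alpha>) =
      ?c ?x0 ?x2 ?x3 ?A (FArr ?g (co X Y Z h g) (co X Y Z h' g')
        (Comp (H X Z) (co X Y Z h g) (co X Y Z h' g) (co X Y Z h' g') (FArr (Post X Y Z h') g g' \<beta>) (FArr (Pre X Y Z g) h h' \<gamma>)))"
    unfolding hcomp[OF OX g(1,2) h(1,2) g(3) h(3)]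
    by (rule hcomp[OF OZ f(1,2) hg h'g' f(3) categoryD(2)[OF cXZ hg h'g h'g' m1 m2]])
  also have "FArr ?g (co X Y Z h g) (co X Y Z h' g')
        (Comp (H X Z) (co X Y Z h g) (co X Y Z h' g) (co X Y Z h' g') (FArr (Post X Y Z h') g g' \<beta>) (FArr (Pre X Y Z g) h h' \<gamma>)) =
      ?c ?x0 ?x1 ?x2 ?B ?D"
    unfolding Pre_Comp[OF OZ f(1) hg h'g h'g' m1 m2] Pre_Pre[OF O f(1) g(1) h] ..
  finally have 1: "FArr (CompF K W X Z) (co X Y Z h g, f) (co X Y Z h' g', f') (FArr (CompF K X Y Z) (h, g) (h', g') (\<gamma>, \<beta>), \<alpha>) =
      ?c ?x0 ?x2 ?x3 ?A (?c ?x0 ?x1 ?x2 ?B ?D)" .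
  have "FArr (CompF K W Y Z) (h, co W X Y g f) (h', co W X Y g' f') (\<gamma>, FArr (CompF K W X Y) (g, f) (g', f') (\<beta>, \<alpha>)) =
      ?c (co W Y Z h (co W X Y g f)) (co W Y Z h' (co W X Y g f)) (co W Y Z h' (co W X Y g' f'))
        (FArr ?h' (co W X Y g f) (co W X Y g' f') (Comp (H W Y) (co W X Y g f) (co W X Y g' f) (co W X Y g' f')
          (FArr (Post W X Y g') f f' \<alpha>) (FArr (Pre W X Y f) g g' \<beta>))) ?D"
    unfolding hcomp[OF OW f(1,2) g(1,2) f(3) g(3)]
    by (rule hcomp[OF OY gf g'f' h(1,2) categoryD(2)[OF cWY gf g'f g'f' n1 n2] h(3)])
  also have "\<dots> = ?c ?x0 ?x1 ?x3 (?c ?x1 ?x2 ?x3 ?A ?B) ?D"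
    unfolding Post_Comp[OF OY h(2) gf g'f g'f' n1 n2] Post_Post[OF O g(2) h(2) f] Post_Pre[OF O f(1) h(2) g]
    using co_assoc[OF O f(1) g(1) h(1)] co_assoc[OF O f(1) g(1) h(2)] co_assoc[OF O f(2) g(2) h(2)] co_assoc[OF O f(1) g(2) h(2)] by simp
  also have "\<dots> = ?c ?x0 ?x2 ?x3 ?A (?c ?x0 ?x1 ?x2 ?B ?D)"
    by (rule categoryD(5)[OF cWZ ob D B A])
  finally show ?thesis using 1 by simp
qed

theorem two_category: "two_category K"
  unfolding two_category_def
proof (intro conjI ballI)
  fix X Y f f' \<alpha>
  assume X: "X \<in> Ob0 K" and Y: "Y \<in> Ob0 K" and f: "f \<in> Ob (HomCat K X Y)" "f' \<in> Ob (HomCat K X Y)"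
    and \<alpha>: "\<alpha> \<in> Hom (HomCat K X Y) f f'"
  then have f: "f \<in> Ob (H X Y)" "f' \<in> Ob (H X Y)" "\<alpha> \<in> Hom (H X Y) f f'" by (simp_all add: H_def)
  note uX = unit[OF X] and uY = unit[OF Y] and c = cat[OF X Y]
  have "FArr (CompF K X X Y) (f, Unit K X) (f', Unit K X) (\<alpha>, Id (H X X) (Unit K X)) = Comp (H X Y) f f' f' (Id (H X Y) f') \<alpha>"
    using hcomp[OF X X Y uX uX f(1,2) categoryD(1)[OF cat[OF X X] uX] f(3)] Pre_unit[OF X Y f]
      Post_Id[OF X X Y f(2) uX] co_unit[OF X Y f(1)] co_unit[OF X Y f(2)] by simp
  then show "FArr (CompF K X X Y) (f, Unit K X) (f', Unit K X) (\<alpha>, Id (HomCat K X X) (Unit K X)) = \<alpha>"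
    using categoryD(4)[OF c f] by (simp add: H_def)
  have "FArr (CompF K X Y Y) (Unit K Y, f) (Unit K Y, f') (Id (H Y Y) (Unit K Y), \<alpha>) = Comp (H X Y) f f f' \<alpha> (Id (H X Y) f)"
    using hcomp[OF X Y Y f(1,2) uY uY f(3) categoryD(1)[OF cat[OF Y Y] uY]] Post_unit[OF X Y f]
      Pre_Id[OF X Y Y f(1) uY] co_unit[OF X Y f(1)] co_unit[OF X Y f(2)] by simp
  then show "FArr (CompF K X Y Y) (Unit K Y, f) (Unit K Y, f') (Id (HomCat K Y Y) (Unit K Y), \<alpha>) = \<alpha>"
    using categoryD(3)[OF c f] by (simp add: H_def)
next
  show "is_functor (prod_cat (HomCat K Y Z) (HomCat K X Y)) (HomCat K X Z) (CompF K X Y Z)"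
    if "X \<in> Ob0 K" "Y \<in> Ob0 K" "Z \<in> Ob0 K" for X Y Z
    using CompF_functor[OF that] by (simp add: H_def)
qed (use cat unit co_unit co_assoc hcomp_assoc in \<open>simp_all add: H_def co_def\<close>)

end

section \<open>The 2-category of quasicategories\<close>

lemma Simp_sexp: "Simp (sexp X Y) n = sHom (sprod (std_simplex n) X) Y"
  by (simp add: sexp_def)

lemma esimpD:
  assumes "u \<in> Simp (sexp X Y) n"
  shows "\<sigma> \<in> Delta k n \<Longrightarrow> x \<in> Simp X k \<Longrightarrow> u k (\<sigma>, x) \<in> Simp Y k"
    and "\<theta> \<in> Delta l k \<Longrightarrow> \<sigma> \<in> Delta k n \<Longrightarrow> x \<in> Simp X k \<Longrightarrow>
       u l (compose {..l} \<sigma> \<theta>, Act X l k \<theta> x) = Act Y l k \<theta> (u k (\<sigma>, x))"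
    and "\<not> (\<sigma> \<in> Delta k n \<and> x \<in> Simp X k) \<Longrightarrow> u k (\<sigma>, x) = undefined"
  using assms unfolding Simp_sexp esimp_iff by (blast, blast, auto simp: extensional_def)

lemma esimpI:
  assumes "\<And>k \<sigma> x. \<sigma> \<in> Delta k n \<Longrightarrow> x \<in> Simp X k \<Longrightarrow> u k (\<sigma>, x) \<in> Simp Y k"
    and "\<And>k l \<theta> \<sigma> x. \<theta> \<in> Delta l k \<Longrightarrow> \<sigma> \<in> Delta k n \<Longrightarrow> x \<in> Simp X k \<Longrightarrow>
       u l (compose {..l} \<sigma> \<theta>, Act X l k \<theta> x) = Act Y l k \<theta> (u k (\<sigma>, x))"
    and "\<And>k. u k \<in> extensional (Delta k n \<times> Simp X k)"
  shows "u \<in> Simp (sexp X Y) n"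
  unfolding Simp_sexp esimp_iff using assms by blast

lemma Act_sexp:
  "\<theta> \<in> Delta m n \<Longrightarrow> u \<in> Simp (sexp X Y) n \<Longrightarrow>
   Act (sexp X Y) m n \<theta> u = (\<lambda>k. \<lambda>(\<sigma>, x)\<in>Delta k m \<times> Simp X k. u k (compose {..k} \<theta> \<sigma>, x))"
  by (simp add: sexp_def)

lemma sname_in: "simplicial_set X \<Longrightarrow> f \<in> sHom X Y \<Longrightarrow> sname X f \<in> Simp (sexp X Y) 0"
  using bij_betw_sname by (rule bij_betw_apply)

lemma sconst_sname:
  assumes X: "simplicial_set X" and f: "f \<in> sHom X Y"
  shows "sconst (sexp X Y) (sname X f) n = (\<lambda>k. \<lambda>(\<sigma>, x)\<in>Delta k n \<times> Simp X k. f k x)"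
  unfolding sconst_def Act_sexp[OF Delta_0 sname_in[OF X f]]
  using compose_Delta[OF _ Delta_0] by (auto simp: sname_def fun_eq_iff)

text \<open>
  The morphism \<open>[X, g] : [X, Y] \<rightarrow> [X, Z]\<close>, the counterpart of \<open>sexp_pre\<close> in the other variable.
\<close>

definition sexp_post :: "'a sset \<Rightarrow> 'b sset \<Rightarrow> ('b, 'c) smap \<Rightarrow> (('a, 'b) esimp, ('a, 'c) esimp) smap" where
  "sexp_post X Y g = (\<lambda>n. \<lambda>u\<in>Simp (sexp X Y) n. \<lambda>k. \<lambda>(\<sigma>, x)\<in>Delta k n \<times> Simp X k. g k (u k (\<sigma>, x)))"

lemma sexp_comp_sHom:
  assumes X: "simplicial_set X" and Y: "simplicial_set Y"
  shows "sexp_comp X Y Z \<in> sHom (sprod (sexp Y Z) (sexp X Y)) (sexp X Z)"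
proof (rule sHomI)
  have mem: "(\<lambda>k. \<lambda>(\<sigma>, x)\<in>Delta k n \<times> Simp X k. v k (\<sigma>, u k (\<sigma>, x))) \<in> Simp (sexp X Z) n"
    if v: "v \<in> Simp (sexp Y Z) n" and u: "u \<in> Simp (sexp X Y) n" for v u n
  proof (rule esimpI)
    fix k l \<theta> \<sigma> x assume "\<theta> \<in> Delta l k" "\<sigma> \<in> Delta k n" "x \<in> Simp X k"
    then show "(\<lambda>(\<sigma>, x)\<in>Delta l n \<times> Simp X l. v l (\<sigma>, u l (\<sigma>, x))) (compose {..l} \<sigma> \<theta>, Act X l k \<theta> x) =
       Act Z l k \<theta> ((\<lambda>(\<sigma>, x)\<in>Delta k n \<times> Simp X k. v k (\<sigma>, u k (\<sigma>, x))) (\<sigma>, x))"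
      using esimpD[OF u] esimpD[OF v] compose_Delta Act_in[OF X] by simp
  qed (use esimpD[OF u] esimpD[OF v] in auto)
  show "sexp_comp X Y Z n x \<in> Simp (sexp X Z) n" if "x \<in> Simp (sprod (sexp Y Z) (sexp X Y)) n" for n x
    using that mem by (auto simp: sexp_comp_def sprod_simps)
  show "sexp_comp X Y Z n x = undefined" if "x \<notin> Simp (sprod (sexp Y Z) (sexp X Y)) n" for n x
    using that by (auto simp: sexp_comp_def sprod_simps)
  fix m n \<theta> p assume t: "\<theta> \<in> Delta m n" and "p \<in> Simp (sprod (sexp Y Z) (sexp X Y)) n"
  then obtain v u where p: "p = (v, u)" and v: "v \<in> Simp (sexp Y Z) n" and u: "u \<in> Simp (sexp X Y) n"
    by (cases p) (auto simp: sprod_simps)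
  have a: "Act (sexp Y Z) m n \<theta> v \<in> Simp (sexp Y Z) m" "Act (sexp X Y) m n \<theta> u \<in> Simp (sexp X Y) m"
    using Act_in[OF simplicial_set_sexp[OF Y] t v] Act_in[OF simplicial_set_sexp[OF X] t u] by simp_all
  show "sexp_comp X Y Z m (Act (sprod (sexp Y Z) (sexp X Y)) m n \<theta> p) =
      Act (sexp X Z) m n \<theta> (sexp_comp X Y Z n p)"
  proof -
    have "sexp_comp X Y Z m (Act (sprod (sexp Y Z) (sexp X Y)) m n \<theta> p) =
        (\<lambda>k. \<lambda>(\<sigma>, x)\<in>Delta k m \<times> Simp X k. Act (sexp Y Z) m n \<theta> v k (\<sigma>, Act (sexp X Y) m n \<theta> u k (\<sigma>, x)))"
      using a by (simp add: p sprod_simps(2)[OF t v u] sexp_comp_def)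
    also have "\<dots> = (\<lambda>k. \<lambda>(\<sigma>, x)\<in>Delta k m \<times> Simp X k. v k (compose {..k} \<theta> \<sigma>, u k (compose {..k} \<theta> \<sigma>, x)))"
      using esimpD(1)[OF u] compose_Delta[OF _ t] by (auto simp: Act_sexp[OF t] u v fun_eq_iff)
    also have "\<dots> = Act (sexp X Z) m n \<theta> (sexp_comp X Y Z n p)"
      using u v mem[OF v u] compose_Delta[OF _ t] by (auto simp: p sexp_comp_def Act_sexp[OF t] fun_eq_iff)
    finally show ?thesis .
  qed
qed

text \<open>
  Precomposition with \<open>f\<close> is the composition morphism restricted to the slice at the vertex \<open>f\<close>, and dually for
  postcomposition. This identifies the two halves of a horizontal composite with whiskerings.
\<close>

lemma sexp_pre_eq:
  assumes X: "simplicial_set X" and Y: "simplicial_set Y" and f: "f \<in> sHom X Y"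
  shows "scomp (sexp Y Z) (sexp_comp X Y Z) (sset_product.inl (sexp Y Z) (sexp X Y) (sname X f)) = sexp_pre X Y f Z"
proof (intro ext)
  interpret sset_product "sexp Y Z" "sexp X Y"
    by unfold_locales (rule simplicial_set_sexp[OF Y] simplicial_set_sexp[OF X])+
  fix n v k p
  show "scomp (sexp Y Z) (sexp_comp X Y Z) (inl (sname X f)) n v k p = sexp_pre X Y f Z n v k p"
    using sconst_in[OF B sname_in[OF X f], of n]
    by (auto simp: scomp_def compose_def sexp_comp_def inl_def sexp_pre_def sconst_sname[OF X f])
qed

lemma sexp_post_eq:
  assumes X: "simplicial_set X" and Y: "simplicial_set Y" and g: "g \<in> sHom Y Z"
  shows "scomp (sexp X Y) (sexp_comp X Y Z) (sset_product.inr (sexp Y Z) (sexp X Y) (sname Y g)) = sexp_post X Y g"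
proof (intro ext)
  interpret sset_product "sexp Y Z" "sexp X Y"
    by unfold_locales (rule simplicial_set_sexp[OF Y] simplicial_set_sexp[OF X])+
  fix n u k p
  show "scomp (sexp X Y) (sexp_comp X Y Z) (inr (sname Y g)) n u k p = sexp_post X Y g n u k p"
    using sconst_in[OF A sname_in[OF Y g], of n] esimpD(1)[of u X Y n]
    by (auto simp: scomp_def compose_def sexp_comp_def inr_def sexp_post_def sconst_sname[OF Y g])
qed

lemma
  assumes X: "simplicial_set X" and Y: "simplicial_set Y"
  shows sexp_pre_sHom: "f \<in> sHom X Y \<Longrightarrow> sexp_pre X Y f Z \<in> sHom (sexp Y Z) (sexp X Z)"
    and sexp_post_sHom: "g \<in> sHom Y Z \<Longrightarrow> sexp_post X Y g \<in> sHom (sexp X Y) (sexp X Z)"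
proof -
  interpret sset_product "sexp Y Z" "sexp X Y"
    by unfold_locales (rule simplicial_set_sexp[OF Y] simplicial_set_sexp[OF X])+
  show "f \<in> sHom X Y \<Longrightarrow> sexp_pre X Y f Z \<in> sHom (sexp Y Z) (sexp X Z)"
    using scomp_sHom[OF A inl_sHom[OF sname_in[OF X]] sexp_comp_sHom[OF X Y]] by (simp add: sexp_pre_eq[OF X Y])
  show "g \<in> sHom Y Z \<Longrightarrow> sexp_post X Y g \<in> sHom (sexp X Y) (sexp X Z)"
    using scomp_sHom[OF B inr_sHom[OF sname_in[OF Y]] sexp_comp_sHom[OF X Y]] by (simp add: sexp_post_eq[OF X Y])
qed

lemma sexp_pre_sname:
  assumes "simplicial_set X" "simplicial_set Y" "f \<in> sHom X Y" "g \<in> sHom Y Z"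
  shows "sexp_pre X Y f Z 0 (sname Y g) = sname X (scomp X g f)"
  using sname_in[OF assms(2,4)] sHomD(1)[OF assms(3)]
  by (auto simp: sexp_pre_def sname_def scomp_apply fun_eq_iff)

lemma sexp_post_sname:
  assumes "simplicial_set X" "f \<in> sHom X Y"
  shows "sexp_post X Y g 0 (sname X f) = sname X (scomp X g f)"
  using sname_in[OF assms]
  by (auto simp: sexp_post_def sname_def scomp_apply fun_eq_iff)

lemma sexp_pre_sid: "sexp_pre X X (sid X) Z = sid (sexp X Z)"
proof (intro ext)
  fix n u k p show "sexp_pre X X (sid X) Z n u k p = sid (sexp X Z) n u k p"
    using esimpD(3)[of u X Z n _ k] by (cases p) (auto simp: sexp_pre_def sid_def)
qed

lemma sexp_post_sid: "sexp_post X Y (sid Y) = sid (sexp X Y)"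
proof (intro ext)
  fix n u k p show "sexp_post X Y (sid Y) n u k p = sid (sexp X Y) n u k p"
    using esimpD(1,3)[of u X Y n _ k] by (cases p) (auto simp: sexp_post_def sid_def)
qed

lemma sexp_pre_pre:
  assumes W: "simplicial_set W" and X: "simplicial_set X" and Y: "simplicial_set Y"
    and f: "f \<in> sHom W X" and g: "g \<in> sHom X Y"
  shows "scomp (sexp Y Z) (sexp_pre W X f Z) (sexp_pre X Y g Z) = sexp_pre W Y (scomp W g f) Z"
proof (intro ext)
  fix n u k p
  show "scomp (sexp Y Z) (sexp_pre W X f Z) (sexp_pre X Y g Z) n u k p = sexp_pre W Y (scomp W g f) Z n u k p"
  proof (cases "u \<in> Simp (sexp Y Z) n")
    case True
    then show ?thesis
      using sHomD(1)[OF sexp_pre_sHom[OF X Y g] True] sHomD(1)[OF f]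
      by (auto simp: scomp_apply sexp_pre_def)
  qed (simp add: scomp_def compose_def sexp_pre_def)
qed

lemma sexp_post_post:
  assumes W: "simplicial_set W" and X: "simplicial_set X" and Y: "simplicial_set Y"
    and g: "g \<in> sHom X Y" and h: "h \<in> sHom Y Z"
  shows "scomp (sexp W X) (sexp_post W Y h) (sexp_post W X g) = sexp_post W X (scomp X h g)"
proof (intro ext)
  fix n u k p
  show "scomp (sexp W X) (sexp_post W Y h) (sexp_post W X g) n u k p = sexp_post W X (scomp X h g) n u k p"
  proof (cases "u \<in> Simp (sexp W X) n")
    case True
    then show ?thesis
      using sHomD(1)[OF sexp_post_sHom[OF W X g] True] esimpD(1)[OF True]
      by (auto simp: scomp_apply sexp_post_def)
  qed (simp add: scomp_def compose_def sexp_post_def)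
qed

lemma sexp_post_pre:
  assumes W: "simplicial_set W" and X: "simplicial_set X" and Y: "simplicial_set Y"
    and f: "f \<in> sHom W X" and h: "h \<in> sHom Y Z"
  shows "scomp (sexp X Y) (sexp_post W Y h) (sexp_pre W X f Y) = scomp (sexp X Y) (sexp_pre W X f Z) (sexp_post X Y h)"
proof (intro ext)
  fix n u k p
  show "scomp (sexp X Y) (sexp_post W Y h) (sexp_pre W X f Y) n u k p = scomp (sexp X Y) (sexp_pre W X f Z) (sexp_post X Y h) n u k p"
  proof (cases "u \<in> Simp (sexp X Y) n")
    case True
    then show ?thesis
      using sHomD(1)[OF sexp_pre_sHom[OF W X f] True] sHomD(1)[OF sexp_post_sHom[OF X Y h] True] sHomD(1)[OF f]
      by (auto simp: scomp_apply sexp_post_def sexp_pre_def)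
  qed (simp add: scomp_def compose_def)
qed

lemma scomp_assoc: "f \<in> sHom W X \<Longrightarrow> scomp W (scomp X h g) f = scomp W h (scomp W g f)"
  by (auto simp: scomp_def compose_def fun_eq_iff sHomD)

lemma scomp_sid: "f \<in> sHom X Y \<Longrightarrow> scomp X f (sid X) = f" "f \<in> sHom X Y \<Longrightarrow> scomp X (sid Y) f = f"
  by (auto simp: scomp_def compose_def fun_eq_iff sid_def sHomD)

subsection \<open>Whiskering in the 2-category of quasicategories\<close>

definition qcat_pre :: "'a sset \<Rightarrow> 'b sset \<Rightarrow> 'c sset \<Rightarrow> ('a, 'b) smap \<Rightarrow>
    (('b, 'c) smap, ('b, 'c) two_cell, ('a, 'c) smap, ('a, 'c) two_cell) fctr" where
  "qcat_pre X Y Z f = \<lparr>FOb = (\<lambda>g. scomp X g f),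
     FArr = (\<lambda>g g'. FArr (tau1_functor (sexp X Z) (sexp_pre X Y f Z)) (sname Y g) (sname Y g'))\<rparr>"

definition qcat_post :: "'a sset \<Rightarrow> 'b sset \<Rightarrow> 'c sset \<Rightarrow> ('b, 'c) smap \<Rightarrow>
    (('a, 'b) smap, ('a, 'b) two_cell, ('a, 'c) smap, ('a, 'c) two_cell) fctr" where
  "qcat_post X Y Z g = \<lparr>FOb = (\<lambda>f. scomp X g f),
     FArr = (\<lambda>f f'. FArr (tau1_functor (sexp X Z) (sexp_post X Y g)) (sname X f) (sname X f'))\<rparr>"

lemma qcat_hom_simps:
  "Ob (qcat_hom X Y) = sHom X Y"
  "Hom (qcat_hom X Y) f g = Hom (tau1 (sexp X Y)) (sname X f) (sname X g)"
  "Id (qcat_hom X Y) f = Id (tau1 (sexp X Y)) (sname X f)"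
  "Comp (qcat_hom X Y) f g h = Comp (tau1 (sexp X Y)) (sname X f) (sname X g) (sname X h)"
  by (simp_all add: qcat_hom_def)

lemma category_qcat_hom:
  assumes X: "simplicial_set X"
  shows "category (qcat_hom X Y)"
  unfolding category_def qcat_hom_simps
  by (simp add: categoryD[OF category_tau1] sname_in[OF X])

lemma is_functor_qcat_hom:
  assumes X: "simplicial_set X" and Y: "simplicial_set Y" and p: "p \<in> sHom (sexp X V) (sexp Y W)"
    and h: "\<And>f. f \<in> sHom X V \<Longrightarrow> h f \<in> sHom Y W"
    and ph: "\<And>f. f \<in> sHom X V \<Longrightarrow> p 0 (sname X f) = sname Y (h f)"
  shows "is_functor (qcat_hom X V) (qcat_hom Y W)
    \<lparr>FOb = h, FArr = (\<lambda>f g. FArr (tau1_functor (sexp Y W) p) (sname X f) (sname X g))\<rparr>"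
proof -
  note F = is_functor_tau1[OF simplicial_set_sexp[OF X] simplicial_set_sexp[OF Y] p]
  note n = sname_in[OF X, of _ V] and o = category_qcat_hom[OF X, of V] category_qcat_hom[OF Y, of W]
  have "FArr (tau1_functor (sexp Y W) p) (sname X f) (sname X g) \<alpha> \<in> Hom (tau1 (sexp Y W)) (sname Y (h f)) (sname Y (h g))"
    if "f \<in> sHom X V" "g \<in> sHom X V" "\<alpha> \<in> Hom (tau1 (sexp X V)) (sname X f) (sname X g)" for f g \<alpha>
    using is_functorD(4)[OF F, of "sname X f" "sname X g" \<alpha>] n that by (simp add: ph)
  moreover have "FArr (tau1_functor (sexp Y W) p) (sname X f) (sname X f) (Id (tau1 (sexp X V)) (sname X f)) =
      Id (tau1 (sexp Y W)) (sname Y (h f))" if "f \<in> sHom X V" for f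
    using is_functorD(5)[OF F, of "sname X f"] n that by (simp add: ph)
  ultimately show ?thesis
    unfolding is_functor_def using o h n is_functorD(6)[OF F] by (simp add: qcat_hom_simps flip: ph)
qed

lemma is_functor_qcat_pre:
  assumes X: "simplicial_set X" and Y: "simplicial_set Y" and f: "f \<in> sHom X Y"
  shows "is_functor (qcat_hom Y Z) (qcat_hom X Z) (qcat_pre X Y Z f)"
  unfolding qcat_pre_def
  by (rule is_functor_qcat_hom[OF Y X sexp_pre_sHom[OF X Y f] scomp_sHom[OF X f] sexp_pre_sname[OF X Y f]])

lemma is_functor_qcat_post:
  assumes X: "simplicial_set X" and Y: "simplicial_set Y" and g: "g \<in> sHom Y Z"
  shows "is_functor (qcat_hom X Y) (qcat_hom X Z) (qcat_post X Y Z g)"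
  unfolding qcat_post_def
  by (rule is_functor_qcat_hom[OF X X sexp_post_sHom[OF X Y g] scomp_sHom[OF X _ g] sexp_post_sname[OF X]])

text \<open>
  A pair of 2-cells is the composite of an arrow in one slice and an arrow in another, and composition maps
  the slices by whiskering. The two ways of passing through the slices give interchange.
\<close>

lemma qcat_hcomp:
  assumes X: "simplicial_set X" and Y: "simplicial_set Y" and Z: "simplicial_set Z"
    and f: "f \<in> sHom X Y" "f' \<in> sHom X Y" "\<alpha> \<in> Hom (qcat_hom X Y) f f'"
    and g: "g \<in> sHom Y Z" "g' \<in> sHom Y Z" "\<beta> \<in> Hom (qcat_hom Y Z) g g'"
  shows "FArr (qcat_comp X Y Z) (g, f) (g', f') (\<beta>, \<alpha>) =
      Comp (qcat_hom X Z) (scomp X g f) (scomp X g' f) (scomp X g' f')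
        (FArr (qcat_post X Y Z g') f f' \<alpha>) (FArr (qcat_pre X Y Z f) g g' \<beta>)"
    and "Comp (qcat_hom X Z) (scomp X g f) (scomp X g' f) (scomp X g' f')
        (FArr (qcat_post X Y Z g') f f' \<alpha>) (FArr (qcat_pre X Y Z f) g g' \<beta>) =
      Comp (qcat_hom X Z) (scomp X g f) (scomp X g f') (scomp X g' f')
        (FArr (qcat_pre X Y Z f') g g' \<beta>) (FArr (qcat_post X Y Z g) f f' \<alpha>)"
proof -
  interpret sset_product "sexp Y Z" "sexp X Y"
    by unfold_locales (rule simplicial_set_sexp[OF Y] simplicial_set_sexp[OF X])+
  note S = simplicial_set_sexp[OF X, of Z] and c = sexp_comp_sHom[OF X Y, of Z]
  note F = is_functor_tau1[OF AB S c]
  let ?c = "FArr (tau1_functor (sexp X Z) (sexp_comp X Y Z))"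
  note a = f(3)[unfolded qcat_hom_simps] and b = g(3)[unfolded qcat_hom_simps]
  note nf = sname_in[OF X f(1)] sname_in[OF X f(2)] and ng = sname_in[OF Y g(1)] sname_in[OF Y g(2)]
  have c0: "sexp_comp X Y Z 0 (sname Y g, sname X f) = sname X (scomp X g f)"
    if g: "g \<in> sHom Y Z" and f: "f \<in> sHom X Y" for f g
    using sname_in[OF X f] sname_in[OF Y g] sHomD(1)[OF f]
    by (auto simp: sexp_comp_def sname_def scomp_apply fun_eq_iff)
  have pre: "?c (sname Y g, sname X f) (sname Y g', sname X f) (L (sname X f) (sname Y g) (sname Y g') \<beta>) =
      FArr (qcat_pre X Y Z f) g g' \<beta>" if f: "f \<in> sHom X Y" for f
    using tau1_scomp[OF A AB S inl_sHom[OF sname_in[OF X f]] c b] ng sname_in[OF X f]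
    by (simp add: qcat_pre_def sexp_pre_eq[OF X Y f] inl_0)
  have post: "?c (sname Y g, sname X f) (sname Y g, sname X f') (R (sname Y g) (sname X f) (sname X f') \<alpha>) =
      FArr (qcat_post X Y Z g) f f' \<alpha>" if g: "g \<in> sHom Y Z" for g
    using tau1_scomp[OF B AB S inr_sHom[OF sname_in[OF Y g]] c a] nf sname_in[OF Y g]
    by (simp add: qcat_post_def sexp_post_eq[OF X Y g] inr_0)
  have 1: "?c (sname Y g, sname X f) (sname Y g', sname X f')
      (Comp C (sname Y g, sname X f) (sname Y g', sname X f) (sname Y g', sname X f')
        (R (sname Y g') (sname X f) (sname X f') \<alpha>) (L (sname X f) (sname Y g) (sname Y g') \<beta>)) =
      Comp (qcat_hom X Z) (scomp X g f) (scomp X g' f) (scomp X g' f')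
        (FArr (qcat_post X Y Z g') f f' \<alpha>) (FArr (qcat_pre X Y Z f) g g' \<beta>)"
    using is_functorD(6)[OF F _ _ _ L_Hom[OF nf(1) b] R_Hom[OF ng(2) a]] nf ng f g
    by (simp add: sprod_simps qcat_hom_simps pre post c0)
  have 2: "?c (sname Y g, sname X f) (sname Y g', sname X f')
      (Comp C (sname Y g, sname X f) (sname Y g, sname X f') (sname Y g', sname X f')
        (L (sname X f') (sname Y g) (sname Y g') \<beta>) (R (sname Y g) (sname X f) (sname X f') \<alpha>)) =
      Comp (qcat_hom X Z) (scomp X g f) (scomp X g f') (scomp X g' f')
        (FArr (qcat_pre X Y Z f') g g' \<beta>) (FArr (qcat_post X Y Z g) f f' \<alpha>)"
    using is_functorD(6)[OF F _ _ _ R_Hom[OF ng(1) a] L_Hom[OF nf(2) b]] nf ng f g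
    by (simp add: sprod_simps qcat_hom_simps pre post c0)
  show "FArr (qcat_comp X Y Z) (g, f) (g', f') (\<beta>, \<alpha>) =
      Comp (qcat_hom X Z) (scomp X g f) (scomp X g' f) (scomp X g' f')
        (FArr (qcat_post X Y Z g') f f' \<alpha>) (FArr (qcat_pre X Y Z f) g g' \<beta>)"
    by (simp add: qcat_comp_def tau1_pair_eq[OF b a] 1)
  show "Comp (qcat_hom X Z) (scomp X g f) (scomp X g' f) (scomp X g' f')
        (FArr (qcat_post X Y Z g') f f' \<alpha>) (FArr (qcat_pre X Y Z f) g g' \<beta>) =
      Comp (qcat_hom X Z) (scomp X g f) (scomp X g f') (scomp X g' f')
        (FArr (qcat_pre X Y Z f') g g' \<beta>) (FArr (qcat_post X Y Z g) f f' \<alpha>)"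
    using 1 2 interchange[OF b a] by simp
qed

lemma Ob_Qcat: "Ob Qcat = {X. small_sset X \<and> quasicategory X}"
  by (simp add: Qcat_def sSet_def full_subcat_def)

lemma Qcat_simplicial: "X \<in> Ob Qcat \<Longrightarrow> simplicial_set X"
  by (simp add: Ob_Qcat small_sset_def)

lemma QCAT_simps: "Ob0 QCAT = Ob Qcat" "HomCat QCAT = qcat_hom" "Unit QCAT = sid" "CompF QCAT = qcat_comp"
  by (simp_all add: QCAT_def)

lemma FOb_qcat_comp: "FOb (qcat_comp X Y Z) (g, f) = scomp X g f"
  by (simp add: qcat_comp_def)

text \<open>
  The unit and associativity laws for whiskering are equalities of simplicial maps between exponentials,
  transported along the functoriality of the fundamental category.
\<close>

theorem two_category_QCAT: "two_category QCAT"
proof -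
  note s = Qcat_simplicial
  have sid: "FArr (tau1_functor (sexp X Y) (sid (sexp X Y))) u v c = c"
    if "X \<in> Ob Qcat" "c \<in> Hom (tau1 (sexp X Y)) u v" for X Y :: "'u::universe sset" and u v c
    using tau1_sid[OF simplicial_set_sexp[OF s[OF that(1)]] that(2)] .
  have "whiskering QCAT qcat_pre qcat_post"
  proof (unfold_locales, unfold QCAT_simps qcat_hom_simps(1) FOb_qcat_comp, goal_cases)
    case (1 X Y)
    then show ?case using category_qcat_hom[OF s] by blast
  next
    case (2 X)
    then show ?case using sid_sHom[OF s] by blast
  next
    case (3 X Y Z f)
    then show ?case using is_functor_qcat_pre[OF s s] by blast
  next
    case (4 X Y Z g)
    then show ?case using is_functor_qcat_post[OF s s] by blast
  next
    case (7 X Y Z f f' g g' \<alpha> \<beta>)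
    then show ?case using qcat_hcomp(1)[OF s s s] by blast
  next
    case (8 X Y Z f f' g g' \<alpha> \<beta>)
    then show ?case using qcat_hcomp(2)[OF s s s] by blast
  next
    case (9 X Y f)
    then show ?case using scomp_sid by blast
  next
    case (10 W X Y Z f g h)
    then show ?case using scomp_assoc by blast
  next
    case (11 X Y f f' \<alpha>)
    then show ?case by (simp add: qcat_pre_def sexp_pre_sid sid qcat_hom_simps)
  next
    case (12 X Y f f' \<alpha>)
    then show ?case by (simp add: qcat_post_def sexp_post_sid sid qcat_hom_simps)
  next
    case (13 W X Y Z f g h h' \<gamma>)
    note W = s[OF 13(1)] and X = s[OF 13(2)] and Y = s[OF 13(3)]
    show ?case
      using tau1_scomp[OF simplicial_set_sexp[OF Y] simplicial_set_sexp[OF X] simplicial_set_sexp[OF W]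
          sexp_pre_sHom[OF X Y 13(6)] sexp_pre_sHom[OF W X 13(5)] 13(9)[unfolded qcat_hom_simps]]
      by (simp add: qcat_pre_def sexp_pre_pre[OF W X Y 13(5,6)] sexp_pre_sname[OF X Y 13(6) 13(7)] sexp_pre_sname[OF X Y 13(6) 13(8)])
  next
    case (14 W X Y Z g h f f' \<alpha>)
    note W = s[OF 14(1)] and X = s[OF 14(2)] and Y = s[OF 14(3)]
    show ?case
      using tau1_scomp[OF simplicial_set_sexp[OF W] simplicial_set_sexp[OF W] simplicial_set_sexp[OF W]
          sexp_post_sHom[OF W X 14(5)] sexp_post_sHom[OF W Y 14(6)] 14(9)[unfolded qcat_hom_simps]]
      by (simp add: qcat_post_def sexp_post_post[OF W X Y 14(5,6)] sexp_post_sname[OF W 14(7)] sexp_post_sname[OF W 14(8)])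
  next
    case (15 W X Y Z f h g g' \<beta>)
    note W = s[OF 15(1)] and X = s[OF 15(2)] and Y = s[OF 15(3)]
    note b = 15(9)[unfolded qcat_hom_simps] and S = simplicial_set_sexp
    show ?case
      using tau1_scomp[OF S[OF X] S[OF W] S[OF W] sexp_pre_sHom[OF W X 15(5)] sexp_post_sHom[OF W Y 15(6)] b]
        tau1_scomp[OF S[OF X] S[OF X] S[OF W] sexp_post_sHom[OF X Y 15(6)] sexp_pre_sHom[OF W X 15(5)] b]
      by (simp add: qcat_pre_def qcat_post_def sexp_post_pre[OF W X Y 15(5,6)] sexp_post_sname[OF X 15(7)] sexp_post_sname[OF X 15(8)]
          sexp_pre_sname[OF W X 15(5) 15(7)] sexp_pre_sname[OF W X 15(5) 15(8)])
  qed (simp_all add: qcat_pre_def qcat_post_def)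
  then show ?thesis by (rule whiskering.two_category)
qed

section \<open>The homotopy category of a 2-category\<close>

definition iso_class :: "('o, 'm, 't) two_cat \<Rightarrow> 'o \<Rightarrow> 'o \<Rightarrow> 'm \<Rightarrow> 'm set" where
  "iso_class K X Y f = {g. isomorphic (HomCat K X Y) f g}"

text \<open>
  The isomorphisms of this category are the isomorphism classes of equivalences in the 2-category.
\<close>

definition hcat :: "('o, 'm, 't) two_cat \<Rightarrow> ('o, 'm set) cat" where
  "hcat K = \<lparr>Ob = Ob0 K, Hom = (\<lambda>X Y. iso_class K X Y ` Ob (HomCat K X Y)),
     Id = (\<lambda>X. iso_class K X X (Unit K X)),
     Comp = (\<lambda>X Y Z b a. \<Union>g\<in>b. \<Union>f\<in>a. iso_class K X Z (FOb (CompF K X Y Z) (g, f)))\<rparr>"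

lemma isomorphic_prod:
  assumes "isomorphic C X Y" "isomorphic D X' Y'"
  shows "isomorphic (prod_cat C D) (X, X') (Y, Y')"
proof -
  obtain f g f' g' where "inverse_arrows C X Y f g" "inverse_arrows D X' Y' f' g'"
    using assms unfolding isomorphic_def by (elim conjE exE)
  then have "inverse_arrows (prod_cat C D) (X, X') (Y, Y') (f, f') (g, g')"
    by (simp add: inverse_arrows_def prod_cat_def)
  then have "\<exists>f g. inverse_arrows (prod_cat C D) (X, X') (Y, Y') f g" by (intro exI)
  then show ?thesis using assms by (simp add: isomorphic_def prod_cat_def)
qed

context
  fixes K :: "('o, 'm, 't) two_cat"
  assumes K: "two_category K"
begin

lemma two_categoryD:
  shows "X \<in> Ob0 K \<Longrightarrow> Y \<in> Ob0 K \<Longrightarrow> category (HomCat K X Y)"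
    and "X \<in> Ob0 K \<Longrightarrow> Unit K X \<in> Ob (HomCat K X X)"
    and "X \<in> Ob0 K \<Longrightarrow> Y \<in> Ob0 K \<Longrightarrow> Z \<in> Ob0 K \<Longrightarrow>
      is_functor (prod_cat (HomCat K Y Z) (HomCat K X Y)) (HomCat K X Z) (CompF K X Y Z)"
    and "X \<in> Ob0 K \<Longrightarrow> Y \<in> Ob0 K \<Longrightarrow> f \<in> Ob (HomCat K X Y) \<Longrightarrow>
      FOb (CompF K X X Y) (f, Unit K X) = f \<and> FOb (CompF K X Y Y) (Unit K Y, f) = f"
    and "X \<in> Ob0 K \<Longrightarrow> Y \<in> Ob0 K \<Longrightarrow> f \<in> Ob (HomCat K X Y) \<Longrightarrow> f' \<in> Ob (HomCat K X Y) \<Longrightarrow>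
      \<alpha> \<in> Hom (HomCat K X Y) f f' \<Longrightarrow>
      FArr (CompF K X X Y) (f, Unit K X) (f', Unit K X) (\<alpha>, Id (HomCat K X X) (Unit K X)) = \<alpha> \<and>
      FArr (CompF K X Y Y) (Unit K Y, f) (Unit K Y, f') (Id (HomCat K Y Y) (Unit K Y), \<alpha>) = \<alpha>"
    and "W \<in> Ob0 K \<Longrightarrow> X \<in> Ob0 K \<Longrightarrow> Y \<in> Ob0 K \<Longrightarrow> Z \<in> Ob0 K \<Longrightarrow>
      f \<in> Ob (HomCat K W X) \<Longrightarrow> g \<in> Ob (HomCat K X Y) \<Longrightarrow> h \<in> Ob (HomCat K Y Z) \<Longrightarrow>
       FOb (CompF K W X Z) (FOb (CompF K X Y Z) (h, g), f) =
       FOb (CompF K W Y Z) (h, FOb (CompF K W X Y) (g, f))"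
    and "W \<in> Ob0 K \<Longrightarrow> X \<in> Ob0 K \<Longrightarrow> Y \<in> Ob0 K \<Longrightarrow> Z \<in> Ob0 K \<Longrightarrow>
      f \<in> Ob (HomCat K W X) \<Longrightarrow> g \<in> Ob (HomCat K X Y) \<Longrightarrow> h \<in> Ob (HomCat K Y Z) \<Longrightarrow>
      f' \<in> Ob (HomCat K W X) \<Longrightarrow> g' \<in> Ob (HomCat K X Y) \<Longrightarrow> h' \<in> Ob (HomCat K Y Z) \<Longrightarrow>
      \<alpha> \<in> Hom (HomCat K W X) f f' \<Longrightarrow> \<beta> \<in> Hom (HomCat K X Y) g g' \<Longrightarrow> \<gamma> \<in> Hom (HomCat K Y Z) h h' \<Longrightarrow>
       FArr (CompF K W X Z) (FOb (CompF K X Y Z) (h, g), f) (FOb (CompF K X Y Z) (h', g'), f')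
         (FArr (CompF K X Y Z) (h, g) (h', g') (\<gamma>, \<beta>), \<alpha>) =
       FArr (CompF K W Y Z) (h, FOb (CompF K W X Y) (g, f)) (h', FOb (CompF K W X Y) (g', f'))
         (\<gamma>, FArr (CompF K W X Y) (g, f) (g', f') (\<beta>, \<alpha>))"
  using K by (simp_all add: two_category_def)

lemma CompF_Ob:
  assumes "X \<in> Ob0 K" "Y \<in> Ob0 K" "Z \<in> Ob0 K" "f \<in> Ob (HomCat K X Y)" "g \<in> Ob (HomCat K Y Z)"
  shows "FOb (CompF K X Y Z) (g, f) \<in> Ob (HomCat K X Z)"
  using is_functorD(3)[OF two_categoryD(3)[OF assms(1-3)], of "(g, f)"] assms by (simp add: prod_cat_def)

lemma CompF_isomorphic:
  assumes "X \<in> Ob0 K" "Y \<in> Ob0 K" "Z \<in> Ob0 K" "isomorphic (HomCat K X Y) f f'" "isomorphic (HomCat K Y Z) g g'"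
  shows "isomorphic (HomCat K X Z) (FOb (CompF K X Y Z) (g, f)) (FOb (CompF K X Y Z) (g', f'))"
  using isomorphic_functor[OF two_categoryD(3)[OF assms(1-3)] isomorphic_prod[OF assms(5,4)]] .

lemma iso_class_eq_iff:
  assumes ob: "X \<in> Ob0 K" "Y \<in> Ob0 K" and f: "f \<in> Ob (HomCat K X Y)"
  shows "iso_class K X Y f = iso_class K X Y g \<longleftrightarrow> isomorphic (HomCat K X Y) f g"
proof -
  note c = two_categoryD(1)[OF ob]
  show ?thesis
  proof
    assume "iso_class K X Y f = iso_class K X Y g"
    moreover have "f \<in> iso_class K X Y f" using isomorphic_refl[OF c f] by (simp add: iso_class_def)
    ultimately show "isomorphic (HomCat K X Y) f g" by (simp add: iso_class_def isomorphic_sym)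
  next
    assume fg: "isomorphic (HomCat K X Y) f g"
    show "iso_class K X Y f = iso_class K X Y g"
      unfolding iso_class_def
    proof (intro Collect_cong iffI)
      show "isomorphic (HomCat K X Y) g h" if "isomorphic (HomCat K X Y) f h" for h
        using isomorphic_trans[OF c isomorphic_sym[OF fg] that] .
      show "isomorphic (HomCat K X Y) f h" if "isomorphic (HomCat K X Y) g h" for h
        using isomorphic_trans[OF c fg that] .
    qed
  qed
qed

lemma hcat_Comp:
  assumes ob: "X \<in> Ob0 K" "Y \<in> Ob0 K" "Z \<in> Ob0 K" and f: "f \<in> Ob (HomCat K X Y)" and g: "g \<in> Ob (HomCat K Y Z)"
  shows "Comp (hcat K) X Y Z (iso_class K Y Z g) (iso_class K X Y f) = iso_class K X Z (FOb (CompF K X Y Z) (g, f))"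
proof -
  let ?c = "iso_class K X Z (FOb (CompF K X Y Z) (g, f))"
  have eq: "iso_class K X Z (FOb (CompF K X Y Z) (g', f')) = iso_class K X Z (FOb (CompF K X Y Z) (g, f))"
    if "g' \<in> iso_class K Y Z g" "f' \<in> iso_class K X Y f" for f' g'
  proof -
    have "isomorphic (HomCat K X Z) (FOb (CompF K X Y Z) (g, f)) (FOb (CompF K X Y Z) (g', f'))"
      using that by (intro CompF_isomorphic[OF ob]) (simp_all add: iso_class_def)
    then show ?thesis using iso_class_eq_iff[OF ob(1,3) CompF_Ob[OF ob f g], of "FOb (CompF K X Y Z) (g', f')"] by simp
  qed
  have ne: "g \<in> iso_class K Y Z g" "f \<in> iso_class K X Y f"
    using isomorphic_refl[OF two_categoryD(1)] ob f g by (simp_all add: iso_class_def)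
  have "Comp (hcat K) X Y Z (iso_class K Y Z g) (iso_class K X Y f) =
      (\<Union>g'\<in>iso_class K Y Z g. \<Union>f'\<in>iso_class K X Y f. iso_class K X Z (FOb (CompF K X Y Z) (g', f')))"
    by (simp add: hcat_def)
  also have "\<dots> = (\<Union>g'\<in>iso_class K Y Z g. \<Union>f'\<in>iso_class K X Y f. ?c)"
    by (rule SUP_cong[OF HOL.refl], rule SUP_cong[OF HOL.refl], rule eq)
  also have "\<dots> = ?c" using ne by auto
  finally show ?thesis .
qed

lemma hcat_simps:
  "Ob (hcat K) = Ob0 K" "Hom (hcat K) X Y = iso_class K X Y ` Ob (HomCat K X Y)"
  "Id (hcat K) X = iso_class K X X (Unit K X)"
  by (simp_all add: hcat_def)

lemma category_hcat: "category (hcat K)"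
  unfolding category_def hcat_simps
proof (intro conjI ballI, goal_cases)
  case (1 X)
  then show ?case using two_categoryD(2) by blast
next
  case (2 X Y Z a b)
  from 2(4,5) show ?case by (elim imageE) (use 2(1-3) in \<open>simp add: hcat_Comp CompF_Ob\<close>)
next
  case (3 X Y a)
  from 3(3) show ?case by (elim imageE) (use 3(1,2) in \<open>simp add: hcat_Comp two_categoryD(2,4)\<close>)
next
  case (4 X Y a)
  from 4(3) show ?case by (elim imageE) (use 4(1,2) in \<open>simp add: hcat_Comp two_categoryD(2,4)\<close>)
next
  case (5 W X Y Z a b c)
  from 5(5-7) show ?case
    by (elim imageE) (use 5(1-4) in \<open>simp add: hcat_Comp CompF_Ob two_categoryD(6)\<close>)
qed

lemma category_underlying: "category (underlying_cat K)"
  unfolding category_def underlying_cat_def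
  by (simp add: two_categoryD(2,4,6) CompF_Ob)

lemma equivalent_objects_hcat:
  assumes "isomorphic (hcat K) X Y"
  shows "equivalent_objects K X Y"
proof -
  have ob: "X \<in> Ob0 K" "Y \<in> Ob0 K" using assms by (simp_all add: isomorphic_def hcat_simps)
  obtain a b where ab: "inverse_arrows (hcat K) X Y a b"
    using assms unfolding isomorphic_def by (elim conjE exE)
  have "a \<in> Hom (hcat K) X Y" "b \<in> Hom (hcat K) Y X" using ab by (simp_all add: inverse_arrows_def)
  then obtain f g where f: "f \<in> Ob (HomCat K X Y)" "a = iso_class K X Y f" and g: "g \<in> Ob (HomCat K Y X)" "b = iso_class K Y X g"
    unfolding hcat_simps by (elim imageE)
  have "isomorphic (HomCat K X X) (FOb (CompF K X Y X) (g, f)) (Unit K X)"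
    "isomorphic (HomCat K Y Y) (FOb (CompF K Y X Y) (f, g)) (Unit K Y)"
    using ab hcat_Comp[OF ob ob(1) f(1) g(1)] hcat_Comp[OF ob(2,1) ob(2) g(1) f(1)]
      iso_class_eq_iff[OF ob(1,1) CompF_Ob[OF ob ob(1) f(1) g(1)]]
      iso_class_eq_iff[OF ob(2,2) CompF_Ob[OF ob(2,1) ob(2) g(1) f(1)]]
    by (simp_all add: inverse_arrows_def hcat_simps f g)
  then show ?thesis using ob f(1) g(1) unfolding equivalent_objects_def by (intro conjI bexI)
qed

end

section \<open>Restricting 2-cells along a functor\<close>

text \<open>
  The 2-cells \<open>f \<rightarrow> g\<close> are the 2-cells \<open>F f \<rightarrow> F g\<close> of \<open>K\<close>. All axioms are inherited from \<open>K\<close>, and \<open>F\<close> extends to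
  a 2-functor that is the identity on 2-cells. What remains of a bicategorical equivalence is surjectivity
  on objects up to equivalence and on 1-cells up to isomorphism.
\<close>

context
  fixes K :: "('o, 'm, 't) two_cat" and C :: "('p, 'n, 'z) cat_scheme" and F :: "('p, 'n, 'o, 'm) fctr"
  assumes K: "two_category K" and F: "is_functor C (underlying_cat K) F"
begin

definition pullback_cat :: "('p, 'n, 't) two_cat" where
  "pullback_cat = \<lparr>Ob0 = Ob C,
    HomCat = (\<lambda>X Y. let H = HomCat K (FOb F X) (FOb F Y); F1 = FArr F X Y in
      \<lparr>Ob = Hom C X Y, Hom = (\<lambda>f g. Hom H (F1 f) (F1 g)), Id = (\<lambda>f. Id H (F1 f)),
       Comp = (\<lambda>f g h. Comp H (F1 f) (F1 g) (F1 h))\<rparr>),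
    Unit = Id C,
    CompF = (\<lambda>X Y Z. \<lparr>FOb = (\<lambda>(g, f). Comp C X Y Z g f),
      FArr = (\<lambda>(g, f) (g', f'). FArr (CompF K (FOb F X) (FOb F Y) (FOb F Z))
        (FArr F Y Z g, FArr F X Y f) (FArr F Y Z g', FArr F X Y f'))\<rparr>)\<rparr>"

definition pullback_functor :: "('p, 'n, 't, 'o, 'm, 't) two_fctr" where
  "pullback_functor = \<lparr>F0 = FOb F, FHom = (\<lambda>X Y. \<lparr>FOb = FArr F X Y, FArr = (\<lambda>_ _ \<alpha>. \<alpha>)\<rparr>)\<rparr>"

abbreviation "B \<equiv> pullback_cat"

lemma pullback_simps:
  "Ob0 B = Ob C"
  "Ob (HomCat B X Y) = Hom C X Y"
  "Hom (HomCat B X Y) f g = Hom (HomCat K (FOb F X) (FOb F Y)) (FArr F X Y f) (FArr F X Y g)"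
  "Id (HomCat B X Y) f = Id (HomCat K (FOb F X) (FOb F Y)) (FArr F X Y f)"
  "Comp (HomCat B X Y) f g h = Comp (HomCat K (FOb F X) (FOb F Y)) (FArr F X Y f) (FArr F X Y g) (FArr F X Y h)"
  "Unit B = Id C"
  "FOb (CompF B X Y Z) (g, f) = Comp C X Y Z g f"
  "FArr (CompF B X Y Z) (g, f) (g', f') = FArr (CompF K (FOb F X) (FOb F Y) (FOb F Z))
        (FArr F Y Z g, FArr F X Y f) (FArr F Y Z g', FArr F X Y f')"
  by (simp_all add: pullback_cat_def Let_def)

lemma F_simps:
  "X \<in> Ob C \<Longrightarrow> FOb F X \<in> Ob0 K"
  "X \<in> Ob C \<Longrightarrow> Y \<in> Ob C \<Longrightarrow> f \<in> Hom C X Y \<Longrightarrow> FArr F X Y f \<in> Ob (HomCat K (FOb F X) (FOb F Y))"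
  "X \<in> Ob C \<Longrightarrow> FArr F X X (Id C X) = Unit K (FOb F X)"
  "X \<in> Ob C \<Longrightarrow> Y \<in> Ob C \<Longrightarrow> Z \<in> Ob C \<Longrightarrow> f \<in> Hom C X Y \<Longrightarrow> g \<in> Hom C Y Z \<Longrightarrow>
    FArr F X Z (Comp C X Y Z g f) = FOb (CompF K (FOb F X) (FOb F Y) (FOb F Z)) (FArr F Y Z g, FArr F X Y f)"
  using is_functorD(3-6)[OF F] by (simp_all add: underlying_cat_def)

lemma category_pullback_hom: "X \<in> Ob C \<Longrightarrow> Y \<in> Ob C \<Longrightarrow> category (HomCat B X Y)"
  unfolding category_def pullback_simps
  by (simp add: categoryD[OF two_categoryD(1)[OF K]] F_simps)

lemma pullback_CompF:
  assumes ob: "X \<in> Ob C" "Y \<in> Ob C" "Z \<in> Ob C"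
  shows "is_functor (prod_cat (HomCat B Y Z) (HomCat B X Y)) (HomCat B X Z)
    (CompF B X Y Z)"
proof -
  let ?P = "prod_cat (HomCat B Y Z) (HomCat B X Y)"
  note G = two_categoryD(3)[OF K, OF F_simps(1)[OF ob(1)] F_simps(1)[OF ob(2)] F_simps(1)[OF ob(3)]]
  note C = is_functorD(1)[OF F]
  have c: "category ?P"
    using category_pullback_hom[OF ob(1,2)] category_pullback_hom[OF ob(2,3)] by (rule category_prod[rotated])
  have p: "(FArr F Y Z g, FArr F X Y f) \<in> Ob (prod_cat (HomCat K (FOb F Y) (FOb F Z)) (HomCat K (FOb F X) (FOb F Y)))"
    if "g \<in> Hom C Y Z" "f \<in> Hom C X Y" for f g
    using F_simps(2) ob that by (simp add: prod_cat_def)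
  show ?thesis
    unfolding is_functor_def
  proof (intro conjI c category_pullback_hom[OF ob(1,3)] ballI)
    fix x assume "x \<in> Ob ?P"
    then obtain g f where x: "x = (g, f)" "g \<in> Hom C Y Z" "f \<in> Hom C X Y"
      by (auto simp: prod_cat_def pullback_simps)
    show "FOb (CompF B X Y Z) x \<in> Ob (HomCat B X Z)"
      using categoryD(2)[OF C ob x(3,2)] by (simp add: x pullback_simps)
    show "FArr (CompF B X Y Z) x x (Id ?P x) =
        Id (HomCat B X Z) (FOb (CompF B X Y Z) x)"
      using is_functorD(5)[OF G p[OF x(2,3)]] F_simps(4)[OF ob x(3,2)] by (simp add: x pullback_simps prod_cat_def)
  next
    fix x x' a
    assume "x \<in> Ob ?P"
      and "x' \<in> Ob ?P"
      and a: "a \<in> Hom ?P x x'"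
    then obtain g f g' f' where x: "x = (g, f)" "g \<in> Hom C Y Z" "f \<in> Hom C X Y" "x' = (g', f')" "g' \<in> Hom C Y Z" "f' \<in> Hom C X Y"
      by (auto simp: prod_cat_def pullback_simps)
    show "FArr (CompF B X Y Z) x x' a \<in>
        Hom (HomCat B X Z) (FOb (CompF B X Y Z) x) (FOb (CompF B X Y Z) x')"
      using is_functorD(4)[OF G p[OF x(2,3)] p[OF x(5,6)], of a] a F_simps(4)[OF ob x(3,2)] F_simps(4)[OF ob x(6,5)]
      by (simp add: x pullback_simps prod_cat_def)
  next
    fix x x' x'' a b
    assume "x \<in> Ob ?P"
      and "x' \<in> Ob ?P"
      and "x'' \<in> Ob ?P"
      and a: "a \<in> Hom ?P x x'"
      and b: "b \<in> Hom ?P x' x''"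
    then obtain g f g' f' g'' f'' where x: "x = (g, f)" "g \<in> Hom C Y Z" "f \<in> Hom C X Y"
        "x' = (g', f')" "g' \<in> Hom C Y Z" "f' \<in> Hom C X Y" "x'' = (g'', f'')" "g'' \<in> Hom C Y Z" "f'' \<in> Hom C X Y"
      by (auto simp: prod_cat_def pullback_simps)
    obtain \<alpha> \<beta> \<alpha>' \<beta>' where ab: "a = (\<beta>, \<alpha>)" "b = (\<beta>', \<alpha>')" by (cases a, cases b)
    show "FArr (CompF B X Y Z) x x'' (Comp ?P x x' x'' b a) =
        Comp (HomCat B X Z) (FOb (CompF B X Y Z) x) (FOb (CompF B X Y Z) x') (FOb (CompF B X Y Z) x'')
          (FArr (CompF B X Y Z) x' x'' b) (FArr (CompF B X Y Z) x x' a)"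
      using is_functorD(6)[OF G p[OF x(2,3)] p[OF x(5,6)] p[OF x(8,9)], of a b] a b
        F_simps(4)[OF ob x(3,2)] F_simps(4)[OF ob x(6,5)] F_simps(4)[OF ob x(9,8)]
      by (simp add: x ab pullback_simps prod_cat_def)
  qed
qed

lemma two_category_pullback: "two_category B"
proof -
  note C = is_functorD(1)[OF F]
  show ?thesis
    unfolding two_category_def
  proof (intro conjI ballI, unfold pullback_simps, goal_cases)
    case (9 W X Y Z f g h f' g' h' \<alpha> \<beta> \<gamma>)
    note ob = 9(1-4) and m = 9(5-10) and c = 9(11-13)
    show ?case
      using two_categoryD(7)[OF K, OF F_simps(1)[OF ob(1)] F_simps(1)[OF ob(2)] F_simps(1)[OF ob(3)] F_simps(1)[OF ob(4)]
          F_simps(2)[OF ob(1,2) m(1)] F_simps(2)[OF ob(2,3) m(2)] F_simps(2)[OF ob(3,4) m(3)]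
          F_simps(2)[OF ob(1,2) m(4)] F_simps(2)[OF ob(2,3) m(5)] F_simps(2)[OF ob(3,4) m(6)] c]
      by (simp add: F_simps(4)[OF ob(1-3) m(1,2)] F_simps(4)[OF ob(1-3) m(4,5)]
          F_simps(4)[OF ob(2-4) m(2,3)] F_simps(4)[OF ob(2-4) m(5,6)])
  next
    case (6 X Y f f' \<alpha>)
    then show ?case using two_categoryD(5)[OF K] by (simp add: F_simps)
  next
    case (7 X Y f f' \<alpha>)
    then show ?case using two_categoryD(5)[OF K] by (simp add: F_simps)
  qed (use category_pullback_hom pullback_CompF categoryD[OF C] in simp_all)
qed

lemma is_functor_pullback_hom:
  "X \<in> Ob C \<Longrightarrow> Y \<in> Ob C \<Longrightarrow>
   is_functor (HomCat B X Y) (HomCat K (FOb F X) (FOb F Y)) (FHom pullback_functor X Y)"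
  unfolding is_functor_def
  by (simp add: category_pullback_hom two_categoryD(1)[OF K] F_simps pullback_simps pullback_functor_def)

lemma two_functor_pullback: "two_functor B K pullback_functor"
proof -
  have "F0 pullback_functor = FOb F" by (simp add: pullback_functor_def)
  then show ?thesis
    unfolding two_functor_def
    using K two_category_pullback is_functor_pullback_hom
    by (simp add: pullback_simps F_simps) (simp add: pullback_functor_def F_simps)
qed

lemma underlying_pullback:
  "underlying_cat B = \<lparr>Ob = Ob C, Hom = Hom C, Id = Id C, Comp = Comp C\<rparr>"
  by (simp add: underlying_cat_def pullback_simps)

lemma underlying_pullback_functor: "underlying_functor pullback_functor = F"
  by (simp add: underlying_functor_def pullback_functor_def)

lemma bicategorical_equivalence_pullback:
  assumes ess: "\<And>Z. Z \<in> Ob0 K \<Longrightarrow> \<exists>X\<in>Ob C. equivalent_objects K (FOb F X) Z"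
    and full: "\<And>X Y h. X \<in> Ob C \<Longrightarrow> Y \<in> Ob C \<Longrightarrow> h \<in> Ob (HomCat K (FOb F X) (FOb F Y)) \<Longrightarrow>
      \<exists>f\<in>Hom C X Y. isomorphic (HomCat K (FOb F X) (FOb F Y)) (FArr F X Y f) h"
  shows "bicategorical_equivalence B K pullback_functor"
  unfolding bicategorical_equivalence_def categorical_equivalence_def
  using two_functor_pullback ess full is_functor_pullback_hom
  by (simp add: pullback_simps pullback_functor_def bij_betw_def)

end

section \<open>Weak categorical equivalences between quasicategories\<close>

text \<open>
  The Yoneda argument: surjectivity of \<open>\<tau>\<^sub>0 [f, X]\<close> gives \<open>g\<close> with \<open>g f \<cong> 1\<close>, and injectivity of \<open>\<tau>\<^sub>0 [f, Y]\<close>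
  applied to \<open>f g f \<cong> f\<close> gives \<open>f g \<cong> 1\<close>. Both are available because \<open>X\<close> and \<open>Y\<close> are themselves
  quasicategories.
\<close>

lemma weak_cat_equiv_inverse:
  assumes X: "X \<in> Ob Qcat" and Y: "Y \<in> Ob Qcat" and w: "weak_cat_equiv X Y f"
  shows "\<exists>g\<in>sHom Y X. isomorphic (qcat_hom X X) (scomp X g f) (sid X) \<and> isomorphic (qcat_hom Y Y) (scomp Y f g) (sid Y)"
proof -
  note sX = Qcat_simplicial[OF X] and sY = Qcat_simplicial[OF Y]
  have f: "f \<in> sHom X Y" using w by (simp add: weak_cat_equiv_def)
  define cls where "cls A Z h = {u. isomorphic (tau1 (sexp A Z)) (sname A h) u}"
    for A Z :: "'a sset" and h
  have iso: "isomorphic (tau1 (sexp A Z)) (sname A h) (sname A h') = isomorphic (qcat_hom A Z) h h'"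
    if "simplicial_set A" "h \<in> sHom A Z" "h' \<in> sHom A Z" for A Z :: "'a sset" and h h'
    using sname_in[OF that(1,2)] sname_in[OF that(1,3)] that
    by (simp add: isomorphic_def inverse_arrows_def qcat_hom_simps)
  have eq: "cls A Z h = cls A Z h' \<longleftrightarrow> isomorphic (qcat_hom A Z) h h'"
    if "simplicial_set A" "h \<in> sHom A Z" "h' \<in> sHom A Z" for A Z :: "'a sset" and h h'
    unfolding iso[OF that, symmetric] cls_def
    using isomorphic_refl[OF category_tau1] sname_in[OF that(1,2)] sname_in[OF that(1,3)] isomorphic_sym isomorphic_trans[OF category_tau1]
    by (metis (no_types, lifting) Collect_cong Ob_tau1 mem_Collect_eq)
  have tau0: "tau0 (sexp A Z) = cls A Z ` sHom A Z" if "simplicial_set A" for A Z :: "'a sset"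
  proof -
    have "tau0 (sexp A Z) = (\<lambda>u. {y. isomorphic (tau1 (sexp A Z)) u y}) ` Simp (sexp A Z) 0"
      by (auto simp: tau0_def iso_classes_def quotient_def)
    then show ?thesis
      unfolding bij_betw_imp_surj_on[OF bij_betw_sname[OF that, of Z], symmetric] image_image cls_def .
  qed
  have map: "tau0_map (sexp X Z) (sexp_pre X Y f Z) (cls Y Z g) = cls X Z (scomp X g f)"
    if g: "g \<in> sHom Y Z" for Z g
  proof -
    note F = is_functor_tau1[OF simplicial_set_sexp[OF sY] simplicial_set_sexp[OF sX] sexp_pre_sHom[OF sX sY f, of Z]]
    have im: "isomorphic (tau1 (sexp X Z)) (sname X (scomp X g f)) (sexp_pre X Y f Z 0 u)"
      if "isomorphic (tau1 (sexp Y Z)) (sname Y g) u" for u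
      using isomorphic_functor[OF F that] by (simp add: sexp_pre_sname[OF sX sY f g])
    have refl: "isomorphic (tau1 (sexp Y Z)) (sname Y g) (sname Y g)"
      using isomorphic_refl[OF category_tau1] sname_in[OF sY g] by simp
    show ?thesis
    proof (intro equalityI subsetI)
      fix y assume "y \<in> tau0_map (sexp X Z) (sexp_pre X Y f Z) (cls Y Z g)"
      then obtain u where "isomorphic (tau1 (sexp Y Z)) (sname Y g) u" "isomorphic (tau1 (sexp X Z)) (sexp_pre X Y f Z 0 u) y"
        unfolding tau0_map_def cls_def by auto
      then show "y \<in> cls X Z (scomp X g f)"
        using isomorphic_trans[OF category_tau1 im] unfolding cls_def by simp
    next
      fix y assume "y \<in> cls X Z (scomp X g f)"
      then show "y \<in> tau0_map (sexp X Z) (sexp_pre X Y f Z) (cls Y Z g)"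
        unfolding tau0_map_def cls_def using refl sexp_pre_sname[OF sX sY f g] by (intro UN_I[of "sname Y g"]) simp_all
    qed
  qed
  have bij: "bij_betw (tau0_map (sexp X Z) (sexp_pre X Y f Z)) (cls Y Z ` sHom Y Z) (cls X Z ` sHom X Z)"
    if "Z \<in> Ob Qcat" for Z
    using w that by (simp add: weak_cat_equiv_def Ob_Qcat tau0[OF sX] tau0[OF sY])
  have "cls X X (sid X) \<in> tau0_map (sexp X X) (sexp_pre X Y f X) ` cls Y X ` sHom Y X"
    using bij_betw_imp_surj_on[OF bij[OF X]] sid_sHom[OF sX] by blast
  then obtain g where g: "g \<in> sHom Y X" "cls X X (sid X) = cls X X (scomp X g f)"
    using map by auto
  have gf: "isomorphic (qcat_hom X X) (scomp X g f) (sid X)"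
    using eq[OF sX scomp_sHom[OF sX f g(1)] sid_sHom[OF sX]] g(2) by simp
  have "isomorphic (qcat_hom X Y) (scomp X f (scomp X g f)) (scomp X f (sid X))"
    using isomorphic_functor[OF is_functor_qcat_post[OF sX sX f] gf] by (simp add: qcat_post_def)
  then have "isomorphic (qcat_hom X Y) (scomp X (scomp Y f g) f) (scomp X (sid Y) f)"
    by (simp add: scomp_assoc[OF f] scomp_sid[OF f])
  then have "cls X Y (scomp X (scomp Y f g) f) = cls X Y (scomp X (sid Y) f)"
    using eq[OF sX scomp_sHom[OF sX f scomp_sHom[OF sY g(1) f]] scomp_sHom[OF sX f sid_sHom[OF sY]]] by simp
  then have "cls Y Y (scomp Y f g) = cls Y Y (sid Y)"
    using inj_onD[OF bij_betw_imp_inj_on[OF bij[OF Y]], of "cls Y Y (scomp Y f g)" "cls Y Y (sid Y)"]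
      map[OF scomp_sHom[OF sY g(1) f]] map[OF sid_sHom[OF sY]] scomp_sHom[OF sY g(1) f] sid_sHom[OF sY] by simp
  then have "isomorphic (qcat_hom Y Y) (scomp Y f g) (sid Y)"
    using eq[OF sY scomp_sHom[OF sY g(1) f] sid_sHom[OF sY]] by simp
  then show ?thesis using g gf by blast
qed

lemma Qcat_simps: "Hom Qcat = sHom" "Id Qcat = sid" "Comp Qcat X Y Z g f = scomp X g f" "Weq Qcat X Y = {f. weak_cat_equiv X Y f}"
  by (simp_all add: Qcat_def sSet_def full_subcat_def)

lemma category_Qcat: "category (Qcat :: ('u::universe sset, _) relcat)"
  using category_underlying[OF two_category_QCAT[where 'a = 'u]] unfolding underlying_cat_QCAT
  by (simp add: category_def cat.truncate_def)

lemma relative_category_Qcat: "relative_category Qcat"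
  using category_Qcat by (auto simp: relative_category_def arrow_class_def Qcat_simps weak_cat_equiv_def)

text \<open>
  Weak categorical equivalences become invertible in the homotopy category of the 2-category, so the
  universal property of the localisation applies. In particular, morphisms that are equal in \<open>Ho Qcat\<close> are
  isomorphic as 1-cells.
\<close>

lemma Ho_Qcat_to_hcat:
  "\<exists>H. is_functor (Ho Qcat) (hcat (QCAT :: ('u::universe sset, ('u, 'u) smap, ('u, 'u) two_cell) two_cat)) H \<and>
    (\<forall>X\<in>Ob Qcat. FOb H X = X) \<and>
    (\<forall>X\<in>Ob Qcat. \<forall>Y\<in>Ob Qcat. \<forall>f\<in>sHom X Y. FArr H X Y (ho_arr Qcat X Y f) = iso_class QCAT X Y f)"
proof -
  let ?K = "QCAT :: ('u sset, ('u, 'u) smap, ('u, 'u) two_cell) two_cat"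
  note K = two_category_QCAT[where 'a = 'u]
  define G where "G = \<lparr>FOb = (\<lambda>X. X), FArr = iso_class ?K\<rparr>"
  have G: "is_functor Qcat (hcat ?K) G"
    unfolding is_functor_def
    using category_Qcat[where 'u = 'u] category_hcat[OF K] hcat_Comp[OF K]
    by (auto simp: G_def hcat_simps[OF K] QCAT_simps Qcat_simps qcat_hom_simps FOb_qcat_comp)
  have "\<exists>v. inverse_arrows (hcat ?K) (FOb G X) (FOb G Y) (FArr G X Y w) v"
    if ob: "X \<in> Ob Qcat" "Y \<in> Ob Qcat" and w: "w \<in> Weq Qcat X Y" for X Y w
  proof -
    have wH: "w \<in> sHom X Y" using w by (simp add: Qcat_simps weak_cat_equiv_def)
    obtain g where g: "g \<in> sHom Y X" and iso: "isomorphic (qcat_hom X X) (scomp X g w) (sid X)" "isomorphic (qcat_hom Y Y) (scomp Y w g) (sid Y)"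
      using weak_cat_equiv_inverse[OF ob] w by (auto simp: Qcat_simps)
    note sX = Qcat_simplicial[OF ob(1)] and sY = Qcat_simplicial[OF ob(2)]
    have "inverse_arrows (hcat ?K) X Y (iso_class ?K X Y w) (iso_class ?K Y X g)"
      using ob wH g iso hcat_Comp[OF K, of X Y X w g] hcat_Comp[OF K, of Y X Y g w]
        iso_class_eq_iff[OF K, of X X "scomp X g w" "sid X"] iso_class_eq_iff[OF K, of Y Y "scomp Y w g" "sid Y"]
        scomp_sHom[OF sX wH g] scomp_sHom[OF sY g wH]
      by (simp add: inverse_arrows_def hcat_simps[OF K] QCAT_simps qcat_hom_simps FOb_qcat_comp)
    then show ?thesis by (auto simp: G_def)
  qed
  from Ho_localisation(3)[OF relative_category_Qcat G this] show ?thesis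
    by (simp add: G_def Qcat_simps)
qed

text \<open>
  Every object is cofibrant: an initial simplicial set maps to the empty one and so has no simplices. Any
  two parallel maps into it are therefore equal, and every map out of it is a monomorphism.
\<close>

lemma cf_subcat_joyal:
  assumes J: "joyal_model_structure J"
  shows "cf_subcat J = Qcat"
proof -
  have sset: "relcat.truncate J = sSet" and cof: "\<forall>X\<in>Ob J. \<forall>Y\<in>Ob J. Cof J X Y = {f. monomorphism J X Y f}"
    and fib: "\<forall>X\<in>Ob J. fibrant J X \<longleftrightarrow> quasicategory X"
    using J by (simp_all add: joyal_model_structure_def)
  have J_simps: "Ob J = {X. small_sset X}" "Hom J = sHom" "Comp J = (\<lambda>X Y Z g f. scomp X g f)"
    using sset by (simp_all add: relcat.truncate_def sSet_def)
  define E :: "'a sset" where "E = \<lparr>Simp = (\<lambda>_. {}), Act = (\<lambda>m n \<theta>. (\<lambda>_. undefined))\<rparr>"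
  have E: "E \<in> Ob J" by (auto simp: J_simps small_sset_def simplicial_set_def E_def small_empty extensional_def PiE_def)
  have "cofibrant J X" if X: "X \<in> Ob J" for X
    unfolding cofibrant_def
  proof (intro conjI allI impI subsetI X)
    fix I i assume I: "initial J I" and i: "i \<in> Hom J I X"
    have IO: "I \<in> Ob J" using I by (simp add: initial_def)
    obtain e where "e \<in> sHom I E" using I E unfolding initial_def J_simps(2) by metis
    then have empty: "Simp I n = {}" for n using sHomD(1)[of e I E _ n] by (auto simp: E_def)
    have "monomorphism J I X i"
      unfolding monomorphism_def J_simps
    proof (intro conjI ballI impI)
      show "i \<in> sHom I X" using i by (simp add: J_simps)
      fix T u v assume u: "u \<in> sHom T I" and v: "v \<in> sHom T I"
      show "u = v" using sHomD(1)[OF u] empty by (intro sHom_eqI[OF u v]) auto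
    qed
    then show "i \<in> Cof J I X" using cof IO X by simp
  qed
  then have "{X \<in> Ob J. cofibrant J X \<and> fibrant J X} = {X \<in> Ob (relcat.truncate J). quasicategory X}"
    using fib by (auto simp: relcat.truncate_def)
  then show ?thesis
    unfolding cf_subcat_def Qcat_def full_subcat_def sset[symmetric] by (simp add: relcat.truncate_def)
qed

section \<open>Bicategorical models of quasicategories\<close>

text \<open>
  For the functor \<open>F\<close> obtained from the zigzag, surjectivity on objects and 1-cells is read off from \<open>Ho F\<close>: a
  morphism \<open>h : F X \<rightarrow> F Y\<close> is the image of some arrow of \<open>Ho\<close>, that arrow comes from some \<open>f : X \<rightarrow> Y\<close>, and \<open>F f\<close>
  and \<open>h\<close>, being equal in \<open>Ho Qcat\<close>, are isomorphic.
\<close>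

theorem corollary2p17:
  fixes M :: "('o, 'm) model_cat"
    and Ps :: "('p, 'n) model_cat list"
    and J :: "('u::universe sset, ('u, 'u) smap) model_cat"
  assumes "model_category TYPE('u) M"
    and "joyal_model_structure J"
    and "quillen_zigzag TYPE('u) M Ps J"
  shows "\<exists>(\<MM> :: ('o, 'm, ('u, 'u) two_cell) two_cat)
      (Ft :: ('o, 'm, ('u, 'u) two_cell, 'u sset, ('u, 'u) smap, ('u, 'u) two_cell) two_fctr).
    two_category \<MM> \<and> two_functor \<MM> QCAT Ft \<and>
    bicategorical_equivalence \<MM> QCAT Ft \<and>
    underlying_cat \<MM> = cat.truncate (cf_subcat M) \<and>
    (let F = underlying_functor Ft in
      is_functor (cf_subcat M) Qcat F \<and>
      preserves_weq (cf_subcat M) Qcat F \<and>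
      categorical_equivalence (Ho (cf_subcat M)) (Ho Qcat) (Ho_functor Qcat F))"
proof -
  interpret model "TYPE('u)" M by unfold_locales (fact assms(1))
  let ?C = "cf_subcat M"
  let ?K = "QCAT :: ('u sset, ('u, 'u) smap, ('u, 'u) two_cell) two_cat"
  note K = two_category_QCAT[where 'a = 'u]
  obtain F where ho: "ho_equivalence ?C (Qcat :: ('u sset, ('u, 'u) smap) relcat) F"
    using quillen_zigzag_ho_equivalence[OF assms(3)] unfolding cf_subcat_joyal[OF assms(2)] by blast
  then have F: "is_functor ?C Qcat F" "preserves_weq ?C Qcat F"
    and eqv: "categorical_equivalence (Ho ?C) (Ho Qcat) (Ho_functor Qcat F)" by (simp_all add: ho_equivalence_def)
  note HF = Ho_functor_induced[OF relative_category_cf relative_category_Qcat F]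
  have FK: "is_functor ?C (underlying_cat ?K) F"
    using F(1) category_underlying[OF K] unfolding underlying_cat_QCAT by (simp add: is_functor_def cat.truncate_def)
  obtain H where H: "is_functor (Ho Qcat) (hcat ?K) H" "\<And>X. X \<in> Ob Qcat \<Longrightarrow> FOb H X = X"
    "\<And>X Y f. X \<in> Ob Qcat \<Longrightarrow> Y \<in> Ob Qcat \<Longrightarrow> f \<in> sHom X Y \<Longrightarrow> FArr H X Y (ho_arr Qcat X Y f) = iso_class ?K X Y f"
    using Ho_Qcat_to_hcat[where 'u = 'u] by blast
  have ess: "\<exists>X\<in>Ob ?C. equivalent_objects ?K (FOb F X) Z" if Z: "Z \<in> Ob0 ?K" for Z
  proof -
    have ZQ: "Z \<in> Ob Qcat" using Z by (simp add: QCAT_simps)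
    then have "Z \<in> Ob (Ho Qcat)" by simp
    from categorical_equivalenceD(3)[OF eqv this] obtain X
      where X: "X \<in> Ob ?C" "isomorphic (Ho Qcat) (FOb F X) Z" using HF(2) by auto
    show ?thesis
      using isomorphic_functor[OF H(1) X(2)] H(2)[OF ZQ] H(2)[OF is_functorD(3)[OF F(1) X(1)]] equivalent_objects_hcat[OF K] X(1)
      by auto
  qed
  have full: "\<exists>f\<in>Hom ?C X Y. isomorphic (HomCat ?K (FOb F X) (FOb F Y)) (FArr F X Y f) h"
    if X: "X \<in> Ob ?C" and Y: "Y \<in> Ob ?C" and h: "h \<in> Ob (HomCat ?K (FOb F X) (FOb F Y))" for X Y h
  proof -
    note FX = is_functorD(3)[OF F(1) X] and FY = is_functorD(3)[OF F(1) Y]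
    have hH: "h \<in> sHom (FOb F X) (FOb F Y)" using h by (simp add: QCAT_simps qcat_hom_simps)
    then have "ho_arr Qcat (FOb F X) (FOb F Y) h \<in> Hom (Ho Qcat) (FOb F X) (FOb F Y)"
      by (intro ho_arr_Hom[OF relative_category_Qcat FX FY]) (simp add: Qcat_simps)
    then have "ho_arr Qcat (FOb F X) (FOb F Y) h \<in> FArr (Ho_functor Qcat F) X Y ` Hom (Ho ?C) X Y"
      using bij_betw_imp_surj_on[OF categorical_equivalenceD(2)[OF eqv, of X Y]] X Y HF(2) by simp
    then obtain c where c: "c \<in> Hom (Ho ?C) X Y" "ho_arr Qcat (FOb F X) (FOb F Y) h = FArr (Ho_functor Qcat F) X Y c"
      by (elim imageE)
    obtain f where f: "f \<in> Hom ?C X Y" "ho_arr ?C X Y f = c" using unit_fullD[OF unit_full_cf X Y c(1)] by blast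
    have fH: "FArr F X Y f \<in> sHom (FOb F X) (FOb F Y)" using is_functorD(4)[OF F(1) X Y f(1)] by (simp add: Qcat_simps)
    have "iso_class ?K (FOb F X) (FOb F Y) (FArr F X Y f) = iso_class ?K (FOb F X) (FOb F Y) h"
      using HF(3)[OF X Y f(1)] f(2) c(2) H(3)[OF FX FY fH] H(3)[OF FX FY hH] by simp
    then show ?thesis
      using iso_class_eq_iff[OF K, of "FOb F X" "FOb F Y" "FArr F X Y f" h] FX FY fH f(1)
      by (auto simp: QCAT_simps qcat_hom_simps)
  qed
  let ?Ft = "pullback_functor F :: ('o, 'm, ('u, 'u) two_cell, 'u sset, ('u, 'u) smap, ('u, 'u) two_cell) two_fctr"
  show ?thesis
  proof (intro exI conjI)
    show "two_category (pullback_cat ?K ?C F)" by (rule two_category_pullback[OF K FK])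
    show "two_functor (pullback_cat ?K ?C F) QCAT ?Ft" by (rule two_functor_pullback[OF K FK])
    show "bicategorical_equivalence (pullback_cat ?K ?C F) QCAT ?Ft"
      by (rule bicategorical_equivalence_pullback[OF K FK ess full])
    show "underlying_cat (pullback_cat ?K ?C F) = cat.truncate ?C"
      unfolding underlying_pullback[OF K FK] by (simp add: cat.truncate_def)
    show "let F = underlying_functor ?Ft in is_functor ?C Qcat F \<and> preserves_weq ?C Qcat F \<and>
      categorical_equivalence (Ho ?C) (Ho Qcat) (Ho_functor Qcat F)"
      using F eqv by (simp add: underlying_pullback_functor[OF K FK] Let_def)
  qed
qed

end
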